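(* Suppose that $(\mathrm{WM})_{p,\boldsymbol{k}}$ holds, with constant $C\in[1,\infty)$. Then any sequence $\{\tilde r_n\}_{n\in\mathbb{N}}\subseteq(0,\infty)$ with $\tilde r_n\to 0$ has a subsequence $\{r_n\}_{n\in\mathbb{N}}$ such that the following limit exists in $[0,\infty)$ for any $f\in B_{p,\infty}^{\boldsymbol{k}}$: $$\mathcal{E}_p^{\boldsymbol{k}}(f):=\lim_{n\to\infty}J_{p,r_n}^{\boldsymbol{k}}(f).\qquad( * )$$ Moreover, for any such $\{r_n\}_{n\in\mathbb{N}}$, the functional $\mathcal{E}_p^{\boldsymbol{k}}\colon B_{p,\infty}^{\boldsymbol{k}}\to[0,\infty)$ defined by $( * )$ satisfies the following properties. (a) $(\mathcal{E}_p^{\boldsymbol{k}},B_{p,\infty}^{\boldsymbol{k}})$ is a $p$-energy form on $(K,m)$ such that, with the same $C$ as in $(\mathrm{WM})_{p,\boldsymbol{k}}$, $$C^{-1}\sup_{r>0}J_{p,r}^{\boldsymbol{k}}(f)\le\mathcal{E}_p^{\boldsymbol{k}}(f)\le C\liminf_{r\downarrow0}J_{p,r}^{\boldsymbol{k}}(f)\quad\text{for any } f\in B_{p,\infty}^{\boldsymbol{k}}.$$ In particular, if $m(K)<\infty$, then $\mathbf{1}_K\in B_{p,\infty}^{\boldsymbol{k}}$ and $\mathcal{E}_p^{\boldsymbol{k}}(\mathbf{1}_K)=0$. (b) $(\mathcal{E}_p^{\boldsymbol{k}},B_{p,\infty}^{\boldsymbol{k}})$ satisfies $(\mathrm{GC})_p$.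 Furthermore, for any $f,g\in B_{p,\infty}^{\boldsymbol{k}}$, $\{J_{p,r_n}^{\boldsymbol{k}}(f;g)\}_{n}$ is convergent in $\mathbb{R}$ and $\mathcal{E}_p^{\boldsymbol{k}}(f;g)=\lim_{n\to\infty}J_{p,r_n}^{\boldsymbol{k}}(f;g)$. (c) Let $n_1,n_2\in\mathbb{N}$, $q_1\in(0,p]$, $q_2\in[p,\infty]$, $\boldsymbol{u}=(u_1,\dots,u_{n_1})\in(B_{p,\infty}^{\boldsymbol{k}})^{n_1}$ and $\boldsymbol{v}=(v_1,\dots,v_{n_2})\in L^p(K,m)^{n_2}$. If $\|\boldsymbol{v}(x)-\boldsymbol{v}(y)\|_{\ell^{q_2}}\le\|\boldsymbol{u}(x)-\boldsymbol{u}(y)\|_{\ell^{q_1}}$ for $m\times m$-a.e. $(x,y)\in K\times K$, then $\boldsymbol{v}\in(B_{p,\infty}^{\boldsymbol{k}})^{n_2}$ and $$\bigl\|\bigl(\mathcal{E}_p^{\boldsymbol{k}}(v_l)^{1/p}\bigr)_{l=1}^{n_2}\bigr\|_{\ell^{q_2}}\le\bigl\|\bigl(\mathcal{E}_p^{\boldsymbol{k}}(u_k)^{1/p}\bigr)_{k=1}^{n_1}\bigr\|_{\ell^{q_1}}.$$ (d) There exists $C_p\in(0,\infty)$ determined solely and explicitly by $p$ such that for any $f_1,f_2,g\in B_{p,\infty}^{\boldsymbol{k}}$, $$|\mathcal{E}_p^{\boldsymbol{k}}(f_1;g)-\mathcal{E}_p^{\boldsymbol{k}}(f_2;g)|\le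 C_p\Bigl[\max_{i\in\{1,2\}}\mathcal{E}_p^{\boldsymbol{k}}(f_i)\Bigr]^{\frac{(p-2)^+}{p}}\mathcal{E}_p^{\boldsymbol{k}}(f_1-f_2)^{\frac{(p-1)\wedge1}{p}}\mathcal{E}_p^{\boldsymbol{k}}(g)^{\frac1p}.$$ (e) Suppose that $\boldsymbol{k}$ is asymptotically local. (i) Let $f_1,f_2,g\in B_{p,\infty}^{\boldsymbol{k}}$. If for some $a_1,a_2\in\mathbb{R}$ we have $\operatorname{supp}_m[f_1-a_1\mathbf{1}_K]\cap\operatorname{supp}_m[f_2-a_2\mathbf{1}_K]=\emptyset$ and either $\operatorname{supp}_m[f_1-a_1\mathbf{1}_K]$ or $\operatorname{supp}_m[f_2-a_2\mathbf{1}_K]$ is compact, then $$\mathcal{E}_p^{\boldsymbol{k}}(f_1+f_2+g)+\mathcal{E}_p^{\boldsymbol{k}}(g)=\mathcal{E}_p^{\boldsymbol{k}}(f_1+g)+\mathcal{E}_p^{\boldsymbol{k}}(f_2+g),\qquad \mathcal{E}_p^{\boldsymbol{k}}(f_1+f_2;g)=\mathcal{E}_p^{\boldsymbol{k}}(f_1;g)+\mathcal{E}_p^{\boldsymbol{k}}(f_2;g).$$ (ii) Let $f_1,f_2,g\in B_{p,\infty}^{\boldsymbol{k}}$. If for some $a,b\in\mathbb{R}$ we have $\operatorname{supp}_m[f_1-f_2-a\mathbf{1}_K]\cap\operatorname{supp}_m[g-b\mathbf{1}_K]=\emptyset$ and either $\operatorname{supp}_m[f_1-f_2-a\mathbf{1}_K]$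 or $\operatorname{supp}_m[g-b\mathbf{1}_K]$ is compact, then $\mathcal{E}_p^{\boldsymbol{k}}(f_1;g)=\mathcal{E}_p^{\boldsymbol{k}}(f_2;g)$ and $\mathcal{E}_p^{\boldsymbol{k}}(g;f_1)=\mathcal{E}_p^{\boldsymbol{k}}(g;f_2)$. (f) Let $T\colon K\to K$ be Borel measurable and preserve $m$, i.e., $T^{-1}(A)\in\mathcal{B}(K)$ and $m(T^{-1}(A))=m(A)$ for any $A\in\mathcal{B}(K)$. If $\boldsymbol{k}$ is $T$-invariant, i.e., $k_r(T(x),T(y))=k_r(x,y)$ for $m\times m$-a.e. $(x,y)\in K\times K$ for each $r\in(0,\infty)$, then $f\circ T\in B_{p,\infty}^{\boldsymbol{k}}$ and $\mathcal{E}_p^{\boldsymbol{k}}(f\circ T)=\mathcal{E}_p^{\boldsymbol{k}}(f)$ for any $f\in B_{p,\infty}^{\boldsymbol{k}}$.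
   Context: Setting. $p\in(1,\infty)$; $(K,d)$ is a separable metric space with at least two points; $m$ is a $\sigma$-finite Borel measure on $K$ with full topological support (strictly positive on every non-empty open set); $\mathcal{B}(K)$ is the Borel $\sigma$-algebra; $B_d(x,r)=\{y\in K: d(x,y)<r\}$. $\boldsymbol{k}=\{k_r\}_{r>0}$ is a family of $[0,\infty]$-valued Borel measurable functions on $K\times K$. Notation: $a\wedge b=\min\{a,b\}$, $a^+=\max\{a,0\}$; $\mathbf{1}_K$ is the constant function $1$; $\|x\|_{\ell^q}=(\sum_k|x_k|^q)^{1/q}$ for $q\in(0,\infty)$ and $\|x\|_{\ell^\infty}=\max_k|x_k|$; $\operatorname{supp}_m[f]$ is the smallest closed $F\subseteq K$ with $\int_{K\setminus F}|f|\,dm=0$. For $f\in L^p(K,m)$ and $r>0$, $$J_{p,r}^{\boldsymbol{k}}(f)=\int_K\int_K|f(x)-f(y)|^p k_r(x,y)\,m(dy)\,m(dx)\in[0,\infty],$$ $D(J_{p,r}^{\boldsymbol{k}})=\{f\in L^p(K,m):J_{p,r}^{\boldsymbol{k}}(f)<\infty\}$, and $B_{p,\infty}^{\boldsymbol{k}}=\{f\in L^p(K,m):\sup_{r>0}J_{p,r}^{\boldsymbol{k}}(f)<\infty\}$. $(\mathrm{WM})_{p,\boldsymbol{k}}$ (weak monotonicity) holds if there is $C\in[1,\infty)$ with $\sup_{r>0}J_{p,r}^{\boldsymbol{k}}(f)\le C\liminf_{r\downarrow0}J_{p,r}^{\boldsymbol{k}}(f)$ for all $f\in B_{p,\infty}^{\boldsymbol{k}}$.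 $\boldsymbol{k}$ is asymptotically local if there is $\{\delta(r)\}_{r>0}\subseteq(0,\infty)$ with $\lim_{r\downarrow0}\delta(r)=0$ and $\lim_{r\downarrow0}\int_K\int_{K\setminus B_d(x,\delta(r))}k_r(x,y)\,m(dy)\,m(dx)=0$. Energy forms. Let $\mathcal{F}$ be a linear subspace of the space $L^0(K,m)$ of $m$-equivalence classes of real-valued measurable functions, and $\mathcal{E}\colon\mathcal{F}\to[0,\infty)$ with $\mathcal{E}(au)=|a|^p\mathcal{E}(u)$. $(\mathcal{E},\mathcal{F})$ is a $p$-energy form on $(K,m)$ if $\mathcal{E}^{1/p}$ is a seminorm on $\mathcal{F}$. It satisfies $(\mathrm{GC})_p$ (generalized $p$-contraction property) if: whenever $n_1,n_2\in\mathbb{N}$, $q_1\in(0,p]$, $q_2\in[p,\infty]$ and $T=(T_1,\dots,T_{n_2})\colon\mathbb{R}^{n_1}\to\mathbb{R}^{n_2}$ satisfies $T(0)=0$ and $\|T(x)-T(y)\|_{\ell^{q_2}}\le\|x-y\|_{\ell^{q_1}}$ for all $x,y$, then for all $\boldsymbol{u}=(u_1,\dots,u_{n_1})\in\mathcal{F}^{n_1}$ one has $T(\boldsymbol{u})\in\mathcal{F}^{n_2}$ and $\|(\mathcal{E}(T_l(\boldsymbol{u}))^{1/p})_{l=1}^{n_2}\|_{\ell^{q_2}}\le\|(\mathcal{E}(u_k)^{1/p})_{k=1}^{n_1}\|_{\ell^{q_1}}$. If $(\mathcal{E},\mathcal{F})$ satisfies $(\mathrm{GC})_p$, then $t\mapsto\mathcal{E}(u+tv)$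 is differentiable for $u,v\in\mathcal{F}$, and one sets $\mathcal{E}(u;v):=\frac1p\frac{d}{dt}\mathcal{E}(u+tv)\big|_{t=0}$. Each $(J_{p,r}^{\boldsymbol{k}},D(J_{p,r}^{\boldsymbol{k}}))$ satisfies $(\mathrm{GC})_p$, and $J_{p,r}^{\boldsymbol{k}}(f;g)=\int_K\int_K\operatorname{sgn}(f(x)-f(y))|f(x)-f(y)|^{p-1}(g(x)-g(y))k_r(x,y)\,m(dy)\,m(dx)$. *)

theory Defs
  imports "HOL-Analysis.Analysis"
begin

text \<open>
  The separable metric space K is a type of class \<open>metric_space\<close> and
  \<open>second_countable_topology\<close>; for metric spaces second countability is separability.
  Elements of \<open>L\<^sup>0(K,m)\<close> and \<open>L\<^sup>p(K,m)\<close> are represented by measurable functions, and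
  \<open>p_energy_form\<close> requires domain and functional to be invariant under a.e. equality, so that
  they descend to equivalence classes.
\<close>

definition Lp_fun :: "real \<Rightarrow> 'a measure \<Rightarrow> ('a \<Rightarrow> real) set" where
  "Lp_fun p m = {f \<in> borel_measurable m. (\<integral>\<^sup>+x. ennreal (\<bar>f x\<bar> powr p) \<partial>m) < \<infinity>}"

definition admissible_measure :: "'a::metric_space measure \<Rightarrow> bool" where
  "admissible_measure m \<longleftrightarrow>
     sets m = sets borel \<and> sigma_finite_measure m \<and>
     (\<forall>U. open U \<longrightarrow> U \<noteq> {} \<longrightarrow> 0 < emeasure m U)"

text \<open>
  A family of kernels is a function on all of the reals of which only the values at
  \<open>r > 0\<close> are ever used.  Products in \<open>ennreal\<close> follow the convention \<open>0 * \<infinity> = 0\<close>.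
\<close>

definition kernel_family :: "(real \<Rightarrow> 'a::metric_space \<Rightarrow> 'a \<Rightarrow> ennreal) \<Rightarrow> bool" where
  "kernel_family k \<longleftrightarrow> (\<forall>r>0. (\<lambda>(x, y). k r x y) \<in> borel_measurable borel)"

definition J :: "real \<Rightarrow> 'a measure \<Rightarrow> (real \<Rightarrow> 'a \<Rightarrow> 'a \<Rightarrow> ennreal) \<Rightarrow> real \<Rightarrow> ('a \<Rightarrow> real) \<Rightarrow> ennreal"
  where
  "J p m k r f = (\<integral>\<^sup>+x. (\<integral>\<^sup>+y. ennreal (\<bar>f x - f y\<bar> powr p) * k r x y \<partial>m) \<partial>m)"

definition B_space :: "real \<Rightarrow> 'a measure \<Rightarrow> (real \<Rightarrow> 'a \<Rightarrow> 'a \<Rightarrow> ennreal) \<Rightarrow> ('a \<Rightarrow> real) set" where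
  "B_space p m k = {f \<in> Lp_fun p m. (SUP r\<in>{0<..}. J p m k r f) < \<infinity>}"

definition weak_monotonicity ::
  "real \<Rightarrow> 'a measure \<Rightarrow> (real \<Rightarrow> 'a \<Rightarrow> 'a \<Rightarrow> ennreal) \<Rightarrow> real \<Rightarrow> bool" where
  "weak_monotonicity p m k C \<longleftrightarrow>
     1 \<le> C \<and>
     (\<forall>f\<in>B_space p m k.
        (SUP r\<in>{0<..}. J p m k r f) \<le> ennreal C * Liminf (at_right 0) (\<lambda>r. J p m k r f))"

definition asymptotically_local ::
  "'a::metric_space measure \<Rightarrow> (real \<Rightarrow> 'a \<Rightarrow> 'a \<Rightarrow> ennreal) \<Rightarrow> bool" where
  "asymptotically_local m k \<longleftrightarrow>
     (\<exists>\<delta>::real \<Rightarrow> real.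
        (\<forall>r>0. 0 < \<delta> r) \<and>
        (\<delta> \<longlongrightarrow> 0) (at_right 0) \<and>
        ((\<lambda>r. \<integral>\<^sup>+x. (\<integral>\<^sup>+y\<in>- ball x (\<delta> r). k r x y \<partial>m) \<partial>m) \<longlongrightarrow> 0) (at_right 0))"

definition supp_m :: "'a::metric_space measure \<Rightarrow> ('a \<Rightarrow> real) \<Rightarrow> 'a set" where
  "supp_m m f = (LEAST F. closed F \<and> (\<integral>\<^sup>+x\<in>- F. ennreal \<bar>f x\<bar> \<partial>m) = 0)"

text \<open>
  The length-\<open>n\<close> vector \<open>(x 0, \<dots>, x (n - 1))\<close> is given by a function on \<open>nat\<close>, whose
  other values are ignored.
\<close>

definition lq_norm :: "nat \<Rightarrow> ereal \<Rightarrow> (nat \<Rightarrow> real) \<Rightarrow> real" where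
  "lq_norm n q x =
     (if q = \<infinity> then Max ((\<lambda>i. \<bar>x i\<bar>) ` {..<n})
      else (\<Sum>i<n. \<bar>x i\<bar> powr real_of_ereal q) powr (1 / real_of_ereal q))"

definition p_energy_form ::
  "real \<Rightarrow> 'a measure \<Rightarrow> ('a \<Rightarrow> real) set \<Rightarrow> (('a \<Rightarrow> real) \<Rightarrow> real) \<Rightarrow> bool" where
  "p_energy_form p m F E \<longleftrightarrow>
     F \<subseteq> borel_measurable m \<and>
     (\<forall>u\<in>F. \<forall>v\<in>borel_measurable m. (AE x in m. u x = v x) \<longrightarrow> v \<in> F \<and> E v = E u) \<and>
     (\<lambda>_. 0) \<in> F \<and>
     (\<forall>u\<in>F. \<forall>v\<in>F. (\<lambda>x. u x + v x) \<in> F) \<and>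
     (\<forall>a. \<forall>u\<in>F. (\<lambda>x. a * u x) \<in> F) \<and>
     (\<forall>u\<in>F. 0 \<le> E u) \<and>
     (\<forall>a. \<forall>u\<in>F. E (\<lambda>x. a * u x) = \<bar>a\<bar> powr p * E u) \<and>
     (\<forall>u\<in>F. \<forall>v\<in>F. E (\<lambda>x. u x + v x) powr (1 / p) \<le> E u powr (1 / p) + E v powr (1 / p))"

text \<open>
  \<open>T\<close> is given on functions on \<open>nat\<close>; the contraction hypothesis forces the first \<open>n2\<close>
  components of \<open>T x\<close> to depend only on the first \<open>n1\<close> components of \<open>x\<close>, so that \<open>T\<close> is
  a map between the n1- and the n2-dimensional real coordinate spaces.
\<close>

definition GC :: "real \<Rightarrow> ('a \<Rightarrow> real) set \<Rightarrow> (('a \<Rightarrow> real) \<Rightarrow> real) \<Rightarrow> bool" where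
  "GC p F E \<longleftrightarrow>
     (\<forall>(n1::nat) (n2::nat) (q1::real) (q2::ereal)
        (T::(nat \<Rightarrow> real) \<Rightarrow> nat \<Rightarrow> real) (u::nat \<Rightarrow> 'a \<Rightarrow> real).
        1 \<le> n1 \<longrightarrow> 1 \<le> n2 \<longrightarrow> 0 < q1 \<longrightarrow> q1 \<le> p \<longrightarrow> ereal p \<le> q2 \<longrightarrow>
        (\<forall>l<n2. T (\<lambda>_. 0) l = 0) \<longrightarrow>
        (\<forall>x y. lq_norm n2 q2 (\<lambda>l. T x l - T y l) \<le> lq_norm n1 (ereal q1) (\<lambda>i. x i - y i)) \<longrightarrow>
        (\<forall>i<n1. u i \<in> F) \<longrightarrow>
        (\<forall>l<n2. (\<lambda>z. T (\<lambda>i. u i z) l) \<in> F) \<and>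
        lq_norm n2 q2 (\<lambda>l. E (\<lambda>z. T (\<lambda>i. u i z) l) powr (1 / p))
          \<le> lq_norm n1 (ereal q1) (\<lambda>i. E (u i) powr (1 / p)))"

text \<open>The two-variable form \<open>E(u;v)\<close>, for \<open>E\<close> differentiable along lines.\<close>

definition form_deriv ::
  "real \<Rightarrow> (('a \<Rightarrow> real) \<Rightarrow> real) \<Rightarrow> ('a \<Rightarrow> real) \<Rightarrow> ('a \<Rightarrow> real) \<Rightarrow> real" where
  "form_deriv p E u v = (1 / p) * deriv (\<lambda>t::real. E (\<lambda>x. u x + t * v x)) 0"

definition limit_exists ::
  "real \<Rightarrow> 'a measure \<Rightarrow> (real \<Rightarrow> 'a \<Rightarrow> 'a \<Rightarrow> ennreal) \<Rightarrow> (nat \<Rightarrow> real) \<Rightarrow> bool" where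
  "limit_exists p m k r \<longleftrightarrow>
     (\<forall>f\<in>B_space p m k. \<exists>L::real. 0 \<le> L \<and> (\<lambda>n. J p m k (r n) f) \<longlonglongrightarrow> ennreal L)"

definition limit_form ::
  "real \<Rightarrow> 'a measure \<Rightarrow> (real \<Rightarrow> 'a \<Rightarrow> 'a \<Rightarrow> ennreal) \<Rightarrow> (nat \<Rightarrow> real) \<Rightarrow> ('a \<Rightarrow> real) \<Rightarrow> real" where
  "limit_form p m k r f = enn2real (lim (\<lambda>n. J p m k (r n) f))"

text \<open>
  A constant determined solely and explicitly by \<open>p\<close>, independently of the space, the measure
  and the kernels.  Put \<open>\<phi>(a) = sgn(a) |a|\<^sup>p\<^sup>-\<^sup>1\<close>.  For \<open>p \<le> 2\<close> use
  \<open>|\<phi>(a) - \<phi>(b)| \<le> 2\<^sup>2\<^sup>-\<^sup>p |a - b|\<^sup>p\<^sup>-\<^sup>1\<close>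
  and Hoelder's inequality; for \<open>p \<ge> 2\<close> use
  \<open>|\<phi>(a) - \<phi>(b)| \<le> (p - 1) max(|a|,|b|)\<^sup>p\<^sup>-\<^sup>2 |a - b|\<close>,
  Hoelder's inequality with exponents \<open>p/(p-2), p, p\<close>, and
  \<open>max(|a|,|b|)\<^sup>p \<le> |a|\<^sup>p + |b|\<^sup>p\<close>.
\<close>

definition form_diff_const :: "real \<Rightarrow> real" where
  "form_diff_const p = (if p \<le> 2 then 2 powr (2 - p) else (p - 1) * 2 powr ((p - 2) / p))"

text \<open>Real powers of nonnegative numbers with \<open>0\<^sup>0 = 1\<close>, whereas \<open>0 powr 0 = 0\<close>.\<close>

definition rpow :: "real \<Rightarrow> real \<Rightarrow> real" where
  "rpow x a = (if a = 0 then 1 else x powr a)"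

end

theory Submission
  imports Defs "HOL-Complex_Analysis.Great_Picard"
begin

text \<open>
  Every energy \<open>J p m k r f\<close> is the integral of \<open>|f x - f y|\<^sup>p\<close> over the product space with the
  measure weighted by \<open>k r\<close>.  Hence everything that holds for \<open>p\<close>-th powers of \<open>L\<^sup>p\<close> norms on a
  general measure space holds for each \<open>r\<close>, with constants that do not depend on \<open>r\<close>, and the
  properties of the limit follow by letting \<open>r\<close> run through the given sequence: the Minkowski
  inequalities between sequence norms (\<open>lq_norm_contraction\<close>) give the contraction properties, and
  the Hoelder bound for the derivative (\<open>ppair_diff_le\<close>) gives its modulus of continuity.  The same
  bound, through convexity, bounds the first-order Taylor remainder uniformly in \<open>r\<close>
  (\<open>pint_Taylor_remainder\<close>), so that derivatives converge together with values
  (\<open>derivative_of_limit\<close>).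

  Two parts are not inherited from a fixed \<open>r\<close>: the existence of a subsequence that serves all \<open>f\<close>,
  and locality for unbounded functions.  Both rest on one approximation principle,
  \<open>near_minimiser_approximation\<close>.  Let \<open>S f\<close> be the supremum of the energies of \<open>f\<close>.  If a set
  closed under midpoints contains functions that are arbitrarily close to \<open>f\<close> in \<open>L\<^sup>1\<close> and have
  bounded energy, then it also contains functions \<open>g\<close> for which \<open>S (f - g)\<close> is arbitrarily small.
  The functions \<open>g\<close> are near-minimisers of the upper limit of the energies on small \<open>L\<^sup>1\<close> balls.
  That they form a Cauchy sequence is uniform convexity; here weak monotonicity enters, because it
  bounds the lower limit of the energies of a difference from below by \<open>S\<close>.  That their limit is \<open>f\<close>
  is Fatou's lemma for each \<open>r\<close>.

  The space \<open>L\<^sup>1\<close> of an equivalent finite measure is separable.  Choosing elements of \<open>B\<close> close to the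
  points of a countable dense set and closing under midpoints, one obtains a countable subset of
  \<open>B\<close> that is dense for \<open>S\<close> (\<open>B_separable\<close>).  The \<open>p\<close>-th roots of the energies are
  seminorms bounded by the \<open>p\<close>-th root of \<open>S\<close>, so convergence on this subset, which a diagonal argument
  provides, extends to all of \<open>B\<close> (\<open>convergent_subsequence\<close>).

  Locality is immediate for bounded functions, since the integrands of the two sides agree close to
  the diagonal and the kernels have vanishing mass away from it (\<open>local_additivity_bounded\<close>).  In
  general, the approximation principle applied to bounded functions that are constant wherever \<open>f\<close>
  has a given value provides bounded approximations without enlarging the support
  (\<open>bounded_approximation\<close>).
\<close>


section \<open>Inequalities for real powers\<close>

lemma young_weighted:
  fixes a b \<alpha> \<beta> :: real
  assumes "0 \<le> a" "0 \<le> b" "0 < \<alpha>" "0 < \<beta>" "\<alpha> + \<beta> = 1"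
  shows "a powr \<alpha> * b powr \<beta> \<le> \<alpha> * a + \<beta> * b"
proof (cases "a = 0 \<or> b = 0")
  case True
  then show ?thesis using assms by auto
next
  case False
  then show ?thesis using assms Youngs_inequality_0[of \<alpha> \<beta> a b] by auto
qed

text \<open>This is Young's inequality for \<open>x\<^sup>s\<^sup>-\<^sup>1 y\<close> with exponents \<open>s / (s - 1)\<close> and \<open>s\<close>.\<close>

lemma powr_tangent_nonneg:
  fixes x y s :: real
  assumes "0 \<le> x" "0 \<le> y" "1 < s"
  shows "x powr s + s * x powr (s - 1) * (y - x) \<le> y powr s"
proof -
  have e: "(x powr s) powr ((s-1)/s) = x powr (s-1)" "(y powr s) powr (1/s) = y"
    using assms by (auto simp: powr_powr)
  have "x powr (s-1) * y \<le> ((s-1)/s) * x powr s + (1/s) * y powr s"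
    using young_weighted[of "x powr s" "y powr s" "(s-1)/s" "1/s"] assms e
    by (auto simp: field_simps)
  then have "s * (x powr (s-1) * y) \<le> (s-1) * x powr s + y powr s"
    using assms by (simp add: field_simps)
  moreover have "x powr (s-1) * x = x powr s"
    using assms powr_add[of x "s-1" 1] by (cases "x = 0") auto
  ultimately show ?thesis
    by (simp add: algebra_simps)
qed

text \<open>Sum the tangent inequalities at the mean: their linear parts cancel.\<close>

lemma powr_Jensen_sum:
  fixes w x :: "'i \<Rightarrow> real"
  assumes fin: "finite I" and w: "\<And>i. i \<in> I \<Longrightarrow> 0 \<le> w i" "(\<Sum>i\<in>I. w i) = 1"
    and x: "\<And>i. i \<in> I \<Longrightarrow> 0 \<le> x i" and s: "1 \<le> s"
  shows "(\<Sum>i\<in>I. w i * x i) powr s \<le> (\<Sum>i\<in>I. w i * x i powr s)"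
proof (cases "s = 1")
  case True
  have "0 \<le> (\<Sum>i\<in>I. w i * x i)" by (intro sum_nonneg mult_nonneg_nonneg w x)
  then show ?thesis using True x by (auto intro!: sum_mono mult_left_mono w)
next
  case False
  let ?X = "\<Sum>i\<in>I. w i * x i"
  have X: "0 \<le> ?X" by (intro sum_nonneg mult_nonneg_nonneg w x)
  have affine: "(\<Sum>i\<in>I. w i * (u + v * (x i - X))) = (\<Sum>i\<in>I. w i) * u + v * ((\<Sum>i\<in>I. w i * x i) - (\<Sum>i\<in>I. w i) * X)"
    for u v X :: real
    by (simp add: algebra_simps sum.distrib sum_distrib_left sum_distrib_right sum_subtractf)
  have "?X powr s = (\<Sum>i\<in>I. w i * (?X powr s + s * ?X powr (s - 1) * (x i - ?X)))"
    unfolding affine using w by simp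
  also have "\<dots> \<le> (\<Sum>i\<in>I. w i * x i powr s)"
    using False s X by (intro sum_mono mult_left_mono powr_tangent_nonneg w x) auto
  finally show ?thesis .
qed

lemma powr_mean_le:
  fixes x y s :: real
  assumes "0 \<le> x" "0 \<le> y" "1 \<le> s"
  shows "((x + y) / 2) powr s \<le> (x powr s + y powr s) / 2"
  using powr_Jensen_sum[of "{True,False}" "\<lambda>_. 1/2" "\<lambda>i. if i then x else y" s] assms
  by (simp add: field_simps)

lemma powr_add_le_2:
  fixes a b p :: real
  assumes "0 \<le> p"
  shows "\<bar>a + b\<bar> powr p \<le> 2 powr p * (\<bar>a\<bar> powr p + \<bar>b\<bar> powr p)"
proof -
  have "\<bar>a + b\<bar> powr p \<le> (2 * max \<bar>a\<bar> \<bar>b\<bar>) powr p"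
    using assms by (intro powr_mono2) auto
  also have "\<dots> = 2 powr p * max \<bar>a\<bar> \<bar>b\<bar> powr p" by (simp add: powr_mult)
  also have "\<dots> \<le> 2 powr p * (\<bar>a\<bar> powr p + \<bar>b\<bar> powr p)"
    by (intro mult_left_mono) (auto simp: max_def)
  finally show ?thesis .
qed

text \<open>Up to the factor \<open>p\<close>, the derivative of \<open>|a|\<^sup>p\<close>.\<close>

definition \<phi> :: "real \<Rightarrow> real \<Rightarrow> real" where
  "\<phi> p a = sgn a * \<bar>a\<bar> powr (p - 1)"

lemma measurable_\<phi>[measurable]: "\<phi> p \<in> borel_measurable borel"
  unfolding \<phi>_def by measurable

lemma \<phi>_minus: "\<phi> p (- a) = - \<phi> p a"
  by (simp add: \<phi>_def sgn_minus)

lemma abs_\<phi>: "\<bar>\<phi> p a\<bar> = \<bar>a\<bar> powr (p - 1)"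
  by (auto simp: \<phi>_def abs_mult sgn_if)

lemma \<phi>_nonneg: "0 \<le> a \<Longrightarrow> \<phi> p a = a powr (p - 1)"
  by (auto simp: \<phi>_def sgn_if)

lemma \<phi>_strict_mono:
  assumes "1 < p" "a < b"
  shows "\<phi> p a < \<phi> p b"
proof -
  consider "0 \<le> a" | "b \<le> 0" | "a < 0" "0 < b" using assms by linarith
  then show ?thesis
  proof cases
    case 1
    then show ?thesis using assms by (simp add: \<phi>_nonneg powr_less_mono2)
  next
    case 2
    then have "\<phi> p (- b) < \<phi> p (- a)" using assms by (subst (1 2) \<phi>_nonneg) (auto intro: powr_less_mono2)
    then show ?thesis by (simp add: \<phi>_minus)
  next
    case 3
    then have "0 < \<phi> p b" "0 < \<phi> p (- a)" by (auto simp: \<phi>_nonneg)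
    then show ?thesis by (simp add: \<phi>_minus)
  qed
qed

lemma \<phi>_mult_self: "\<phi> p a * a = \<bar>a\<bar> powr p"
  using powr_add[of "\<bar>a\<bar>" "p-1" 1] by (cases "a = 0") (auto simp: \<phi>_def sgn_if)

text \<open>Convexity of \<open>|x|\<^sup>p\<close> in the form of the tangent inequality: after multiplying out it is
  Young's inequality for \<open>|x|\<^sup>p\<^sup>-\<^sup>1 |y|\<close>.\<close>

lemma powr_abs_tangent:
  assumes "1 < p"
  shows "\<bar>x\<bar> powr p + p * \<phi> p x * (y - x) \<le> \<bar>y\<bar> powr p"
proof -
  have "\<phi> p x * y \<le> \<bar>x\<bar> powr (p-1) * \<bar>y\<bar>"
    using abs_ge_self[of "\<phi> p x * y"] by (simp add: abs_mult abs_\<phi>)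
  then have "p * (\<phi> p x * y) \<le> p * (\<bar>x\<bar> powr (p-1) * \<bar>y\<bar>)"
    using assms by simp
  moreover have "\<bar>x\<bar> powr p + p * \<bar>x\<bar> powr (p - 1) * (\<bar>y\<bar> - \<bar>x\<bar>) \<le> \<bar>y\<bar> powr p"
    using assms by (intro powr_tangent_nonneg) auto
  moreover have "\<bar>x\<bar> powr (p-1) * \<bar>x\<bar> = \<bar>x\<bar> powr p"
    using powr_add[of "\<bar>x\<bar>" "p-1" 1] by (cases "x = 0") auto
  ultimately show ?thesis using \<phi>_mult_self[of p x]
    by (simp add: algebra_simps)
qed

text \<open>Strictness comes from a second tangent, at a point between \<open>x\<close> and \<open>y\<close>, where the strictly
  increasing slope has already changed.\<close>

lemma powr_abs_midpoint_strict:
  fixes a b p :: real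
  assumes p: "1 < p" and ne: "a \<noteq> b"
  shows "\<bar>(a + b) / 2\<bar> powr p < (\<bar>a\<bar> powr p + \<bar>b\<bar> powr p) / 2"
proof -
  let ?x = "(a + b) / 2"
  have strict: "\<bar>x\<bar> powr p + p * \<phi> p x * (y - x) < \<bar>y\<bar> powr p" if "x \<noteq> y" for x y :: real
  proof -
    let ?z = "(x + y) / 2"
    have "p * \<phi> p x * (y - x) / 2 < p * \<phi> p ?z * (y - x) / 2"
    proof (cases "x < y")
      case True
      then show ?thesis using \<phi>_strict_mono[OF p, of x ?z] p by auto
    next
      case False
      then have "\<phi> p ?z < \<phi> p x" using \<phi>_strict_mono[OF p, of ?z x] that by auto
      then show ?thesis using False that p by auto
    qed
    moreover have "\<bar>x\<bar> powr p + p * \<phi> p x * (?z - x) \<le> \<bar>?z\<bar> powr p"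
      "\<bar>?z\<bar> powr p + p * \<phi> p ?z * (y - ?z) \<le> \<bar>y\<bar> powr p"
      using powr_abs_tangent[OF p] by blast+
    moreover have "?z - x = (y - x)/2" "y - ?z = (y - x)/2" by (auto simp: field_simps)
    ultimately show ?thesis by (simp add: field_simps)
  qed
  have "?x \<noteq> a" "?x \<noteq> b" using ne by (auto simp: field_simps)
  then have "\<bar>?x\<bar> powr p + p * \<phi> p ?x * (a - ?x) < \<bar>a\<bar> powr p"
    "\<bar>?x\<bar> powr p + p * \<phi> p ?x * (b - ?x) < \<bar>b\<bar> powr p"
    by (simp_all only: strict not_False_eq_True)
  moreover have "p * \<phi> p ?x * (b - ?x) = - (p * \<phi> p ?x * (a - ?x))" by (simp add: field_simps)
  moreover have "F < (A + B) / 2" if "F + t < A" "F + u < B" "u = - t" for A B F t u :: real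
    using that by (simp add: field_simps)
  ultimately show ?thesis by blast
qed

lemma powr_abs_midpoint:
  fixes a b p :: real
  assumes "1 < p"
  shows "\<bar>(a + b) / 2\<bar> powr p \<le> (\<bar>a\<bar> powr p + \<bar>b\<bar> powr p) / 2"
  using powr_abs_midpoint_strict[OF assms, of a b] by (cases "a = b") auto

text \<open>A quantitative form of strict convexity that survives integration against any measure and
  replaces both Clarkson inequalities.  By homogeneity it suffices to consider
  \<open>max |a| |b| = 1\<close>.  There the convexity defect has a positive minimum on the compact set where
  \<open>|a - b|\<^sup>p \<ge> \<epsilon>\<close>, while elsewhere the first term on the right is enough.\<close>

lemma powr_abs_uniformly_convex:
  assumes p: "1 < p" and \<epsilon>: "0 < \<epsilon>"
  shows "\<exists>K\<ge>0. \<forall>a b::real. \<bar>a - b\<bar> powr p \<le> \<epsilon> * (\<bar>a\<bar> powr p + \<bar>b\<bar> powr p)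
           + K * ((\<bar>a\<bar> powr p + \<bar>b\<bar> powr p) / 2 - \<bar>(a + b) / 2\<bar> powr p)"
proof -
  define S where "S = ({-1..1} \<times> {-1..1}) \<inter> {z::real\<times>real. \<epsilon> \<le> \<bar>fst z - snd z\<bar> powr p}"
  define D where "D = (\<lambda>z::real\<times>real. (\<bar>fst z\<bar> powr p + \<bar>snd z\<bar> powr p) / 2 - \<bar>(fst z + snd z) / 2\<bar> powr p)"
  have D_nonneg: "0 \<le> D z" for z using powr_abs_midpoint[OF p] by (simp add: D_def)
  have "compact S"
    unfolding S_def using p
    by (intro compact_Int_closed compact_Times compact_Icc closed_Collect_le
          continuous_on_powr' continuous_intros) auto
  moreover have "continuous_on S D"
    unfolding D_def using p by (intro continuous_intros continuous_on_powr') auto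
  moreover have D_pos: "0 < D z" if "z \<in> S" for z
  proof -
    have "fst z \<noteq> snd z" using that \<epsilon> p by (auto simp: S_def)
    from powr_abs_midpoint_strict[OF p this] show ?thesis by (simp add: D_def)
  qed
  ultimately obtain \<delta> where \<delta>: "0 < \<delta>" "\<And>z. z \<in> S \<Longrightarrow> \<delta> \<le> D z"
  proof (cases "S = {}")
    case True
    then show ?thesis using that[of 1] by auto
  next
    case False
    then obtain z0 where "z0 \<in> S" "\<And>z. z \<in> S \<Longrightarrow> D z0 \<le> D z"
      using continuous_attains_inf[OF \<open>compact S\<close> False \<open>continuous_on S D\<close>] by auto
    then show ?thesis using that[of "D z0"] D_pos by auto
  qed
  define K where "K = 2 powr p / \<delta>"
  have K: "0 \<le> K" using \<delta> by (simp add: K_def)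
  have unit: "\<bar>a - b\<bar> powr p \<le> \<epsilon> * (\<bar>a\<bar> powr p + \<bar>b\<bar> powr p) + K * D (a, b)"
    if m: "max \<bar>a\<bar> \<bar>b\<bar> = 1" for a b
  proof (cases "\<epsilon> \<le> \<bar>a - b\<bar> powr p")
    case True
    then have "(a, b) \<in> S" using m by (auto simp: S_def max_def split: if_splits)
    then have "2 powr p \<le> K * D (a,b)" using \<delta> by (simp add: K_def field_simps)
    moreover have "\<bar>a - b\<bar> powr p \<le> 2 powr p"
      using m p by (intro powr_mono2) (auto simp: max_def split: if_splits)
    moreover have "0 \<le> \<epsilon> * (\<bar>a\<bar> powr p + \<bar>b\<bar> powr p)" using \<epsilon> by auto
    ultimately show ?thesis by linarith
  next
    case False
    have "1 \<le> \<bar>a\<bar> powr p + \<bar>b\<bar> powr p" using m by (auto simp: max_def split: if_splits)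
    then have "\<epsilon> \<le> \<epsilon> * (\<bar>a\<bar> powr p + \<bar>b\<bar> powr p)" using \<epsilon> by simp
    moreover have "0 \<le> K * D (a,b)" using K D_nonneg by auto
    ultimately show ?thesis using False by linarith
  qed
  have "\<bar>a - b\<bar> powr p \<le> \<epsilon> * (\<bar>a\<bar> powr p + \<bar>b\<bar> powr p) + K * D (a, b)" for a b
  proof (cases "a = 0 \<and> b = 0")
    case False
    define c where "c = max \<bar>a\<bar> \<bar>b\<bar>"
    have c: "0 < c" using False by (auto simp: c_def max_def)
    have "max \<bar>a / c\<bar> \<bar>b / c\<bar> = max \<bar>a\<bar> \<bar>b\<bar> / c"
      using c by (simp add: max_divide_distrib_right)
    then have "max \<bar>a / c\<bar> \<bar>b / c\<bar> = 1" using c by (simp add: c_def)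
    from unit[OF this] have "\<bar>a / c - b / c\<bar> powr p
       \<le> \<epsilon> * (\<bar>a / c\<bar> powr p + \<bar>b / c\<bar> powr p) + K * D (a / c, b / c)" .
    moreover have "\<bar>a / c - b / c\<bar> powr p = \<bar>a - b\<bar> powr p / c powr p"
      "\<bar>a / c\<bar> powr p = \<bar>a\<bar> powr p / c powr p" "\<bar>b / c\<bar> powr p = \<bar>b\<bar> powr p / c powr p"
      "\<bar>(a / c + b / c) / 2\<bar> powr p = \<bar>(a + b) / 2\<bar> powr p / c powr p"
      using c by (simp_all add: powr_divide [symmetric] abs_divide diff_divide_distrib[symmetric] add_divide_distrib[symmetric] mult.commute)
    ultimately have "\<bar>a - b\<bar> powr p / c powr p \<le> (\<epsilon> * (\<bar>a\<bar> powr p + \<bar>b\<bar> powr p) + K * D (a, b)) / c powr p"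
      by (simp add: D_def diff_divide_distrib add_divide_distrib algebra_simps)
    then show ?thesis using c by (simp add: divide_le_cancel)
  qed (simp add: D_def)
  then show ?thesis using K unfolding D_def fst_conv snd_conv by blast
qed

lemma powr_add_subadditive:
  fixes x y s :: real
  assumes "0 \<le> x" "0 \<le> y" "0 < s" "s \<le> 1"
  shows "(x + y) powr s \<le> x powr s + y powr s"
proof (cases "x + y = 0")
  case False
  then have pos: "0 < x + y" using assms by auto
  have "x / (x+y) \<le> (x/(x+y)) powr s" "y / (x+y) \<le> (y/(x+y)) powr s"
    using assms pos powr_mono'[of s 1 "x/(x+y)"] powr_mono'[of s 1 "y/(x+y)"] by auto
  then have "x / (x+y) + y / (x+y) \<le> (x powr s + y powr s) / (x+y) powr s"
    using assms pos by (simp add: powr_divide add_divide_distrib)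
  moreover have "x / (x+y) + y / (x+y) = 1" using pos by (simp add: add_divide_distrib[symmetric])
  ultimately show ?thesis using pos by (simp add: field_simps)
qed (use assms in auto)

text \<open>Bounds for the increments of the odd function \<open>\<phi>\<close> that are invariant under exchange and under
  change of sign need to be verified only for \<open>0 \<le> b \<le> a\<close> and for opposite signs.\<close>

lemma \<phi>_increment_cases:
  assumes same: "\<And>a b. 0 \<le> b \<Longrightarrow> b \<le> a \<Longrightarrow> \<bar>\<phi> p a - \<phi> p b\<bar> \<le> R a b"
    and opp: "\<And>a b. 0 \<le> b \<Longrightarrow> 0 \<le> a \<Longrightarrow> \<bar>\<phi> p a - \<phi> p (- b)\<bar> \<le> R a (- b)"
    and sym: "\<And>a b. R a b = R b a" and neg: "\<And>a b. R (- a) (- b) = R a b"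
  shows "\<bar>\<phi> p a - \<phi> p b\<bar> \<le> R a b"
proof -
  have le: "\<bar>\<phi> p a - \<phi> p b\<bar> \<le> R a b" if "b \<le> a" for a b
  proof -
    consider "0 \<le> b" | "a \<le> 0" | "0 \<le> a" "b \<le> 0" by linarith
    then show ?thesis
    proof cases
      case 1 then show ?thesis using same that by blast
    next
      case 2 then show ?thesis
        using same[of "- a" "- b"] that neg[of b a] sym[of a b] by (simp add: \<phi>_minus abs_minus_commute)
    next
      case 3 then show ?thesis using opp[of "- b" a] by simp
    qed
  qed
  show ?thesis using le[of b a] le[of a b] sym[of a b] by (cases "b \<le> a") (auto simp: abs_minus_commute)
qed

text \<open>For arguments of equal sign this is subadditivity of \<open>t \<mapsto> t\<^sup>p\<^sup>-\<^sup>1\<close>; for opposite signs it is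
  concavity, which is where the factor \<open>2\<^sup>2\<^sup>-\<^sup>p\<close> comes from.\<close>

lemma \<phi>_Hoelder_le_2:
  assumes p: "1 < p" "p \<le> 2"
  shows "\<bar>\<phi> p a - \<phi> p b\<bar> \<le> 2 powr (2 - p) * \<bar>a - b\<bar> powr (p - 1)"
proof -
  have one: "1 \<le> (2::real) powr (2 - p)" using p ge_one_powr_ge_zero by auto
  have same: "\<bar>\<phi> p a - \<phi> p b\<bar> \<le> 2 powr (2 - p) * \<bar>a - b\<bar> powr (p - 1)" if "0 \<le> b" "b \<le> a" for a b
  proof -
    have "((a - b) + b) powr (p-1) \<le> (a - b) powr (p-1) + b powr (p-1)"
      using that p by (intro powr_add_subadditive) auto
    moreover have "b powr (p-1) \<le> a powr (p-1)" using that p by (intro powr_mono2) auto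
    ultimately have "\<bar>\<phi> p a - \<phi> p b\<bar> \<le> 1 * \<bar>a - b\<bar> powr (p - 1)"
      using that by (simp add: \<phi>_nonneg)
    also have "\<dots> \<le> 2 powr (2 - p) * \<bar>a - b\<bar> powr (p - 1)" using one by (intro mult_right_mono) auto
    finally show ?thesis .
  qed
  have opp: "\<bar>\<phi> p a - \<phi> p (- b)\<bar> \<le> 2 powr (2 - p) * \<bar>a + b\<bar> powr (p - 1)" if "0 \<le> b" "0 \<le> a" for a b
  proof -
    let ?s = "p - 1"
    have "((a powr ?s + b powr ?s) / 2) powr (1/?s) \<le> ((a powr ?s) powr (1/?s) + (b powr ?s) powr (1/?s)) / 2"
      using p by (intro powr_mean_le) auto
    also have "\<dots> = (a + b) / 2" using that p by (simp add: powr_powr)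
    finally have "(((a powr ?s + b powr ?s) / 2) powr (1/?s)) powr ?s \<le> ((a + b) / 2) powr ?s"
      using p by (intro powr_mono2) auto
    then have "a powr ?s + b powr ?s \<le> 2 * ((a + b) powr ?s / 2 powr ?s)"
      using p that by (simp add: powr_powr powr_divide field_simps)
    also have "\<dots> = 2 powr (2 - p) * (a + b) powr ?s"
      using powr_diff[of 2 1 "p - 1"] by (simp add: field_simps)
    finally show ?thesis using that by (simp add: \<phi>_minus \<phi>_nonneg)
  qed
  show ?thesis
  proof (rule \<phi>_increment_cases[where R = "\<lambda>a b. 2 powr (2 - p) * \<bar>a - b\<bar> powr (p - 1)"], goal_cases)
    case (1 a b) then show ?case by (rule same)
  next
    case (2 a b) then show ?case using opp[of b a] by simp
  next
    case (3 a b) show ?case by (simp add: abs_minus_commute max.commute)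
  next
    case (4 a b) show ?case by (simp add: abs_minus_commute)
  qed
qed

text \<open>For equal signs this is the tangent inequality for the exponent \<open>p - 1\<close>; for opposite signs
  the two powers are estimated separately, and \<open>p - 1 \<ge> 1\<close>.\<close>

lemma \<phi>_Lipschitz_ge_2:
  assumes p: "2 \<le> p"
  shows "\<bar>\<phi> p a - \<phi> p b\<bar> \<le> (p - 1) * max \<bar>a\<bar> \<bar>b\<bar> powr (p - 2) * \<bar>a - b\<bar>"
proof -
  have same: "\<bar>\<phi> p a - \<phi> p b\<bar> \<le> (p - 1) * max \<bar>a\<bar> \<bar>b\<bar> powr (p - 2) * \<bar>a - b\<bar>" if ab: "0 \<le> b" "b \<le> a" for a b
  proof (cases "p = 2")
    case True
    then show ?thesis using ab by (cases "a = 0") (auto simp: \<phi>_nonneg)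
  next
    case False
    then have "a powr (p-1) + (p-1) * a powr (p-1-1) * (b - a) \<le> b powr (p-1)"
      using ab p by (intro powr_tangent_nonneg) auto
    moreover have "b powr (p-1) \<le> a powr (p-1)" using that p by (intro powr_mono2) auto
    ultimately show ?thesis using ab by (simp add: \<phi>_nonneg algebra_simps)
  qed
  have opp: "\<bar>\<phi> p a - \<phi> p (- b)\<bar> \<le> (p - 1) * max \<bar>a\<bar> \<bar>b\<bar> powr (p - 2) * \<bar>a + b\<bar>" if ab: "0 \<le> b" "0 \<le> a" for a b
  proof -
    let ?m = "max \<bar>a\<bar> \<bar>b\<bar> powr (p - 2)"
    have le: "x powr (p-1) \<le> ?m * x" if x: "0 \<le> x" "x \<le> max \<bar>a\<bar> \<bar>b\<bar>" for x
    proof (cases "x = 0")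
      case False
      then have "x powr (p-1) = x powr (p-2) * x"
        using x powr_add[of x "p-2" 1] by simp
      also have "\<dots> \<le> ?m * x" using x p by (intro mult_right_mono powr_mono2) auto
      finally show ?thesis .
    qed auto
    have "a powr (p-1) + b powr (p-1) \<le> 1 * (?m * (a + b))"
      using le[of a] le[of b] ab by (simp add: algebra_simps)
    also have "\<dots> \<le> (p - 1) * (?m * (a + b))" using p ab by (intro mult_right_mono) auto
    finally show ?thesis using ab by (simp add: \<phi>_minus \<phi>_nonneg algebra_simps)
  qed
  show ?thesis
  proof (rule \<phi>_increment_cases[where R = "\<lambda>a b. (p - 1) * max \<bar>a\<bar> \<bar>b\<bar> powr (p - 2) * \<bar>a - b\<bar>"], goal_cases)
    case (1 a b) then show ?case by (rule same)
  next
    case (2 a b) then show ?case using opp[of b a] by simp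
  next
    case (3 a b) show ?case by (simp add: abs_minus_commute max.commute)
  next
    case (4 a b) show ?case by (simp add: abs_minus_commute)
  qed
qed

section \<open>The \<open>p\<close>-th power of the norm on a general measure space\<close>

definition pint :: "real \<Rightarrow> 'z measure \<Rightarrow> ('z \<Rightarrow> real) \<Rightarrow> real" where
  "pint p N h = (\<integral>z. \<bar>h z\<bar> powr p \<partial>N)"

lemma Lp_fun_iff: "h \<in> Lp_fun p N \<longleftrightarrow> h \<in> borel_measurable N \<and> integrable N (\<lambda>z. \<bar>h z\<bar> powr p)"
  by (auto simp: Lp_fun_def integrable_iff_bounded)

lemma Lp_fun_measurable[measurable_dest]: "h \<in> Lp_fun p N \<Longrightarrow> h \<in> borel_measurable N"
  by (simp add: Lp_fun_iff)

lemma Lp_fun_integrable: "h \<in> Lp_fun p N \<Longrightarrow> integrable N (\<lambda>z. \<bar>h z\<bar> powr p)"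
  by (simp add: Lp_fun_iff)

lemma pint_nonneg: "0 \<le> pint p N h"
  by (simp add: pint_def)

abbreviation npint :: "real \<Rightarrow> 'z measure \<Rightarrow> ('z \<Rightarrow> real) \<Rightarrow> ennreal" where
  "npint p N h \<equiv> \<integral>\<^sup>+z. ennreal (\<bar>h z\<bar> powr p) \<partial>N"

lemma nn_integral_eq_pint:
  "h \<in> Lp_fun p N \<Longrightarrow> npint p N h = ennreal (pint p N h)"
  unfolding pint_def by (rule nn_integral_eq_integral) (auto simp: Lp_fun_iff)

lemma Lp_fun_dominated:
  assumes "h \<in> borel_measurable N" "AE z in N. \<bar>h z\<bar> powr p \<le> G z" "integrable N G"
  shows "h \<in> Lp_fun p N"
  unfolding Lp_fun_iff
  using assms by (auto intro!: Bochner_Integration.integrable_bound[OF assms(3)] elim!: AE_mp)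

lemma Lp_fun_add:
  assumes "0 \<le> p" "u \<in> Lp_fun p N" "v \<in> Lp_fun p N"
  shows "(\<lambda>z. u z + v z) \<in> Lp_fun p N"
proof (rule Lp_fun_dominated[where G = "\<lambda>z. 2 powr p * (\<bar>u z\<bar> powr p + \<bar>v z\<bar> powr p)"])
  show "integrable N (\<lambda>z. 2 powr p * (\<bar>u z\<bar> powr p + \<bar>v z\<bar> powr p))"
    using assms by (auto intro!: integrable_mult_right integrable_add Lp_fun_integrable)
qed (use assms powr_add_le_2 in \<open>auto simp: Lp_fun_iff\<close>)

lemma Lp_fun_cmult:
  assumes "u \<in> Lp_fun p N"
  shows "(\<lambda>z. a * u z) \<in> Lp_fun p N"
  using assms by (auto simp: Lp_fun_iff abs_mult powr_mult)

lemma Lp_fun_diff: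
  assumes "0 \<le> p" "u \<in> Lp_fun p N" "v \<in> Lp_fun p N"
  shows "(\<lambda>z. u z - v z) \<in> Lp_fun p N"
  using Lp_fun_add[OF assms(1,2) Lp_fun_cmult[OF assms(3), of "-1"]] by simp

lemma pint_cmult: "pint p N (\<lambda>z. a * h z) = \<bar>a\<bar> powr p * pint p N h"
  by (simp add: pint_def abs_mult powr_mult)

lemma pint_add_le:
  assumes "0 \<le> p" "u \<in> Lp_fun p N" "v \<in> Lp_fun p N"
  shows "pint p N (\<lambda>z. u z + v z) \<le> 2 powr p * (pint p N u + pint p N v)"
proof -
  have "pint p N (\<lambda>z. u z + v z) \<le> (\<integral>z. 2 powr p * (\<bar>u z\<bar> powr p + \<bar>v z\<bar> powr p) \<partial>N)"
    unfolding pint_def using assms Lp_fun_add[OF assms]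
    by (intro integral_mono powr_add_le_2) (auto simp: Lp_fun_iff)
  also have "\<dots> = 2 powr p * (pint p N u + pint p N v)"
    using assms by (simp add: Lp_fun_iff pint_def)
  finally show ?thesis .
qed

text \<open>The order of quantifiers matters: one \<open>K\<close> serves all measures, in particular those of all
  kernels \<open>k r\<close>.\<close>

lemma pint_uniformly_convex:
  assumes p: "1 < p" and \<epsilon>: "0 < \<epsilon>"
  shows "\<exists>K\<ge>0. \<forall>(N::'z measure) u v. u \<in> Lp_fun p N \<longrightarrow> v \<in> Lp_fun p N \<longrightarrow>
    pint p N (\<lambda>z. u z - v z) + K * pint p N (\<lambda>z. (u z + v z) / 2)
      \<le> (\<epsilon> + K / 2) * (pint p N u + pint p N v)"
proof -
  obtain K where K: "0 \<le> K" "\<And>a b::real. \<bar>a - b\<bar> powr p \<le> \<epsilon> * (\<bar>a\<bar> powr p + \<bar>b\<bar> powr p)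
           + K * ((\<bar>a\<bar> powr p + \<bar>b\<bar> powr p) / 2 - \<bar>(a + b) / 2\<bar> powr p)"
    using powr_abs_uniformly_convex[OF p \<epsilon>] by blast
  have "pint p N (\<lambda>z. u z - v z) + K * pint p N (\<lambda>z. (u z + v z) / 2)
      \<le> (\<epsilon> + K / 2) * (pint p N u + pint p N v)"
    if uv: "u \<in> Lp_fun p N" "v \<in> Lp_fun p N" for N :: "'z measure" and u v
  proof -
    have p0: "0 \<le> p" using p by simp
    have i: "integrable N (\<lambda>z. \<bar>u z\<bar> powr p)" "integrable N (\<lambda>z. \<bar>v z\<bar> powr p)"
      "integrable N (\<lambda>z. \<bar>u z - v z\<bar> powr p)" "integrable N (\<lambda>z. \<bar>(u z + v z) / 2\<bar> powr p)"
      using Lp_fun_integrable[OF uv(1)] Lp_fun_integrable[OF uv(2)]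
        Lp_fun_integrable[OF Lp_fun_diff[OF p0 uv]]
        Lp_fun_integrable[OF Lp_fun_cmult[OF Lp_fun_add[OF p0 uv], of "1/2"]] by auto
    have "(\<integral>z. \<bar>u z - v z\<bar> powr p + K * \<bar>(u z + v z) / 2\<bar> powr p \<partial>N)
      \<le> (\<integral>z. (\<epsilon> + K / 2) * (\<bar>u z\<bar> powr p + \<bar>v z\<bar> powr p) \<partial>N)"
    proof (rule integral_mono)
      fix z
      show "\<bar>u z - v z\<bar> powr p + K * \<bar>(u z + v z) / 2\<bar> powr p \<le> (\<epsilon> + K / 2) * (\<bar>u z\<bar> powr p + \<bar>v z\<bar> powr p)"
        using K(2)[of "u z" "v z"] by (simp add: algebra_simps add_divide_distrib)
    qed (use i in auto)
    then show ?thesis using i by (simp add: pint_def)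
  qed
  then show ?thesis using K(1) by blast
qed

text \<open>Integrate the weighted Young inequality for the functions normalised to have integral 1.  If one
  of the integrals is 0, then the product vanishes almost everywhere.\<close>

lemma Hoelder_2:
  assumes \<alpha>: "0 < \<alpha>" "0 < \<beta>" "\<alpha> + \<beta> = (1::real)"
    and int: "integrable N u" "integrable N v" and nn: "\<And>z. 0 \<le> u z" "\<And>z. (0::real) \<le> v z"
  shows "integrable N (\<lambda>z. u z powr \<alpha> * v z powr \<beta>)"
    and "(\<integral>z. u z powr \<alpha> * v z powr \<beta> \<partial>N) \<le> (\<integral>z. u z \<partial>N) powr \<alpha> * (\<integral>z. v z \<partial>N) powr \<beta>"
proof -
  note [measurable] = borel_measurable_integrable[OF int(1)] borel_measurable_integrable[OF int(2)]
  show i: "integrable N (\<lambda>z. u z powr \<alpha> * v z powr \<beta>)"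
    by (rule Bochner_Integration.integrable_bound[where f="\<lambda>z. \<alpha> * u z + \<beta> * v z"])
      (use assms young_weighted[of "u _" "v _" \<alpha> \<beta>] in \<open>auto intro!: AE_I2 order_trans[OF _ abs_ge_self]\<close>)
  define U where "U = (\<integral>z. u z \<partial>N)"
  define V where "V = (\<integral>z. v z \<partial>N)"
  have "0 \<le> U" "0 \<le> V" using nn by (auto simp: U_def V_def)
  show "(\<integral>z. u z powr \<alpha> * v z powr \<beta> \<partial>N) \<le> (\<integral>z. u z \<partial>N) powr \<alpha> * (\<integral>z. v z \<partial>N) powr \<beta>"
  proof (cases "U = 0 \<or> V = 0")
    case True
    then have "AE z in N. u z powr \<alpha> * v z powr \<beta> = 0"
    proof
      assume "U = 0"
      then have "AE z in N. u z = 0"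
        unfolding U_def using int nn by (subst (asm) integral_nonneg_eq_0_iff_AE) auto
      then show ?thesis by eventually_elim auto
    next
      assume "V = 0"
      then have "AE z in N. v z = 0"
        unfolding V_def using int nn by (subst (asm) integral_nonneg_eq_0_iff_AE) auto
      then show ?thesis by eventually_elim auto
    qed
    then have "(\<integral>z. u z powr \<alpha> * v z powr \<beta> \<partial>N) = (\<integral>z. 0 \<partial>N)"
      by (intro integral_cong_AE) auto
    then show ?thesis by auto
  next
    case False
    then have pos: "0 < U" "0 < V" using \<open>0 \<le> U\<close> \<open>0 \<le> V\<close> by auto
    have "(\<integral>z. u z powr \<alpha> * v z powr \<beta> \<partial>N)
      \<le> (\<integral>z. U powr \<alpha> * V powr \<beta> * (\<alpha> / U * u z + \<beta> / V * v z) \<partial>N)"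
    proof (rule integral_mono[OF i])
      fix z
      have "(u z / U) powr \<alpha> * (v z / V) powr \<beta> \<le> \<alpha> * (u z / U) + \<beta> * (v z / V)"
        using nn pos \<alpha> by (intro young_weighted) auto
      then have "u z powr \<alpha> * v z powr \<beta> / (U powr \<alpha> * V powr \<beta>) \<le> \<alpha> / U * u z + \<beta> / V * v z"
        using nn pos by (simp add: powr_divide)
      then show "u z powr \<alpha> * v z powr \<beta> \<le> U powr \<alpha> * V powr \<beta> * (\<alpha> / U * u z + \<beta> / V * v z)"
        using pos by (subst (asm) pos_divide_le_eq) (auto simp: mult.commute)
    qed (use int in auto)
    also have "\<dots> = U powr \<alpha> * V powr \<beta> * (\<alpha> / U * U + \<beta> / V * V)"
      using int by (simp add: U_def V_def)
    also have "\<dots> = U powr \<alpha> * V powr \<beta>" using pos \<alpha> by simp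
    finally show ?thesis by (simp add: U_def V_def)
  qed
qed

lemma Hoelder_3:
  assumes \<alpha>: "0 < \<alpha>" "0 < \<beta>" "0 < \<gamma>" "\<alpha> + \<beta> + \<gamma> = (1::real)"
    and int: "integrable N u" "integrable N v" "integrable N w"
    and nn: "\<And>z. 0 \<le> u z" "\<And>z. (0::real) \<le> v z" "\<And>z. (0::real) \<le> w z"
  shows "integrable N (\<lambda>z. u z powr \<alpha> * (v z powr \<beta> * w z powr \<gamma>))"
    and "(\<integral>z. u z powr \<alpha> * (v z powr \<beta> * w z powr \<gamma>) \<partial>N)
       \<le> (\<integral>z. u z \<partial>N) powr \<alpha> * ((\<integral>z. v z \<partial>N) powr \<beta> * (\<integral>z. w z \<partial>N) powr \<gamma>)"
proof -
  let ?b = "\<beta> / (\<beta> + \<gamma>)" and ?c = "\<gamma> / (\<beta> + \<gamma>)"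
  have bc: "0 < ?b" "0 < ?c" "?b + ?c = 1" using \<alpha> by (auto simp: add_divide_distrib[symmetric])
  note H = Hoelder_2[OF bc int(2,3) nn(2,3)]
  have eq: "(x powr ?b * y powr ?c) powr (\<beta> + \<gamma>) = x powr \<beta> * y powr \<gamma>" for x y :: real
    using \<alpha> by (simp add: powr_mult powr_powr)
  have s: "\<alpha> + (\<beta> + \<gamma>) = 1" "0 < \<beta> + \<gamma>" using \<alpha> by auto
  note H' = Hoelder_2[OF \<alpha>(1) s(2) s(1) int(1) H(1) nn(1), unfolded eq]
  show "integrable N (\<lambda>z. u z powr \<alpha> * (v z powr \<beta> * w z powr \<gamma>))"
    by (rule H'(1)) auto
  have "(\<integral>z. u z powr \<alpha> * (v z powr \<beta> * w z powr \<gamma>) \<partial>N)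
     \<le> (\<integral>z. u z \<partial>N) powr \<alpha> * (\<integral>z. v z powr ?b * w z powr ?c \<partial>N) powr (\<beta> + \<gamma>)"
    by (rule H'(2)) auto
  also have "\<dots> \<le> (\<integral>z. u z \<partial>N) powr \<alpha> * ((\<integral>z. v z \<partial>N) powr ?b * (\<integral>z. w z \<partial>N) powr ?c) powr (\<beta> + \<gamma>)"
    using s H(2) by (intro mult_left_mono powr_mono2) auto
  finally show "(\<integral>z. u z powr \<alpha> * (v z powr \<beta> * w z powr \<gamma>) \<partial>N)
       \<le> (\<integral>z. u z \<partial>N) powr \<alpha> * ((\<integral>z. v z \<partial>N) powr \<beta> * (\<integral>z. w z \<partial>N) powr \<gamma>)"
    unfolding eq .
qed

text \<open>The derivative of \<open>pint p N\<close> at \<open>u\<close> in the direction \<open>v\<close>, divided by \<open>p\<close>.\<close>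

definition ppair :: "real \<Rightarrow> 'z measure \<Rightarrow> ('z \<Rightarrow> real) \<Rightarrow> ('z \<Rightarrow> real) \<Rightarrow> real" where
  "ppair p N u v = (\<integral>z. \<phi> p (u z) * v z \<partial>N)"

lemma powr_abs_root: "1 < p \<Longrightarrow> (\<bar>a::real\<bar> powr p) powr (s / p) = \<bar>a\<bar> powr s"
  by (simp add: powr_powr)

lemma powr_abs_root_1: "1 < p \<Longrightarrow> (\<bar>a::real\<bar> powr p) powr (1 / p) = \<bar>a\<bar>"
  by (simp add: powr_powr)

lemma ppair_integrable:
  assumes p: "1 < p" and uv: "u \<in> Lp_fun p N" "v \<in> Lp_fun p N"
  shows "integrable N (\<lambda>z. \<phi> p (u z) * v z)"
proof (rule Bochner_Integration.integrable_bound)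
  show "integrable N (\<lambda>z. (\<bar>u z\<bar> powr p) powr ((p - 1) / p) * (\<bar>v z\<bar> powr p) powr (1 / p))"
    using uv p by (intro Hoelder_2) (auto simp: Lp_fun_iff field_simps)
  show "AE z in N. norm (\<phi> p (u z) * v z)
      \<le> norm ((\<bar>u z\<bar> powr p) powr ((p - 1) / p) * (\<bar>v z\<bar> powr p) powr (1 / p))"
    using p by (simp add: powr_abs_root powr_abs_root_1 abs_mult abs_\<phi>)
qed (use uv in measurable)

text \<open>The bounds for the increments of \<open>\<phi>\<close>, integrated by Hoelder's inequality: with exponents
  \<open>p / (p - 1)\<close> and \<open>p\<close> for \<open>p \<le> 2\<close>, with \<open>p / (p - 2)\<close>, \<open>p\<close> and \<open>p\<close> otherwise.\<close>

lemma ppair_diff_le: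
  assumes p: "1 < p" and L: "u1 \<in> Lp_fun p N" "u2 \<in> Lp_fun p N" "v \<in> Lp_fun p N"
  shows "\<bar>ppair p N u1 v - ppair p N u2 v\<bar> \<le>
    form_diff_const p * rpow (max (pint p N u1) (pint p N u2)) (max (p - 2) 0 / p)
      * rpow (pint p N (\<lambda>z. u1 z - u2 z)) (min (p - 1) 1 / p) * rpow (pint p N v) (1 / p)"
proof -
  let ?F = "\<lambda>z. (\<phi> p (u1 z) - \<phi> p (u2 z)) * v z"
  have p0: "0 \<le> p" using p by simp
  note D = Lp_fun_diff[OF p0 L(1,2)]
  note i = L[THEN Lp_fun_integrable] D[THEN Lp_fun_integrable]
  note iA = ppair_integrable[OF p L(1,3)] ppair_integrable[OF p L(2,3)]
  have "\<bar>ppair p N u1 v - ppair p N u2 v\<bar> = \<bar>\<integral>z. ?F z \<partial>N\<bar>"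
    unfolding ppair_def using iA by (simp add: left_diff_distrib)
  also have "\<dots> \<le> (\<integral>z. \<bar>?F z\<bar> \<partial>N)"
    by (rule integral_abs_bound)
  finally have le: "\<bar>ppair p N u1 v - ppair p N u2 v\<bar> \<le> (\<integral>z. \<bar>?F z\<bar> \<partial>N)" .
  have ia: "integrable N (\<lambda>z. \<bar>?F z\<bar>)"
    using iA by (simp add: left_diff_distrib)
  show ?thesis
  proof (cases "p \<le> 2")
    case True
    let ?G = "\<lambda>z. (\<bar>u1 z - u2 z\<bar> powr p) powr ((p - 1) / p) * (\<bar>v z\<bar> powr p) powr (1 / p)"
    have e: "0 < (p - 1) / p" "0 < 1 / p" "(p - 1) / p + 1 / p = 1" using p by (auto simp: field_simps)
    note H = Hoelder_2[OF e i(4,3)]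
    have "(\<integral>z. \<bar>?F z\<bar> \<partial>N) \<le> (\<integral>z. 2 powr (2 - p) * ?G z \<partial>N)"
    proof (rule integral_mono[OF ia])
      show "integrable N (\<lambda>z. 2 powr (2 - p) * ?G z)" using H(1) by simp
      fix z
      show "\<bar>?F z\<bar> \<le> 2 powr (2 - p) * ?G z"
        using mult_right_mono[OF \<phi>_Hoelder_le_2[OF p True, of "u1 z" "u2 z"] abs_ge_zero[of "v z"]] p
        by (simp add: powr_abs_root powr_abs_root_1 abs_mult)
    qed
    also have "\<dots> \<le> 2 powr (2 - p) * (pint p N (\<lambda>z. u1 z - u2 z) powr ((p - 1) / p) * pint p N v powr (1 / p))"
      unfolding pint_def using H(2) by simp
    finally show ?thesis using le True p by (simp add: form_diff_const_def rpow_def)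
  next
    case False
    let ?M = "\<lambda>z. max \<bar>u1 z\<bar> \<bar>u2 z\<bar>"
    let ?G = "\<lambda>z. (\<bar>u1 z\<bar> powr p + \<bar>u2 z\<bar> powr p) powr ((p - 2) / p)
       * ((\<bar>u1 z - u2 z\<bar> powr p) powr (1 / p) * (\<bar>v z\<bar> powr p) powr (1 / p))"
    have e: "0 < (p - 2) / p" "0 < 1 / p" "0 < 1 / p" "(p - 2) / p + 1 / p + 1 / p = 1"
      using False p by (auto simp: field_simps)
    note H = Hoelder_3[OF e Bochner_Integration.integrable_add[OF i(1,2)] i(4,3)]
    have "(\<integral>z. \<bar>?F z\<bar> \<partial>N) \<le> (\<integral>z. (p - 1) * ?G z \<partial>N)"
    proof (rule integral_mono[OF ia])
      show "integrable N (\<lambda>z. (p - 1) * ?G z)" using H(1) by simp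
      fix z
      have "?M z powr p \<le> \<bar>u1 z\<bar> powr p + \<bar>u2 z\<bar> powr p" by (auto simp: max_def)
      then have "(?M z powr p) powr ((p - 2) / p) \<le> (\<bar>u1 z\<bar> powr p + \<bar>u2 z\<bar> powr p) powr ((p - 2) / p)"
        using e by (intro powr_mono2) auto
      then have M: "?M z powr (p - 2) \<le> (\<bar>u1 z\<bar> powr p + \<bar>u2 z\<bar> powr p) powr ((p - 2) / p)"
        using p by (simp add: powr_powr)
      have "\<bar>?F z\<bar> \<le> (p - 1) * (?M z powr (p - 2)) * \<bar>u1 z - u2 z\<bar> * \<bar>v z\<bar>"
        using mult_right_mono[OF \<phi>_Lipschitz_ge_2[of p "u1 z" "u2 z"] abs_ge_zero[of "v z"]] False
        by (simp add: abs_mult)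
      also have "\<dots> \<le> (p - 1) * ((\<bar>u1 z\<bar> powr p + \<bar>u2 z\<bar> powr p) powr ((p - 2) / p)) * \<bar>u1 z - u2 z\<bar> * \<bar>v z\<bar>"
        using M p by (intro mult_right_mono mult_left_mono) auto
      finally show "\<bar>?F z\<bar> \<le> (p - 1) * ?G z"
        using p by (simp add: powr_abs_root_1)
    qed
    also have "\<dots> \<le> (p - 1) * ((\<integral>z. \<bar>u1 z\<bar> powr p + \<bar>u2 z\<bar> powr p \<partial>N) powr ((p - 2) / p)
       * (pint p N (\<lambda>z. u1 z - u2 z) powr (1 / p) * pint p N v powr (1 / p)))"
      unfolding pint_def using H(2) p by simp
    also have "(\<integral>z. \<bar>u1 z\<bar> powr p + \<bar>u2 z\<bar> powr p \<partial>N) = pint p N u1 + pint p N u2"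
      using i by (simp add: pint_def)
    also have "(p - 1) * ((pint p N u1 + pint p N u2) powr ((p - 2) / p)
       * (pint p N (\<lambda>z. u1 z - u2 z) powr (1 / p) * pint p N v powr (1 / p)))
      \<le> (p - 1) * ((2 * max (pint p N u1) (pint p N u2)) powr ((p - 2) / p)
       * (pint p N (\<lambda>z. u1 z - u2 z) powr (1 / p) * pint p N v powr (1 / p)))"
      using p e pint_nonneg[of p N] by (intro mult_left_mono mult_right_mono powr_mono2) auto
    finally show ?thesis using le False p pint_nonneg[of p N u1]
      by (simp add: form_diff_const_def rpow_def powr_mult)
  qed
qed

lemma pint_tangent:
  assumes p: "1 < p" and L: "u \<in> Lp_fun p N" "v \<in> Lp_fun p N"
  shows "pint p N u + p * t * ppair p N u v \<le> pint p N (\<lambda>z. u z + t * v z)"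
proof -
  have p0: "0 \<le> p" using p by simp
  note i = Lp_fun_integrable[OF L(1)] ppair_integrable[OF p L]
    Lp_fun_integrable[OF Lp_fun_add[OF p0 L(1) Lp_fun_cmult[OF L(2)]]]
  have "(\<integral>z. \<bar>u z\<bar> powr p + p * t * (\<phi> p (u z) * v z) \<partial>N) \<le> pint p N (\<lambda>z. u z + t * v z)"
    unfolding pint_def
  proof (rule integral_mono)
    fix z
    show "\<bar>u z\<bar> powr p + p * t * (\<phi> p (u z) * v z) \<le> \<bar>u z + t * v z\<bar> powr p"
      using powr_abs_tangent[OF p, of "u z" "u z + t * v z"] by (simp add: algebra_simps)
  qed (use i in auto)
  then show ?thesis using i(1,2) by (simp add: pint_def ppair_def)
qed

text \<open>Convexity bounds the first-order Taylor remainder by the increment of the derivative; thus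
  the Hoelder bound for the derivative gives differentiability along lines with a remainder that
  depends on the measure only through bounds on the \<open>p\<close>-th powers involved.\<close>

lemma pint_Taylor_remainder:
  assumes p: "1 < p" and L: "u \<in> Lp_fun p N" "v \<in> Lp_fun p N"
  shows "\<bar>pint p N (\<lambda>z. u z + t * v z) - pint p N u - p * t * ppair p N u v\<bar>
     \<le> p * \<bar>t\<bar> * \<bar>ppair p N (\<lambda>z. u z + t * v z) v - ppair p N u v\<bar>"
proof -
  have p0: "0 \<le> p" using p by simp
  have "pint p N (\<lambda>z. u z + t * v z) + p * (- t) * ppair p N (\<lambda>z. u z + t * v z) v
     \<le> pint p N (\<lambda>z. (u z + t * v z) + (- t) * v z)"
    by (rule pint_tangent[OF p Lp_fun_add[OF p0 L(1) Lp_fun_cmult[OF L(2)]] L(2)])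
  then have "pint p N (\<lambda>z. u z + t * v z) - pint p N u - p * t * ppair p N u v
      \<le> p * (t * (ppair p N (\<lambda>z. u z + t * v z) v - ppair p N u v))"
    by (simp add: algebra_simps)
  also have "\<dots> \<le> p * \<bar>t * (ppair p N (\<lambda>z. u z + t * v z) v - ppair p N u v)\<bar>"
    using p by (intro mult_left_mono) auto
  finally show ?thesis using pint_tangent[OF p L, of t] by (simp add: abs_mult)
qed

section \<open>Contractions between sequence norms of integrals\<close>

lemma tendsto_Max_image:
  fixes x :: "'k \<Rightarrow> 'i \<Rightarrow> real"
  assumes "finite I" "I \<noteq> {}" "\<And>i. i \<in> I \<Longrightarrow> ((\<lambda>k. x k i) \<longlongrightarrow> y i) F"
  shows "((\<lambda>k. Max (x k ` I)) \<longlongrightarrow> Max (y ` I)) F"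
  using assms
proof (induction rule: finite_ne_induct)
  case (insert i I)
  then show ?case by (auto intro!: tendsto_max)
qed auto

lemma exponent_pos: "1 < p \<Longrightarrow> ereal p \<le> q \<Longrightarrow> 0 < q"
  by (metis ereal_less(2) less_le_trans less_trans zero_less_one)

lemma lq_norm_real: "lq_norm n (ereal q) x = (\<Sum>i<n. \<bar>x i\<bar> powr q) powr (1 / q)"
  by (simp add: lq_norm_def)

lemma lq_norm_top: "lq_norm n \<infinity> x = Max ((\<lambda>i. \<bar>x i\<bar>) ` {..<n})"
  by (simp add: lq_norm_def)

lemma lq_norm_cong: "(\<And>i. i < n \<Longrightarrow> x i = y i) \<Longrightarrow> lq_norm n q x = lq_norm n q y"
  unfolding lq_norm_def by (intro if_cong refl arg_cong[where f=Max] arg_cong2[where f="(powr)"]) auto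

lemma tendsto_lq_norm:
  assumes n: "1 \<le> n" and q: "0 < q" and x: "\<And>i. i < n \<Longrightarrow> ((\<lambda>k. x k i) \<longlongrightarrow> y i) F"
  shows "((\<lambda>k. lq_norm n q (x k)) \<longlongrightarrow> lq_norm n q y) F"
proof (cases q)
  case (real s)
  then have "0 < s" using q by simp
  then show ?thesis unfolding real lq_norm_real
    by (intro tendsto_powr2 tendsto_sum tendsto_rabs tendsto_const x) (auto intro!: sum_nonneg always_eventually)
next
  case PInf
  then show ?thesis unfolding PInf lq_norm_top using n
    by (intro tendsto_Max_image tendsto_rabs x) (auto simp: lessThan_empty_iff)
qed (use q in auto)

lemma measurable_lq_norm:
  assumes n: "1 \<le> n" and q: "0 < q" and x: "\<And>i. i < n \<Longrightarrow> x i \<in> borel_measurable N"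
  shows "(\<lambda>z. lq_norm n q (\<lambda>i. x i z)) \<in> borel_measurable N"
proof (cases q)
  case (real s)
  then show ?thesis unfolding real lq_norm_real 
    using x by (intro powr_real_measurable borel_measurable_sum borel_measurable_abs borel_measurable_const) auto
next
  case PInf
  have "(\<lambda>z. Max ((\<lambda>i. \<bar>x i z\<bar>) ` {..<n})) \<in> borel_measurable N"
    using x by (intro borel_measurable_Max borel_measurable_abs) auto
  then show ?thesis unfolding PInf lq_norm_top .
qed (use q in auto)

lemma abs_le_lq_norm:
  assumes "l < n" "0 < q"
  shows "\<bar>x l\<bar> \<le> lq_norm n q x"
proof (cases q)
  case (real s)
  then have s: "0 < s" using assms by simp
  have "\<bar>x l\<bar> powr s \<le> (\<Sum>i<n. \<bar>x i\<bar> powr s)"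
    using assms by (intro member_le_sum) auto
  then have "(\<bar>x l\<bar> powr s) powr (1/s) \<le> (\<Sum>i<n. \<bar>x i\<bar> powr s) powr (1 / s)"
    using s by (intro powr_mono2) auto
  then show ?thesis using s by (simp add: real lq_norm_real powr_powr)
qed (use assms in \<open>auto simp: lq_norm_top\<close>)

lemma lq_norm_nonneg: "1 \<le> n \<Longrightarrow> 0 < q \<Longrightarrow> 0 \<le> lq_norm n q x"
  using abs_le_lq_norm[of 0 n q x] by (auto intro: order_trans[rotated])

text \<open>Minkowski's inequality in \<open>L\<^sup>s\<close>, \<open>s = p / q\<close>, for the functions \<open>|u\<^sub>i|\<^sup>q\<close>.  It is Jensen's
  inequality for the convex combination with weights proportional to the norms \<open>b\<^sub>i\<close> of these
  functions; the norms are increased by \<open>\<eta>\<close> so that one may divide by them.\<close>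

lemma lq_norm_Minkowski:
  assumes p: "1 < p" and n: "1 \<le> n" and q: "0 < q" "q \<le> p" and u: "\<And>i. i < n \<Longrightarrow> u i \<in> Lp_fun p N"
  shows "(\<lambda>z. lq_norm n (ereal q) (\<lambda>i. u i z)) \<in> Lp_fun p N"
    and "pint p N (\<lambda>z. lq_norm n (ereal q) (\<lambda>i. u i z)) powr (1 / p)
       \<le> lq_norm n (ereal q) (\<lambda>i. pint p N (u i) powr (1 / p))"
proof -
  let ?G = "\<lambda>z. lq_norm n (ereal q) (\<lambda>i. u i z)"
  define s where "s = p / q"
  have s: "1 \<le> s" using q by (simp add: s_def)
  define A where "A = (\<lambda>i. pint p N (u i))"
  have A: "0 \<le> A i" for i by (simp add: A_def pint_nonneg)
  have *: "?G \<in> Lp_fun p N \<and> pint p N ?G \<le> (\<Sum>i<n. A i powr (q / p) + \<eta>) powr s" if \<eta>: "0 < \<eta>" for \<eta>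
  proof -
    define b where "b = (\<lambda>i. A i powr (q / p) + \<eta>)"
    have b: "0 < b i" for i using \<eta> by (simp add: b_def add_nonneg_pos)
    define B where "B = (\<Sum>i<n. b i)"
    have B: "0 < B" unfolding B_def using n b by (intro sum_pos) (auto simp: lessThan_empty_iff)
    define c where "c = (\<lambda>i. B powr s * (b i / B) / b i powr s)"
    have c: "0 \<le> c i" for i using b[of i] B by (simp add: c_def)
    have le: "\<bar>?G z\<bar> powr p \<le> (\<Sum>i<n. c i * \<bar>u i z\<bar> powr p)" for z
    proof -
      have "\<bar>?G z\<bar> powr p = (\<Sum>i<n. \<bar>u i z\<bar> powr q) powr s"
        using q by (simp add: lq_norm_real powr_powr s_def)
      also have "(\<Sum>i<n. \<bar>u i z\<bar> powr q) = B * (\<Sum>i<n. b i / B * (\<bar>u i z\<bar> powr q / b i))"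
        using B b by (simp add: sum_distrib_left less_imp_neq[symmetric])
      also have "\<dots> powr s = B powr s * (\<Sum>i<n. b i / B * (\<bar>u i z\<bar> powr q / b i)) powr s"
        by (simp add: powr_mult)
      also have "\<dots> \<le> B powr s * (\<Sum>i<n. b i / B * (\<bar>u i z\<bar> powr q / b i) powr s)"
        using B b less_imp_le[OF b] s
        by (intro mult_left_mono powr_Jensen_sum) (auto simp: sum_divide_distrib[symmetric] B_def[symmetric])
      also have "\<dots> = (\<Sum>i<n. c i * \<bar>u i z\<bar> powr p)"
        using b q by (simp add: sum_distrib_left c_def powr_divide powr_powr s_def less_imp_le mult.assoc mult.left_commute)
      finally show ?thesis .
    qed
    have int: "integrable N (\<lambda>z. \<Sum>i<n. c i * \<bar>u i z\<bar> powr p)"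
      by (intro Bochner_Integration.integrable_sum integrable_mult_right Lp_fun_integrable u) auto
    have G: "?G \<in> Lp_fun p N"
    proof (rule Lp_fun_dominated[OF _ _ int])
      show "?G \<in> borel_measurable N"
        using n q by (intro measurable_lq_norm) (auto intro: Lp_fun_measurable u)
    qed (use le in auto)
    have "pint p N ?G \<le> (\<integral>z. (\<Sum>i<n. c i * \<bar>u i z\<bar> powr p) \<partial>N)"
      unfolding pint_def by (rule integral_mono[OF Lp_fun_integrable[OF G] int le])
    also have "\<dots> = (\<Sum>i<n. c i * A i)"
      using u by (simp add: A_def pint_def Lp_fun_integrable)
    also have "\<dots> \<le> (\<Sum>i<n. B powr s * (b i / B))"
    proof (rule sum_mono)
      fix i
      have "A i = (A i powr (q / p)) powr s" using A[of i] p q by (simp add: powr_powr s_def)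
      also have "\<dots> \<le> b i powr s" using s \<eta> by (intro powr_mono2) (auto simp: b_def)
      finally have "c i * A i \<le> c i * b i powr s" using c by (intro mult_left_mono)
      then show "c i * A i \<le> B powr s * (b i / B)" using b[of i] by (simp add: c_def)
    qed
    also have "\<dots> = B powr s * ((\<Sum>i<n. b i) / B)" by (simp add: sum_distrib_left sum_divide_distrib)
    also have "\<dots> = B powr s" using B by (simp add: B_def[symmetric])
    finally show ?thesis using G by (simp add: B_def b_def)
  qed
  from *[of 1] show "?G \<in> Lp_fun p N" by simp
  have "pint p N ?G powr (1 / s) \<le> (\<Sum>i<n. A i powr (q / p))"
  proof (rule field_le_epsilon)
    fix e :: real assume e: "0 < e"
    have "pint p N ?G powr (1 / s) \<le> ((\<Sum>i<n. A i powr (q / p) + e / n) powr s) powr (1 / s)"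
      using *[of "e / n"] e n s pint_nonneg by (intro powr_mono2) auto
    also have "\<dots> = (\<Sum>i<n. A i powr (q / p)) + e"
      using s e n by (simp add: powr_powr sum.distrib sum_nonneg)
    finally show "pint p N ?G powr (1 / s) \<le> (\<Sum>i<n. A i powr (q / p)) + e" .
  qed
  then have "(pint p N ?G powr (1 / s)) powr (1 / q) \<le> (\<Sum>i<n. A i powr (q / p)) powr (1 / q)"
    using q by (intro powr_mono2) auto
  then show "pint p N ?G powr (1 / p) \<le> lq_norm n (ereal q) (\<lambda>i. pint p N (u i) powr (1 / p))"
    using p q by (simp add: lq_norm_real powr_powr s_def A_def)
qed

text \<open>The integral version of the triangle inequality in \<open>\<ell>\<^sup>s\<close>, \<open>s = q / p\<close>, for the vectors with
  entries \<open>|v\<^sub>l|\<^sup>p\<close>: the \<open>\<ell>\<^sup>s\<close> norm of the vector \<open>A\<close> of integrals is attained by pairing it with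
  \<open>A\<^sup>s\<^sup>-\<^sup>1\<close>, and this pairing may be estimated before integration.\<close>

lemma lq_norm_integral_le:
  assumes p: "1 < p" and n: "1 \<le> n" and q: "ereal p \<le> q" and v: "\<And>l. l < n \<Longrightarrow> v l \<in> borel_measurable N"
    and G: "G \<in> Lp_fun p N" and le: "AE z in N. lq_norm n q (\<lambda>l. v l z) \<le> \<bar>G z\<bar>"
  shows "\<And>l. l < n \<Longrightarrow> v l \<in> Lp_fun p N"
    and "lq_norm n q (\<lambda>l. pint p N (v l) powr (1 / p)) \<le> pint p N G powr (1 / p)"
proof -
  have q0: "0 < q" using p q by (rule exponent_pos)
  have le_v: "AE z in N. \<bar>v l z\<bar> powr p \<le> \<bar>G z\<bar> powr p" if "l < n" for l
    using le by eventually_elim (use p abs_le_lq_norm[OF that q0, of "\<lambda>l. v l _"] in \<open>auto intro!: powr_mono2 intro: order_trans\<close>)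
  show vL: "v l \<in> Lp_fun p N" if "l < n" for l
    using v[OF that] le_v[OF that] Lp_fun_integrable[OF G] by (rule Lp_fun_dominated)
  define A where "A = (\<lambda>l. pint p N (v l))"
  have A: "0 \<le> A l" for l by (simp add: A_def pint_nonneg)
  have A_le: "A l \<le> pint p N G" if "l < n" for l
    unfolding A_def pint_def using vL[OF that] G le_v[OF that]
    by (intro integral_mono_AE) (auto simp: Lp_fun_iff)
  consider "q = \<infinity>" | r where "q = ereal r" "p \<le> r" using q by (cases q) auto
  then show "lq_norm n q (\<lambda>l. pint p N (v l) powr (1 / p)) \<le> pint p N G powr (1 / p)"
  proof cases
    case 1
    show ?thesis unfolding 1 lq_norm_top
      using n p A_le[unfolded A_def] pint_nonneg[of p N]
      by (subst Max_le_iff) (auto simp: lessThan_empty_iff intro!: powr_mono2)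
  next
    case (2 r)
    define s where "s = r / p"
    have s: "1 \<le> s" using 2 p by (simp add: s_def)
    define D where "D = (\<Sum>l<n. A l powr s)"
    have D: "0 \<le> D" by (simp add: D_def sum_nonneg)
    have goal: "lq_norm n q (\<lambda>l. pint p N (v l) powr (1 / p)) = D powr (1 / r)"
      using p A by (simp add: 2 lq_norm_real powr_powr D_def s_def A_def)
    have "D powr (1 / s) \<le> pint p N G"
    proof (cases "D = 0")
      case True
      then show ?thesis by (simp add: pint_nonneg)
    next
      case False
      with D have Dpos: "0 < D" by simp
      have pt: "(\<Sum>l<n. A l powr (s - 1) * \<bar>v l z\<bar> powr p)
          \<le> D powr ((s - 1) / s) * (\<Sum>l<n. \<bar>v l z\<bar> powr r) powr (1 / s)" for z
      proof (cases "s = 1")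
        case True
        then have "r = p" using p by (simp add: s_def)
        then show ?thesis using True Dpos by (auto simp: sum_nonneg intro!: sum_mono)
      next
        case False
        then have s1: "1 < s" using s by simp
        define W where "W = (\<Sum>l<n. \<bar>v l z\<bar> powr r)"
        have "0 \<le> W" by (simp add: W_def sum_nonneg)
        show ?thesis
        proof (cases "W = 0")
          case True
          then have "\<bar>v l z\<bar> powr r = 0" if "l < n" for l
            unfolding W_def using that by (subst (asm) sum_nonneg_eq_0_iff) auto
          then show ?thesis by auto
        next
          case False
          with \<open>0 \<le> W\<close> have W: "0 < W" by simp
          have rs: "r / s = p" using p s by (simp add: s_def)
          have dA: "(\<Sum>l<n. A l powr s / D) = 1"
            unfolding sum_divide_distrib[symmetric] D_def[symmetric] using Dpos by simp
          have dW: "(\<Sum>l<n. \<bar>v l z\<bar> powr r / W) = 1"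
            unfolding sum_divide_distrib[symmetric] W_def[symmetric] using W by simp
          have "(\<Sum>l<n. A l powr (s - 1) * \<bar>v l z\<bar> powr p) / (D powr ((s - 1) / s) * W powr (1 / s))
            = (\<Sum>l<n. (A l powr s / D) powr ((s - 1) / s) * (\<bar>v l z\<bar> powr r / W) powr (1 / s))"
            unfolding sum_divide_distrib
          proof (rule sum.cong[OF refl])
            fix l
            show "A l powr (s - 1) * \<bar>v l z\<bar> powr p / (D powr ((s - 1) / s) * W powr (1 / s))
              = (A l powr s / D) powr ((s - 1) / s) * (\<bar>v l z\<bar> powr r / W) powr (1 / s)"
              using s1 by (simp add: powr_divide powr_powr rs)
          qed
          also have "\<dots> \<le> (\<Sum>l<n. (s - 1) / s * (A l powr s / D) + 1 / s * (\<bar>v l z\<bar> powr r / W))"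
            using Dpos W s1 by (intro sum_mono young_weighted) (auto simp: field_simps)
          also have "\<dots> = (s - 1) / s * (D / D) + 1 / s * (W / W)"
            unfolding sum.distrib sum_distrib_left[symmetric] dA dW using Dpos W by simp
          also have "\<dots> = 1" using Dpos W s1 by (simp add: field_simps)
          finally have "(\<Sum>l<n. A l powr (s - 1) * \<bar>v l z\<bar> powr p) / (D powr ((s - 1) / s) * W powr (1 / s)) \<le> 1" .
          then show ?thesis using Dpos W by (simp add: W_def[symmetric] divide_le_eq)
        qed
      qed
      have "D = (\<Sum>l<n. A l powr (s - 1) * A l)"
        unfolding D_def
      proof (intro sum.cong refl)
        fix l show "A l powr s = A l powr (s - 1) * A l"
          using A[of l] powr_add[of "A l" "s - 1" 1] by (cases "A l = 0") auto
      qed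
      also have "\<dots> = (\<integral>z. (\<Sum>l<n. A l powr (s - 1) * \<bar>v l z\<bar> powr p) \<partial>N)"
        using vL by (simp add: A_def pint_def Lp_fun_integrable)
      also have "\<dots> \<le> (\<integral>z. D powr ((s - 1) / s) * \<bar>G z\<bar> powr p \<partial>N)"
      proof (rule integral_mono_AE)
        show "AE z in N. (\<Sum>l<n. A l powr (s - 1) * \<bar>v l z\<bar> powr p) \<le> D powr ((s - 1) / s) * \<bar>G z\<bar> powr p"
          using le
        proof eventually_elim
          case (elim z)
          have "(\<Sum>l<n. \<bar>v l z\<bar> powr r) powr (1 / s) = (lq_norm n q (\<lambda>l. v l z)) powr p"
            using 2 p by (simp add: lq_norm_real powr_powr s_def)
          also have "\<dots> \<le> \<bar>G z\<bar> powr p"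
            using elim p lq_norm_nonneg[OF n q0] by (intro powr_mono2) auto
          finally show ?case
            using pt[of z] by (meson mult_left_mono order_trans powr_ge_zero)
        qed
      qed (intro Bochner_Integration.integrable_sum integrable_mult_right Lp_fun_integrable vL G; simp)+
      also have "\<dots> = D powr ((s - 1) / s) * pint p N G" by (simp add: pint_def)
      finally have "D powr ((s - 1) / s) * D powr (1 / s) \<le> D powr ((s - 1) / s) * pint p N G"
        using Dpos s powr_add[of D "(s-1)/s" "1/s"] by (simp add: add_divide_distrib[symmetric])
      then show ?thesis using Dpos by simp
    qed
    then have "(D powr (1 / s)) powr (1 / p) \<le> pint p N G powr (1 / p)"
      using p by (intro powr_mono2) auto
    then show ?thesis using goal p by (simp add: powr_powr s_def)
  qed
qed

lemma lq_norm_contraction: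
  assumes p: "1 < p" and n: "1 \<le> n1" "1 \<le> n2" and q: "0 < q1" "q1 \<le> p" "ereal p \<le> q2"
    and u: "\<And>i. i < n1 \<Longrightarrow> u i \<in> Lp_fun p N" and v: "\<And>l. l < n2 \<Longrightarrow> v l \<in> borel_measurable N"
    and le: "AE z in N. lq_norm n2 q2 (\<lambda>l. v l z) \<le> lq_norm n1 (ereal q1) (\<lambda>i. u i z)"
  shows "\<And>l. l < n2 \<Longrightarrow> v l \<in> Lp_fun p N"
    and "lq_norm n2 q2 (\<lambda>l. pint p N (v l) powr (1 / p)) \<le> lq_norm n1 (ereal q1) (\<lambda>i. pint p N (u i) powr (1 / p))"
proof -
  let ?G = "\<lambda>z. lq_norm n1 (ereal q1) (\<lambda>i. u i z)"
  have M1: "?G \<in> Lp_fun p N"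
    by (rule lq_norm_Minkowski(1)[OF p n(1) q(1,2)]) (rule u)
  have M2: "pint p N ?G powr (1 / p) \<le> lq_norm n1 (ereal q1) (\<lambda>i. pint p N (u i) powr (1 / p))"
    by (rule lq_norm_Minkowski(2)[OF p n(1) q(1,2)]) (rule u)
  have le': "AE z in N. lq_norm n2 q2 (\<lambda>l. v l z) \<le> \<bar>?G z\<bar>"
    using le by (rule AE_mp) (auto intro: order_trans)
  show "v l \<in> Lp_fun p N" if "l < n2" for l
    by (rule lq_norm_integral_le(1)[where v=v, OF p n(2) q(3) _ M1 le' that]) (rule v)
  have "lq_norm n2 q2 (\<lambda>l. pint p N (v l) powr (1 / p)) \<le> pint p N ?G powr (1 / p)"
    by (rule lq_norm_integral_le(2)[where v=v, OF p n(2) q(3) _ M1 le']) (rule v)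
  then show "lq_norm n2 q2 (\<lambda>l. pint p N (v l) powr (1 / p)) \<le> lq_norm n1 (ereal q1) (\<lambda>i. pint p N (u i) powr (1 / p))"
    using M2 by (rule order_trans)
qed

lemma pint_root_triangle:
  assumes p: "1 < p" and L: "u \<in> Lp_fun p N" "v \<in> Lp_fun p N"
  shows "pint p N (\<lambda>z. u z + v z) powr (1 / p) \<le> pint p N u powr (1 / p) + pint p N v powr (1 / p)"
proof -
  let ?u = "\<lambda>i::nat. if i = 0 then u else v"
  have "lq_norm 1 \<infinity> (\<lambda>l. pint p N (\<lambda>z. u z + v z) powr (1 / p))
     \<le> lq_norm 2 (ereal 1) (\<lambda>i. pint p N (?u i) powr (1 / p))"
  proof (rule lq_norm_contraction(2)[OF p])
    show "AE z in N. lq_norm 1 \<infinity> (\<lambda>l. u z + v z) \<le> lq_norm 2 (ereal 1) (\<lambda>i. ?u i z)"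
      by (intro AE_I2) (auto simp: lq_norm_top lq_norm_real numeral_2_eq_2 lessThan_Suc)
  qed (use p L in auto)
  then show ?thesis by (simp add: lq_norm_top lq_norm_real numeral_2_eq_2 lessThan_Suc)
qed

section \<open>Separability of \<open>L\<^sup>1\<close> of a finite Borel measure\<close>

text \<open>The dense set consists of the rational combinations of indicators of finite intersections of
  basis sets.  The functions it approximates are closed under linear combinations and dominated
  limits, so the sets with approximable indicators form a Dynkin system over a generator that is
  closed under intersections.\<close>

lemma L1_countable_dense:
  fixes \<mu> :: "'a::second_countable_topology measure"
  assumes fin: "finite_measure \<mu>" and sets_\<mu>: "sets \<mu> = sets borel"
  shows "\<exists>D. countable D \<and> (\<forall>d\<in>D. integrable \<mu> d) \<and>
    (\<forall>f::'a \<Rightarrow> real. integrable \<mu> f \<longrightarrow> (\<forall>\<epsilon>>0. \<exists>d\<in>D. (\<integral>x. \<bar>f x - d x\<bar> \<partial>\<mu>) < \<epsilon>))"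
proof -
  interpret finite_measure \<mu> by fact
  let ?dist = "\<lambda>f g::'a \<Rightarrow> real. \<integral>x. \<bar>f x - g x\<bar> \<partial>\<mu>"
  obtain B :: "'a set set" where B: "countable B" "topological_basis B"
    using ex_countable_basis by blast
  define G where "G = {\<Inter>F |F. finite F \<and> F \<subseteq> B}"
  have G_open: "open A" if "A \<in> G" for A
    using that B(2) unfolding G_def topological_basis_def by (auto intro!: open_Inter)
  have B_G: "B \<subseteq> G" unfolding G_def by (auto intro: exI[of _ "{_}"])
  have G_count: "countable G"
  proof -
    have "G = Inter ` {F. F \<subseteq> B \<and> finite F}" by (auto simp: G_def)
    then show ?thesis using countable_Collect_finite_subset[OF B(1)] by (simp add: conj_commute)
  qed
  have G_UNIV: "UNIV \<in> G" unfolding G_def by (intro CollectI exI[of _ "{}"]) auto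
  have G_int: "Int_stable G"
  proof (rule Int_stableI)
    fix a b assume "a \<in> G" "b \<in> G"
    then obtain F F' where "a = \<Inter>F" "b = \<Inter>F'" "finite F" "finite F'" "F \<subseteq> B" "F' \<subseteq> B"
      by (auto simp: G_def)
    then show "a \<inter> b \<in> G" unfolding G_def by (intro CollectI exI[of _ "F \<union> F'"]) auto
  qed
  have "topological_basis G"
    using B(2) B_G G_open unfolding topological_basis_def by (meson order_trans)
  have borel_G: "sets borel = sigma_sets UNIV G"
    unfolding borel_eq_countable_basis[OF G_count \<open>topological_basis G\<close>] by (rule sets_measure_of) simp
  have G_sets: "A \<in> sets \<mu>" if "A \<in> G" for A unfolding sets_\<mu> by (rule borel_open[OF G_open[OF that]])
  define step where "step = (\<lambda>l x. \<Sum>(q, A)\<leftarrow>l. of_rat q * indicator A (x :: 'a) :: real)"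
  define D where "D = step ` lists (UNIV \<times> G)"
  have "countable D" unfolding D_def using G_count by (intro countable_image countable_lists) auto
  have step_int: "integrable \<mu> (step l)" if "l \<in> lists (UNIV \<times> G)" for l
    using that
  proof (induction l)
    case (Cons a l)
    then have "integrable \<mu> (\<lambda>x. of_rat (fst a) * indicator (snd a) x + step l x)"
      using G_sets by (intro Bochner_Integration.integrable_add integrable_mult_right) (auto simp: emeasure_eq_measure)
    then show ?case by (simp add: step_def split_beta)
  qed (simp add: step_def)
  have D_int: "integrable \<mu> d" if "d \<in> D" for d using that step_int by (auto simp: D_def)
  have D_add: "(\<lambda>x. d x + d' x) \<in> D" if dd: "d \<in> D" "d' \<in> D" for d d'
  proof -
    obtain l l' where l: "d = step l" "l \<in> lists (UNIV \<times> G)" "d' = step l'" "l' \<in> lists (UNIV \<times> G)"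
      using dd by (auto simp: D_def)
    then have "(\<lambda>x. d x + d' x) = step (l @ l')" by (auto simp: step_def)
    then show ?thesis unfolding D_def using l by (auto simp del: lists_eq_set intro!: imageI)
  qed
  have D_scale: "(\<lambda>x. of_rat q * d x) \<in> D" if d: "d \<in> D" for q d
  proof -
    obtain l where l: "d = step l" "l \<in> lists (UNIV \<times> G)" using d by (auto simp: D_def)
    have "(\<lambda>x. of_rat q * step l x) = step (map (\<lambda>(q', A). (q * q', A)) l)"
      by (rule ext, induction l) (auto simp: step_def algebra_simps of_rat_mult)
    moreover have "map (\<lambda>(q', A). (q * q', A)) l \<in> lists (UNIV \<times> G)" using l(2) by (induction l) auto
    ultimately show ?thesis using l by (auto simp: D_def)
  qed
  define P where "P = (\<lambda>f::'a \<Rightarrow> real. integrable \<mu> f \<and> (\<forall>\<epsilon>>0. \<exists>d\<in>D. ?dist f d < \<epsilon>))"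
  have PI: "P f" if f: "integrable \<mu> f" and ap: "\<And>\<epsilon>. 0 < \<epsilon> \<Longrightarrow> \<exists>g. P g \<and> ?dist f g < \<epsilon>" for f
    unfolding P_def
  proof (intro conjI allI impI f)
    fix \<epsilon> :: real assume "0 < \<epsilon>"
    then obtain g where g: "P g" "?dist f g < \<epsilon> / 2" using ap[of "\<epsilon> / 2"] by auto
    then obtain d where d: "d \<in> D" "?dist g d < \<epsilon> / 2"
      using \<open>0 < \<epsilon>\<close> unfolding P_def by (meson half_gt_zero)
    have "?dist f d \<le> (\<integral>x. \<bar>f x - g x\<bar> + \<bar>g x - d x\<bar> \<partial>\<mu>)"
      using f g d D_int by (intro integral_mono) (auto simp: P_def)
    also have "\<dots> < \<epsilon>" using f g d D_int by (simp add: P_def)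
    finally show "\<exists>d\<in>D. ?dist f d < \<epsilon>" using d by blast
  qed
  have P_add: "P (\<lambda>x. f x + g x)" if fg: "P f" "P g" for f g
    unfolding P_def
  proof (intro conjI allI impI)
    show "integrable \<mu> (\<lambda>x. f x + g x)" using fg by (auto simp: P_def)
    fix \<epsilon> :: real assume "0 < \<epsilon>"
    then obtain d d' where d: "d \<in> D" "?dist f d < \<epsilon> / 2" "d' \<in> D" "?dist g d' < \<epsilon> / 2"
      using fg unfolding P_def by (meson half_gt_zero)
    have "(\<integral>x. \<bar>(f x + g x) - (d x + d' x)\<bar> \<partial>\<mu>) \<le> (\<integral>x. \<bar>f x - d x\<bar> + \<bar>g x - d' x\<bar> \<partial>\<mu>)"
      using fg d D_int by (intro integral_mono) (auto simp: P_def)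
    also have "\<dots> < \<epsilon>" using fg d D_int by (simp add: P_def)
    finally show "\<exists>d\<in>D. (\<integral>x. \<bar>(f x + g x) - d x\<bar> \<partial>\<mu>) < \<epsilon>" by (rule bexI[OF _ D_add[OF d(1,3)]])
  qed
  have P_scale: "P (\<lambda>x. c * f x)" if f: "P f" for f c
    unfolding P_def
  proof (intro conjI allI impI)
    note i = f[unfolded P_def, THEN conjunct1]
    show "integrable \<mu> (\<lambda>x. c * f x)" using i by simp
    fix \<epsilon> :: real assume \<epsilon>: "0 < \<epsilon>"
    define M where "M = (\<integral>x. \<bar>f x\<bar> \<partial>\<mu>) + 1"
    have M: "0 < M" unfolding M_def by (intro add_nonneg_pos integral_nonneg) auto
    obtain q where q: "\<bar>c - of_rat q\<bar> < \<epsilon> / (2 * M)"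
    proof -
      have "c - \<epsilon> / (2 * M) < c + \<epsilon> / (2 * M)" using \<epsilon> M by simp
      from of_rat_dense[OF this] obtain q where "c - \<epsilon> / (2 * M) < of_rat q" "of_rat q < c + \<epsilon> / (2 * M)" by auto
      then show ?thesis by (intro that[of q]) (auto simp: abs_if)
    qed
    define R where "R = \<bar>of_rat q :: real\<bar> + 1"
    have R: "0 < R" by (simp add: R_def add_nonneg_pos)
    obtain d where d: "d \<in> D" "?dist f d < \<epsilon> / (2 * R)"
      using f \<epsilon> R unfolding P_def by (meson divide_pos_pos mult_pos_pos zero_less_numeral)
    have "(\<integral>x. \<bar>c * f x - of_rat q * d x\<bar> \<partial>\<mu>) \<le> (\<integral>x. \<bar>c - of_rat q\<bar> * \<bar>f x\<bar> + \<bar>of_rat q\<bar> * \<bar>f x - d x\<bar> \<partial>\<mu>)"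
    proof (rule integral_mono)
      fix x
      have "c * f x - of_rat q * d x = (c - of_rat q) * f x + of_rat q * (f x - d x)" by (simp add: algebra_simps)
      then show "\<bar>c * f x - of_rat q * d x\<bar> \<le> \<bar>c - of_rat q\<bar> * \<bar>f x\<bar> + \<bar>of_rat q\<bar> * \<bar>f x - d x\<bar>"
        by (metis abs_mult abs_triangle_ineq)
    qed (use i d D_int in auto)
    also have "\<dots> = \<bar>c - of_rat q\<bar> * (\<integral>x. \<bar>f x\<bar> \<partial>\<mu>) + \<bar>of_rat q\<bar> * ?dist f d"
      using i d D_int by simp
    also have "\<dots> < \<epsilon> / 2 + \<epsilon> / 2"
    proof (rule add_less_le_mono)
      have "\<bar>c - of_rat q\<bar> * (\<integral>x. \<bar>f x\<bar> \<partial>\<mu>) \<le> \<bar>c - of_rat q\<bar> * M"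
        unfolding M_def by (intro mult_left_mono) auto
      also have "\<dots> < \<epsilon> / (2 * M) * M" using q M by (intro mult_strict_right_mono) auto
      finally show "\<bar>c - of_rat q\<bar> * (\<integral>x. \<bar>f x\<bar> \<partial>\<mu>) < \<epsilon> / 2" using M by simp
      have "\<bar>of_rat q\<bar> * ?dist f d \<le> R * (\<epsilon> / (2 * R))"
        using d R by (intro mult_mono) (auto simp: R_def)
      then show "\<bar>of_rat q\<bar> * ?dist f d \<le> \<epsilon> / 2" using R by simp
    qed
    also have "\<epsilon> / 2 + \<epsilon> / 2 = \<epsilon>" by simp
    finally show "\<exists>d\<in>D. (\<integral>x. \<bar>c * f x - d x\<bar> \<partial>\<mu>) < \<epsilon>" by (rule bexI[OF _ D_scale[OF d(1)]])
  qed
  have P_lim: "P f" if f: "integrable \<mu> f" and s: "\<And>i::nat. P (s i)"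
      and conv: "\<And>x. (\<lambda>i. s i x) \<longlonglongrightarrow> f x" and bd: "\<And>i x. \<bar>s i x\<bar> \<le> w x" and w: "integrable \<mu> w" for f s w
  proof (rule PI[OF f])
    fix \<epsilon> :: real assume \<epsilon>: "0 < \<epsilon>"
    have si: "s i \<in> borel_measurable \<mu>" for i
      using s[of i] unfolding P_def by (elim conjE) (rule borel_measurable_integrable)
    have "(\<lambda>i. ?dist f (s i)) \<longlonglongrightarrow> (\<integral>x. 0 \<partial>\<mu>)"
    proof (rule integral_dominated_convergence)
      show "AE x in \<mu>. (\<lambda>i. \<bar>f x - s i x\<bar>) \<longlonglongrightarrow> 0"
        using conv by (auto intro!: AE_I2 tendsto_eq_intros)
      show "AE x in \<mu>. norm \<bar>f x - s i x\<bar> \<le> \<bar>f x\<bar> + w x" for i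
      proof (rule AE_I2)
        fix x show "norm \<bar>f x - s i x\<bar> \<le> \<bar>f x\<bar> + w x" using bd[of i x] by auto
      qed
    qed (use f si w in auto)
    then have "eventually (\<lambda>i. ?dist f (s i) < \<epsilon>) sequentially"
      using \<epsilon> by (auto dest: order_tendstoD)
    then show "\<exists>g. P g \<and> ?dist f g < \<epsilon>"
      using s by (auto simp: eventually_sequentially)
  qed
  have ind_int: "integrable \<mu> (indicator A :: _ \<Rightarrow> real)" if "A \<in> sets borel" for A
    using that sets_\<mu> by (auto simp: emeasure_eq_measure)
  have P_G: "P (indicator A)" if A: "A \<in> G" for A
  proof -
    have "step [(1, A)] \<in> D" unfolding D_def using A by (intro imageI) auto
    then show ?thesis unfolding P_def using ind_int G_open[OF A]
      by (auto simp: step_def intro!: bexI[of _ "step [(1, A)]"])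
  qed
  have P_empty: "P (indicator {})"
  proof -
    have "step [] \<in> D" by (auto simp: D_def)
    then show ?thesis unfolding P_def by (auto simp: step_def intro!: bexI[of _ "step []"])
  qed
  have P_ind: "P (indicator A)" if "A \<in> sigma_sets UNIV G" for A
  proof -
    have "G \<subseteq> Pow UNIV" by simp
    with G_int show ?thesis using that
    proof (induction rule: sigma_sets_induct_disjoint)
      case (basic A)
      then show ?case by (rule P_G)
    next
      case empty
      show ?case by (rule P_empty)
    next
      case (compl A)
      have "P (\<lambda>x. indicator UNIV x + (-1) * indicator A x)"
        by (intro P_add P_scale P_G G_UNIV compl)
      also have "(\<lambda>x. indicator UNIV x + (-1) * indicator A x) = (indicator (UNIV - A) :: 'a \<Rightarrow> real)"
        by (auto simp: indicator_def)
      finally show ?case .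
    next
      case (union A)
      show ?case
      proof (rule P_lim[where s = "\<lambda>n. indicator (\<Union>i<n. A i)" and w = "\<lambda>_. 1"])
        show "integrable \<mu> (indicator (\<Union>i. A i) :: _ \<Rightarrow> real)"
          using union(2) by (intro ind_int) (auto simp: borel_G intro!: sigma_sets.Union)
        show "P (indicator (\<Union>i<n. A i))" for n
        proof (induction n)
          case 0
          show ?case using P_empty by (simp only: lessThan_0 image_empty Union_empty)
        next
          case (Suc n)
          have "(\<lambda>x. indicator (\<Union>i<n. A i) x + indicator (A n) x) = (indicator (\<Union>i<Suc n. A i) :: _ \<Rightarrow> real)"
          proof -
            have "A i \<inter> A n = {}" if "i < n" for i
              using disjoint_family_onD[OF union(1), of i n] that by simp
            then have dj: "(\<Union>i<n. A i) \<inter> A n = {}" by blast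
            have un: "(\<Union>i<Suc n. A i) = (\<Union>i<n. A i) \<union> A n" by (simp add: lessThan_Suc Un_commute)
            show ?thesis unfolding un by (intro ext indicator_disj_union[OF dj, symmetric])
          qed
          then show ?case using P_add[OF Suc union(3)[of n]] by (simp only:)
        qed
        show "(\<lambda>n. indicator (\<Union>i<n. A i) x) \<longlonglongrightarrow> (indicator (\<Union>i. A i) x :: real)" for x
          by (rule LIMSEQ_indicator_UN)
      qed (auto simp: indicator_def)
    qed
  qed
  have "P f" if "integrable \<mu> f" for f
    using that
  proof (induction rule: integrable_induct)
    case (base A c)
    have "P (\<lambda>x. c * indicator A x)" using base sets_\<mu> borel_G by (intro P_scale P_ind) auto
    then show ?case by (simp add: mult.commute)
  next
    case (add f g)
    then show ?case by (intro P_add)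
  next
    case (lim f s)
    show ?case
      by (rule P_lim[where s = s and w = "\<lambda>x. 2 * \<bar>f x\<bar>"])
        (use lim(1-5) sets_eq_imp_space_eq[OF sets_\<mu>] in \<open>simp_all add: space_borel\<close>)
  qed
  then show ?thesis using \<open>countable D\<close> D_int unfolding P_def by blast
qed

text \<open>A \<open>\<sigma>\<close>-finite measure is replaced by an equivalent finite one so that \<open>L\<^sup>p\<close> embeds in a
  separable \<open>L\<^sup>1\<close> space.\<close>

lemma equivalent_finite_measure:
  fixes m :: "'a measure"
  assumes sf: "sigma_finite_measure m" and p: "1 \<le> p"
  shows "\<exists>\<mu>. finite_measure \<mu> \<and> sets \<mu> = sets m \<and> (\<forall>P. (AE x in \<mu>. P x) \<longleftrightarrow> (AE x in m. P x)) \<and>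
    (\<forall>f\<in>Lp_fun p m. integrable \<mu> f)"
proof -
  interpret sigma_finite_measure m by fact
  obtain w :: "'a \<Rightarrow> real" where w[measurable]: "w \<in> borel_measurable m" and w01: "\<And>x. 0 < w x" "\<And>x. w x \<le> 1" and wi: "integrable m w"
    using obtain_positive_integrable_function by blast
  define \<mu> where "\<mu> = density m (\<lambda>x. ennreal (w x))"
  have "finite_measure \<mu>"
  proof (rule finite_measureI)
    have "emeasure \<mu> (space \<mu>) = (\<integral>\<^sup>+x. ennreal (w x) \<partial>m)"
      unfolding \<mu>_def by (subst emeasure_density) (auto intro!: nn_integral_cong)
    also have "\<dots> = ennreal (\<integral>x. w x \<partial>m)"
      using wi w01 by (intro nn_integral_eq_integral) (auto intro!: AE_I2 less_imp_le)
    finally show "emeasure \<mu> (space \<mu>) \<noteq> \<infinity>" by simp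
  qed
  moreover have "(AE x in \<mu>. P x) \<longleftrightarrow> (AE x in m. P x)" for P
    unfolding \<mu>_def by (subst AE_density) (auto simp: w01)
  moreover have "integrable \<mu> f" if f: "f \<in> Lp_fun p m" for f
  proof -
    note [measurable] = Lp_fun_measurable[OF f]
    have "integrable m (\<lambda>x. w x * f x)"
    proof (rule Bochner_Integration.integrable_bound)
      show "integrable m (\<lambda>x. w x + \<bar>f x\<bar> powr p)"
        by (intro Bochner_Integration.integrable_add wi Lp_fun_integrable f)
      show "AE x in m. norm (w x * f x) \<le> norm (w x + \<bar>f x\<bar> powr p)"
      proof (rule AE_I2)
        fix x
        show "norm (w x * f x) \<le> norm (w x + \<bar>f x\<bar> powr p)"
        proof (cases "\<bar>f x\<bar> \<le> 1")
          case True
          then have "w x * \<bar>f x\<bar> \<le> w x * 1" using w01[of x] by (intro mult_left_mono) auto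
          then show ?thesis using w01[of x] by (simp add: abs_mult add_increasing2 abs_of_pos add_pos_nonneg)
        next
          case False
          then have "\<bar>f x\<bar> powr 1 \<le> \<bar>f x\<bar> powr p" using p by (intro powr_mono) auto
          moreover have "w x * \<bar>f x\<bar> \<le> 1 * \<bar>f x\<bar>" using w01[of x] by (intro mult_right_mono) auto
          ultimately show ?thesis using w01[of x] by (simp add: abs_mult abs_of_pos add_pos_nonneg)
        qed
      qed
    qed auto
    then show ?thesis unfolding \<mu>_def using w01 by (subst integrable_real_density) (auto simp: less_imp_le)
  qed
  ultimately show ?thesis by (intro exI[of _ \<mu>]) (auto simp: \<mu>_def)
qed

section \<open>Nonlocal energies as integrals over a weighted product space\<close>

definition grad :: "('a \<Rightarrow> real) \<Rightarrow> 'a \<times> 'a \<Rightarrow> real" where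
  "grad f z = f (fst z) - f (snd z)"

lemma grad_add: "grad (\<lambda>x. f x + g x) = (\<lambda>z. grad f z + grad g z)"
  by (auto simp: grad_def)

lemma grad_diff: "grad (\<lambda>x. f x - g x) = (\<lambda>z. grad f z - grad g z)"
  by (auto simp: grad_def)

lemma grad_cmult: "grad (\<lambda>x. a * f x) = (\<lambda>z. a * grad f z)"
  by (auto simp: grad_def algebra_simps)

lemma grad_midpoint: "grad (\<lambda>x. (f x + g x) / 2) = (\<lambda>z. (grad f z + grad g z) / 2)"
  by (auto simp: grad_def field_simps)

text \<open>The measure \<open>\<mu>\<close> is the finite substitute for \<open>m\<close>: distances in \<open>L\<^sup>1(\<mu>)\<close> will measure how close
  functions in \<open>B\<close> are apart from their energies.\<close>

locale kernel_energy =
  fixes p C :: real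
    and m :: "'a::{metric_space, second_countable_topology} measure"
    and k :: "real \<Rightarrow> 'a \<Rightarrow> 'a \<Rightarrow> ennreal"
    and \<mu> :: "'a measure"
  assumes p: "1 < p"
    and m: "admissible_measure m"
    and k: "kernel_family k"
    and WM: "weak_monotonicity p m k C"
    and \<mu>_finite: "finite_measure \<mu>"
    and sets_\<mu>: "sets \<mu> = sets m"
    and AE_\<mu>: "\<And>P. (AE x in \<mu>. P x) \<longleftrightarrow> (AE x in m. P x)"
    and Lp_integrable_\<mu>: "\<And>f. f \<in> Lp_fun p m \<Longrightarrow> integrable \<mu> f"
begin

abbreviation "B \<equiv> B_space p m k"

definition N :: "real \<Rightarrow> ('a \<times> 'a) measure" where
  "N r = density (m \<Otimes>\<^sub>M m) (\<lambda>(x, y). k r x y)"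

definition j :: "real \<Rightarrow> ('a \<Rightarrow> real) \<Rightarrow> real" where
  "j r f = pint p (N r) (grad f)"

definition S :: "('a \<Rightarrow> real) \<Rightarrow> real" where
  "S f = enn2real (SUP r\<in>{0<..}. J p m k r f)"

lemma p0: "0 \<le> p" and p_pos: "0 < p" using p by auto

lemma C_ge_1: "1 \<le> C" using WM by (simp add: weak_monotonicity_def)

lemma sets_m: "sets m = sets borel"
  using m by (simp add: admissible_measure_def)

lemma space_m: "space m = UNIV"
  using sets_eq_imp_space_eq[OF sets_m] by simp

sublocale m: sigma_finite_measure m
  using m by (simp add: admissible_measure_def)

sublocale mm: pair_sigma_finite m m
  by standard

lemma sets_mm: "sets (m \<Otimes>\<^sub>M m) = sets (borel :: ('a \<times> 'a) measure)"
  unfolding borel_prod[symmetric] by (rule sets_pair_measure_cong[OF sets_m sets_m])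

lemma measurable_k: "0 < r \<Longrightarrow> (\<lambda>(x, y). k r x y) \<in> borel_measurable (m \<Otimes>\<^sub>M m)"
  using k by (simp add: kernel_family_def measurable_cong_sets[OF sets_mm refl])

lemma sets_N: "sets (N r) = sets (m \<Otimes>\<^sub>M m)"
  by (simp add: N_def)

lemma measurable_N: "borel_measurable (N r) = borel_measurable (m \<Otimes>\<^sub>M m)"
  by (rule measurable_cong_sets[OF sets_N refl])

lemma measurable_grad:
  assumes [measurable]: "f \<in> borel_measurable m"
  shows "grad f \<in> borel_measurable (N r)"
  unfolding measurable_N grad_def by measurable

lemma AE_N: "0 < r \<Longrightarrow> (AE z in m \<Otimes>\<^sub>M m. P z) \<Longrightarrow> (AE z in N r. P z)"
  unfolding N_def by (subst AE_density[OF measurable_k]) auto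

lemma AE_N_both:
  assumes "0 < r" "AE x in m. P x"
  shows "AE z in N r. P (fst z) \<and> P (snd z)"
proof (rule AE_N[OF assms(1)])
  obtain A where A: "A \<in> null_sets m" "{x \<in> space m. \<not> P x} \<subseteq> A"
    using assms(2) by (auto simp: eventually_ae_filter)
  have "AE z in m \<Otimes>\<^sub>M m. z \<notin> A \<times> UNIV \<union> UNIV \<times> A"
  proof (rule AE_not_in)
    have "A \<times> space m \<in> null_sets (m \<Otimes>\<^sub>M m)" "space m \<times> A \<in> null_sets (m \<Otimes>\<^sub>M m)"
      using A(1) by (auto simp: null_sets_def m.emeasure_pair_measure_Times)
    then show "A \<times> UNIV \<union> UNIV \<times> A \<in> null_sets (m \<Otimes>\<^sub>M m)" by (simp add: space_m null_sets.Un)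
  qed
  then show "AE z in m \<Otimes>\<^sub>M m. P (fst z) \<and> P (snd z)"
    by eventually_elim (use A(2) in \<open>auto simp: space_m\<close>)
qed

lemma J_eq:
  assumes "0 < r" "f \<in> borel_measurable m"
  shows "J p m k r f = npint p (N r) (grad f)"
proof -
  note [measurable] = measurable_k[OF assms(1)] assms(2)
  have g: "(\<lambda>z. ennreal (\<bar>grad f z\<bar> powr p)) \<in> borel_measurable (m \<Otimes>\<^sub>M m)"
    unfolding grad_def by measurable
  have "npint p (N r) (grad f)
     = (\<integral>\<^sup>+z. (case z of (x, y) \<Rightarrow> k r x y) * ennreal (\<bar>grad f z\<bar> powr p) \<partial>(m \<Otimes>\<^sub>M m))"
    unfolding N_def by (rule nn_integral_density[OF measurable_k[OF assms(1)] g])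
  also have "\<dots> = (\<integral>\<^sup>+x. \<integral>\<^sup>+y. k r x y * ennreal (\<bar>grad f (x, y)\<bar> powr p) \<partial>m \<partial>m)"
    using g by (subst m.nn_integral_fst[symmetric]) (auto simp: split_beta)
  also have "\<dots> = J p m k r f" by (simp add: J_def grad_def mult.commute)
  finally show ?thesis ..
qed

lemma J_cong_AE:
  assumes "0 < r" "f \<in> borel_measurable m" "g \<in> borel_measurable m" "AE x in m. f x = g x"
  shows "J p m k r f = J p m k r g"
  unfolding J_eq[OF assms(1,2)] J_eq[OF assms(1,3)]
  by (rule nn_integral_cong_AE) (use AE_N_both[OF assms(1,4)] in \<open>eventually_elim, auto simp: grad_def\<close>)

lemma B_Lp: "f \<in> B \<Longrightarrow> f \<in> Lp_fun p m"
  by (simp add: B_space_def)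

lemma B_measurable [measurable_dest]: "f \<in> B \<Longrightarrow> f \<in> borel_measurable m"
  by (auto dest: B_Lp Lp_fun_measurable)

lemma SUP_J: "f \<in> B \<Longrightarrow> (SUP r\<in>{0<..}. J p m k r f) = ennreal (S f)"
  by (auto simp: B_space_def S_def)

lemma S_nonneg: "0 \<le> S f"
  by (simp add: S_def)

lemma J_le_S: "f \<in> B \<Longrightarrow> 0 < r \<Longrightarrow> J p m k r f \<le> ennreal (S f)"
  using SUP_J[of f] SUP_upper[of r "{0<..}" "\<lambda>r. J p m k r f"] by auto

lemma grad_Lp: "f \<in> B \<Longrightarrow> 0 < r \<Longrightarrow> grad f \<in> Lp_fun p (N r)"
  using J_le_S[of f r] unfolding Lp_fun_def
  by (auto simp: J_eq B_measurable intro: measurable_grad le_less_trans)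

lemma J_eq_j: "f \<in> B \<Longrightarrow> 0 < r \<Longrightarrow> J p m k r f = ennreal (j r f)"
  unfolding j_def by (subst J_eq) (auto intro: nn_integral_eq_pint grad_Lp B_measurable)

lemma j_nonneg: "0 \<le> j r f"
  by (simp add: j_def pint_nonneg)

lemma j_le_S: "f \<in> B \<Longrightarrow> 0 < r \<Longrightarrow> j r f \<le> S f"
  using J_le_S[of f r] by (simp add: J_eq_j S_nonneg)

lemma BI:
  assumes "f \<in> Lp_fun p m" and "\<And>r. 0 < r \<Longrightarrow> grad f \<in> Lp_fun p (N r)"
    and le: "\<And>r. 0 < r \<Longrightarrow> j r f \<le> c"
  shows "f \<in> B" and "S f \<le> c"
proof -
  have J: "J p m k r f = ennreal (j r f)" if "0 < r" for r
    unfolding j_def using assms that by (subst J_eq) (auto intro: nn_integral_eq_pint Lp_fun_measurable)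
  have c: "0 \<le> c" using le[of 1] j_nonneg[of 1 f] by simp
  have le': "(SUP r\<in>{0<..}. J p m k r f) \<le> ennreal c"
    using J le by (auto intro!: SUP_least ennreal_leI)
  then show "f \<in> B" using assms(1) by (auto simp: B_space_def intro: le_less_trans)
  then show "S f \<le> c" using le' c by (simp add: SUP_J)
qed

lemma zero_Lp: "(\<lambda>_. 0) \<in> Lp_fun p M"
  by (simp add: Lp_fun_def)

lemma zero_B: "(\<lambda>_. 0) \<in> B"
  by (auto simp: B_space_def zero_Lp J_def)

lemma
  assumes "f \<in> B" "g \<in> B"
  shows B_add: "(\<lambda>x. f x + g x) \<in> B" and S_add: "S (\<lambda>x. f x + g x) \<le> 2 powr p * (S f + S g)"
proof -
  have L: "(\<lambda>x. f x + g x) \<in> Lp_fun p m" using assms by (intro Lp_fun_add p0 B_Lp)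
  have G: "grad (\<lambda>x. f x + g x) \<in> Lp_fun p (N r)" if "0 < r" for r
    unfolding grad_add using assms that by (intro Lp_fun_add p0 grad_Lp)
  have j: "j r (\<lambda>x. f x + g x) \<le> 2 powr p * (S f + S g)" if r: "0 < r" for r
  proof -
    have "j r (\<lambda>x. f x + g x) \<le> 2 powr p * (j r f + j r g)"
      unfolding j_def grad_add using assms r by (intro pint_add_le p0 grad_Lp)
    also have "\<dots> \<le> 2 powr p * (S f + S g)" using assms r by (intro mult_left_mono add_mono j_le_S) auto
    finally show ?thesis .
  qed
  show "(\<lambda>x. f x + g x) \<in> B" "S (\<lambda>x. f x + g x) \<le> 2 powr p * (S f + S g)"
    using BI[OF L G j] by auto
qed

lemma j_cmult: "j r (\<lambda>x. a * f x) = \<bar>a\<bar> powr p * j r f"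
  by (simp add: j_def grad_cmult pint_cmult)

lemma B_cmult:
  assumes "f \<in> B"
  shows "(\<lambda>x. a * f x) \<in> B"
proof (rule BI(1))
  show "(\<lambda>x. a * f x) \<in> Lp_fun p m" using assms by (intro Lp_fun_cmult B_Lp)
  fix r :: real assume r: "0 < r"
  show "grad (\<lambda>x. a * f x) \<in> Lp_fun p (N r)"
    unfolding grad_cmult using assms r by (intro Lp_fun_cmult grad_Lp)
  show "j r (\<lambda>x. a * f x) \<le> \<bar>a\<bar> powr p * S f"
    unfolding j_cmult using j_le_S[OF assms r] by (intro mult_left_mono) auto
qed

lemma B_diff: "f \<in> B \<Longrightarrow> g \<in> B \<Longrightarrow> (\<lambda>x. f x - g x) \<in> B"
  using B_add[of f "\<lambda>x. (-1) * g x"] B_cmult[of g "-1"] by simp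

lemma B_midpoint: "f \<in> B \<Longrightarrow> g \<in> B \<Longrightarrow> (\<lambda>x. (f x + g x) / 2) \<in> B"
  using B_cmult[OF B_add, of f g "1/2"] by simp

lemma j_root_triangle:
  "f \<in> B \<Longrightarrow> g \<in> B \<Longrightarrow> 0 < r \<Longrightarrow> j r (\<lambda>x. f x + g x) powr (1 / p) \<le> j r f powr (1 / p) + j r g powr (1 / p)"
  unfolding j_def grad_add by (intro pint_root_triangle p grad_Lp)

lemma j_root_lipschitz:
  assumes "f \<in> B" "g \<in> B" "0 < r"
  shows "\<bar>j r f powr (1 / p) - j r g powr (1 / p)\<bar> \<le> S (\<lambda>x. f x - g x) powr (1 / p)"
proof -
  have d: "(\<lambda>x. f x - g x) \<in> B" by (rule B_diff[OF assms(1,2)])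
  have d': "(\<lambda>x. g x - f x) \<in> B" by (rule B_diff[OF assms(2,1)])
  have sym: "j r (\<lambda>x. g x - f x) = j r (\<lambda>x. f x - g x)"
    using j_cmult[of r "-1" "\<lambda>x. f x - g x"] by simp
  have le: "j r (\<lambda>x. f x - g x) powr (1 / p) \<le> S (\<lambda>x. f x - g x) powr (1 / p)"
    using j_le_S[OF d assms(3)] j_nonneg p by (intro powr_mono2) auto
  have "j r f powr (1 / p) \<le> j r (\<lambda>x. f x - g x) powr (1 / p) + j r g powr (1 / p)"
    using j_root_triangle[OF d assms(2,3)] by simp
  moreover have "j r g powr (1 / p) \<le> j r (\<lambda>x. g x - f x) powr (1 / p) + j r f powr (1 / p)"
    using j_root_triangle[OF d' assms(1,3)] by simp
  ultimately show ?thesis using le unfolding sym by linarith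
qed

lemma weak_monotonicity_eventually:
  assumes f: "f \<in> B" and c: "c < S f / C"
  shows "eventually (\<lambda>r. c < j r f) (at_right 0)"
proof (cases "c < 0")
  case True
  then show ?thesis using j_nonneg less_le_trans by (intro always_eventually) blast
next
  case False
  have "\<not> Liminf (at_right 0) (\<lambda>r. J p m k r f) \<le> ennreal c"
  proof
    assume le: "Liminf (at_right 0) (\<lambda>r. J p m k r f) \<le> ennreal c"
    have "ennreal (S f) \<le> ennreal C * Liminf (at_right 0) (\<lambda>r. J p m k r f)"
      using WM f by (simp add: weak_monotonicity_def SUP_J)
    also have "\<dots> \<le> ennreal C * ennreal c" using le by (intro mult_left_mono) auto
    also have "\<dots> = ennreal (C * c)" using C_ge_1 False by (simp add: ennreal_mult)
    finally have "S f \<le> C * c" using False C_ge_1 by simp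
    then show False using c C_ge_1 by (simp add: field_simps)
  qed
  then have "ennreal c < Liminf (at_right 0) (\<lambda>r. J p m k r f)" by simp
  from less_LiminfD[OF this] eventually_at_right_less[of 0]
  show ?thesis by eventually_elim (use False in \<open>simp add: J_eq_j[OF f] ennreal_less_iff\<close>)
qed

definition limsup_bounds :: "('a \<Rightarrow> real) \<Rightarrow> real set" where
  "limsup_bounds f = {c. eventually (\<lambda>r. j r f \<le> c) (at_right 0)}"

text \<open>The upper limit of the energies as \<open>r \<down> 0\<close>, which is available before any limit is known to
  exist.  The infimum is over real bounds so that no extended reals enter.\<close>

definition limsup_energy :: "('a \<Rightarrow> real) \<Rightarrow> real" where
  "limsup_energy f = Inf (limsup_bounds f)"

lemma limsup_bounds_nonneg:
  assumes "c \<in> limsup_bounds f"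
  shows "0 \<le> c"
proof -
  have "\<exists>r. j r f \<le> c"
    using assms eventually_happens'[OF trivial_limit_at_right_real] by (auto simp: limsup_bounds_def)
  then show ?thesis using j_nonneg order_trans by blast
qed

lemma S_in_limsup_set: "f \<in> B \<Longrightarrow> S f \<in> limsup_bounds f"
  using eventually_at_right_less[of "0::real"]
  by (auto simp: limsup_bounds_def elim!: eventually_mono intro: j_le_S)

lemma limsup_energy_le: "eventually (\<lambda>r. j r f \<le> c) (at_right 0) \<Longrightarrow> limsup_energy f \<le> c"
  unfolding limsup_energy_def
  by (rule cInf_lower) (auto simp: limsup_bounds_def intro!: bdd_belowI limsup_bounds_nonneg)

lemma limsup_energy_nonneg: "f \<in> B \<Longrightarrow> 0 \<le> limsup_energy f"
  unfolding limsup_energy_def using S_in_limsup_set by (intro cInf_greatest limsup_bounds_nonneg) auto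

lemma limsup_energy_eventually:
  assumes "f \<in> B" "0 < e"
  shows "eventually (\<lambda>r. j r f \<le> limsup_energy f + e) (at_right 0)"
proof -
  obtain c where c: "eventually (\<lambda>r. j r f \<le> c) (at_right 0)" "c < limsup_energy f + e"
    using cInf_lessD[of "limsup_bounds f" "limsup_energy f + e"]
      S_in_limsup_set[OF assms(1)] assms(2) unfolding limsup_energy_def limsup_bounds_def by auto
  show ?thesis using c(1) by eventually_elim (use c(2) in simp)
qed

text \<open>Take limits in the inequality for a single \<open>r\<close>.  The energy of the midpoint is close to its upper
  limit for some arbitrarily small \<open>r\<close>, whereas all other terms are controlled for all small \<open>r\<close>, the
  energy of the difference by weak monotonicity.\<close>

lemma limsup_energy_uniformly_convex:
  assumes \<epsilon>: "0 < \<epsilon>"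
  shows "\<exists>K\<ge>0. \<forall>u\<in>B. \<forall>v\<in>B. S (\<lambda>x. u x - v x) / C + K * limsup_energy (\<lambda>x. (u x + v x) / 2)
     \<le> (\<epsilon> + K / 2) * (limsup_energy u + limsup_energy v)"
proof -
  obtain K where K: "0 \<le> K" and le: "\<And>(M::('a\<times>'a) measure) u v. u \<in> Lp_fun p M \<Longrightarrow> v \<in> Lp_fun p M \<Longrightarrow>
    pint p M (\<lambda>z. u z - v z) + K * pint p M (\<lambda>z. (u z + v z) / 2) \<le> (\<epsilon> + K / 2) * (pint p M u + pint p M v)"
    using pint_uniformly_convex[OF p \<epsilon>, where 'z="'a\<times>'a"] by blast
  have "S (\<lambda>x. u x - v x) / C + K * limsup_energy (\<lambda>x. (u x + v x) / 2)
     \<le> (\<epsilon> + K / 2) * (limsup_energy u + limsup_energy v)" if uv: "u \<in> B" "v \<in> B" for u v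
  proof (rule field_le_epsilon)
    fix e :: real assume e: "0 < e"
    let ?w = "\<lambda>x. (u x + v x) / 2" and ?d = "\<lambda>x. u x - v x"
    let ?R = "\<lambda>e'. (\<epsilon> + K / 2) * (limsup_energy u + limsup_energy v + 2 * e')"
    define e' where "e' = e / (1 + 2 * \<epsilon> + 2 * K)"
    have e': "0 < e'" unfolding e'_def using e \<epsilon> K by (auto intro!: divide_pos_pos add_pos_nonneg)
    have e'_mult: "e' * (1 + 2 * \<epsilon> + 2 * K) = e" unfolding e'_def using \<epsilon> K by (simp add: add_pos_nonneg less_imp_neq[symmetric])
    have d: "?d \<in> B" by (rule B_diff[OF uv])
    have lower: "eventually (\<lambda>r. S ?d / C - e' < j r ?d) (at_right 0)"
      using e' by (intro weak_monotonicity_eventually d) simp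
    have ev: "eventually (\<lambda>r. K * j r ?w \<le> ?R e' - (S ?d / C - e')) (at_right 0)"
      using limsup_energy_eventually[OF uv(1) e'] limsup_energy_eventually[OF uv(2) e']
        lower eventually_at_right_less[of "0::real"]
    proof eventually_elim
      case (elim r)
      have "j r ?d + K * j r ?w \<le> (\<epsilon> + K / 2) * (j r u + j r v)"
        unfolding j_def grad_diff grad_midpoint using uv elim by (intro le grad_Lp)
      also have "\<dots> \<le> ?R e'"
        using elim \<epsilon> K by (intro mult_left_mono) auto
      finally show ?case using elim e' by simp
    qed
    have "K * limsup_energy ?w \<le> ?R e' - (S ?d / C - e')"
    proof (cases "K = 0")
      case True
      then have "\<exists>r::real. 0 \<le> ?R e' - (S ?d / C - e')" using eventually_happens'[OF trivial_limit_at_right_real ev] by simp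
      then show ?thesis using True by simp
    next
      case False
      with K have "0 < K" by simp
      then have "eventually (\<lambda>r. j r ?w \<le> (?R e' - (S ?d / C - e')) / K) (at_right 0)"
        using ev by (simp add: field_simps)
      from limsup_energy_le[OF this] show ?thesis using \<open>0 < K\<close> by (simp add: pos_le_divide_eq mult.commute)
    qed
    then have "S ?d / C + K * limsup_energy ?w
      \<le> (\<epsilon> + K / 2) * (limsup_energy u + limsup_energy v) + (2 * \<epsilon> + K + 1) * e'"
      by (simp add: algebra_simps)
    also have "(2 * \<epsilon> + K + 1) * e' \<le> (1 + 2 * \<epsilon> + 2 * K) * e'"
      using K e' by (intro mult_right_mono) auto
    also have "\<dots> = e" using e'_mult by (simp add: mult.commute)
    finally show "S ?d / C + K * limsup_energy ?w
      \<le> (\<epsilon> + K / 2) * (limsup_energy u + limsup_energy v) + e" by simp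
  qed
  then show ?thesis using K by blast
qed

end

section \<open>Near-minimisers and convergence along a subsequence\<close>

context kernel_energy
begin

definition dist1 :: "('a \<Rightarrow> real) \<Rightarrow> ('a \<Rightarrow> real) \<Rightarrow> real" where
  "dist1 f g = (\<integral>x. \<bar>f x - g x\<bar> \<partial>\<mu>)"

lemma B_integrable: "f \<in> B \<Longrightarrow> integrable \<mu> f"
  by (intro Lp_integrable_\<mu> B_Lp)

lemma dist1_triangle:
  assumes "integrable \<mu> f" "integrable \<mu> g" "integrable \<mu> h"
  shows "dist1 f h \<le> dist1 f g + dist1 g h"
proof -
  have "dist1 f h \<le> (\<integral>x. \<bar>f x - g x\<bar> + \<bar>g x - h x\<bar> \<partial>\<mu>)"
    unfolding dist1_def using assms by (intro integral_mono) auto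
  also have "\<dots> = dist1 f g + dist1 g h" unfolding dist1_def using assms by simp
  finally show ?thesis .
qed

lemma dist1_commute: "dist1 f g = dist1 g f"
  by (simp add: dist1_def abs_minus_commute)

lemma dist1_midpoint:
  assumes "integrable \<mu> u" "integrable \<mu> v" "integrable \<mu> f"
  shows "dist1 (\<lambda>x. (u x + v x) / 2) f \<le> (dist1 u f + dist1 v f) / 2"
proof -
  have "dist1 (\<lambda>x. (u x + v x) / 2) f \<le> (\<integral>x. (\<bar>u x - f x\<bar> + \<bar>v x - f x\<bar>) / 2 \<partial>\<mu>)"
    unfolding dist1_def using assms by (intro integral_mono) (auto simp: field_simps)
  also have "\<dots> = (dist1 u f + dist1 v f) / 2" unfolding dist1_def using assms by simp
  finally show ?thesis .
qed

text \<open>Although no limit of the energies need be lower semicontinuous, their supremum is, by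
  Fatou's lemma for each fixed \<open>r\<close>.\<close>

lemma S_lower_semicontinuous:
  assumes g: "\<And>n. g n \<in> B" and f: "f \<in> Lp_fun p m" and conv: "(\<lambda>n. dist1 (g n) f) \<longlonglongrightarrow> 0"
    and le: "\<And>n. start \<le> n \<Longrightarrow> S (g n) \<le> c"
  shows "f \<in> B" and "S f \<le> c"
proof -
  have "\<exists>s::nat\<Rightarrow>nat. strict_mono s \<and> (AE x in \<mu>. (\<lambda>n. g (s n) x - f x) \<longlonglongrightarrow> 0)"
    using conv B_integrable[OF g] Lp_integrable_\<mu>[OF f]
    by (intro tendsto_L1_AE_subseq) (auto simp: dist1_def)
  then obtain s :: "nat \<Rightarrow> nat" where s: "strict_mono s" "AE x in m. (\<lambda>n. g (s n) x - f x) \<longlonglongrightarrow> 0"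
    by (auto simp: AE_\<mu>)
  have c: "0 \<le> c" using le[of start] S_nonneg[of "g start"] by simp
  define h where "h = (\<lambda>n. g (s (n + start)))"
  have h: "h n \<in> B" "S (h n) \<le> c" for n
  proof -
    show "h n \<in> B" by (simp add: h_def g)
    have "start \<le> s (n + start)" using seq_suble[OF s(1), of "n + start"] by simp
    then show "S (h n) \<le> c" by (simp add: h_def le)
  qed
  have h_conv: "AE x in m. (\<lambda>n. h n x) \<longlonglongrightarrow> f x"
    using s(2)
  proof eventually_elim
    case (elim x)
    then have "(\<lambda>n. g (s n) x) \<longlonglongrightarrow> f x" by (simp add: LIM_zero_iff)
    then show ?case unfolding h_def by (rule LIMSEQ_ignore_initial_segment)
  qed
  have main: "npint p (N r) (grad f) \<le> ennreal c" if r: "0 < r" for r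
  proof -
    have [measurable]: "grad (h n) \<in> borel_measurable (N r)" for n
      by (rule measurable_grad[OF B_measurable[OF h(1)]])
    have "npint p (N r) (grad f) = (\<integral>\<^sup>+z. liminf (\<lambda>n. ennreal (\<bar>grad (h n) z\<bar> powr p)) \<partial>N r)"
    proof (rule nn_integral_cong_AE)
      show "AE z in N r. ennreal (\<bar>grad f z\<bar> powr p) = liminf (\<lambda>n. ennreal (\<bar>grad (h n) z\<bar> powr p))"
        using AE_N_both[OF r h_conv]
      proof eventually_elim
        case (elim z)
        have "(\<lambda>n. ennreal (\<bar>grad (h n) z\<bar> powr p)) \<longlonglongrightarrow> ennreal (\<bar>grad f z\<bar> powr p)"
          unfolding grad_def using elim p
          by (intro tendsto_ennrealI tendsto_powr2 tendsto_rabs tendsto_diff) auto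
        then show ?case by (rule lim_imp_Liminf[OF trivial_limit_sequentially, symmetric])
      qed
    qed
    also have "\<dots> \<le> liminf (\<lambda>n. \<integral>\<^sup>+z. ennreal (\<bar>grad (h n) z\<bar> powr p) \<partial>N r)"
      by (intro nn_integral_liminf) measurable
    also have "\<dots> \<le> liminf (\<lambda>n. ennreal c)"
    proof (intro Liminf_mono always_eventually allI)
      fix n
      have "npint p (N r) (grad (h n)) \<le> ennreal (S (h n))"
        using J_le_S[OF h(1) r] J_eq[OF r B_measurable[OF h(1)]] by simp
      also have "\<dots> \<le> ennreal c" by (rule ennreal_leI[OF h(2)])
      finally show "npint p (N r) (grad (h n)) \<le> ennreal c" .
    qed
    also have "\<dots> = ennreal c" by (simp add: Liminf_const)
    finally show ?thesis .
  qed
  have L: "grad f \<in> Lp_fun p (N r)" if "0 < r" for r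
    using main[OF that] measurable_grad[OF Lp_fun_measurable[OF f], of r]
    by (auto simp: Lp_fun_def intro: le_less_trans)
  have "j r f \<le> c" if "0 < r" for r
    using main[OF that] nn_integral_eq_pint[OF L[OF that]] c by (simp add: j_def)
  then show "f \<in> B" "S f \<le> c" using BI[OF f L] by auto
qed

text \<open>Choose near-minimisers of the upper energy among the elements of \<open>Q\<close> that are \<open>L\<^sup>1\<close>-close to
  \<open>f\<close>.  As the neighbourhoods shrink, the infima increase to a finite limit, and midpoints of later
  elements are still competitors; hence uniform convexity makes the chosen sequence Cauchy for \<open>S\<close>,
  and lower semicontinuity identifies its limit with \<open>f\<close>.  The argument takes the place of Mazur's
  lemma in a reflexive space.\<close>

lemma near_minimiser_approximation:
  assumes QB: "Q \<subseteq> B" and mid: "\<And>u v. u \<in> Q \<Longrightarrow> v \<in> Q \<Longrightarrow> (\<lambda>x. (u x + v x) / 2) \<in> Q"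
    and f: "f \<in> B" and ap: "\<And>\<epsilon>. 0 < \<epsilon> \<Longrightarrow> \<exists>g\<in>Q. dist1 g f < \<epsilon> \<and> limsup_energy g \<le> M" and \<epsilon>: "0 < \<epsilon>"
  shows "\<exists>g\<in>Q. S (\<lambda>x. f x - g x) \<le> \<epsilon>"
proof -
  define \<delta> where "\<delta> = (\<lambda>n::nat. 1 / (real n + 1))"
  have \<delta>: "0 < \<delta> n" for n by (simp add: \<delta>_def)
  have \<delta>_mono: "\<delta> n \<le> \<delta> i" if "i \<le> n" for i n using that by (auto simp: \<delta>_def field_simps)
  have \<delta>_lim: "\<delta> \<longlonglongrightarrow> 0"
    using LIMSEQ_inverse_real_of_nat by (simp add: \<delta>_def inverse_eq_divide add.commute)
  define U where "U = (\<lambda>n. {g \<in> Q. dist1 g f < \<delta> n})"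
  define a where "a = (\<lambda>n. Inf (limsup_energy ` U n))"
  have bdd: "bdd_below (limsup_energy ` X)" if "X \<subseteq> Q" for X
    using that QB limsup_energy_nonneg by (intro bdd_belowI[of _ 0]) auto
  have U_sub: "U n \<subseteq> Q" for n by (auto simp: U_def)
  have U_ne: "U n \<noteq> {}" for n using ap[OF \<delta>[of n]] by (auto simp: U_def)
  have U_anti: "U n \<subseteq> U i" if "i \<le> n" for i n using \<delta>_mono[OF that] by (auto simp: U_def)
  have a_le: "a n \<le> limsup_energy g" if "g \<in> U n" for g n
    unfolding a_def using that by (intro cInf_lower bdd U_sub) auto
  have a_mono: "a i \<le> a n" if "i \<le> n" for i n
    unfolding a_def using U_anti[OF that] U_ne by (intro cInf_superset_mono bdd U_sub) auto
  have a_M: "a n \<le> M" for n using ap[OF \<delta>[of n]] a_le[of _ n] by (fastforce simp: U_def)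
  have a_nonneg: "0 \<le> a n" for n
    unfolding a_def using U_ne U_sub QB limsup_energy_nonneg by (intro cInf_greatest) blast+
  define A where "A = (SUP n. a n)"
  have a_lim: "a \<longlonglongrightarrow> A" unfolding A_def
    using a_M a_mono by (intro LIMSEQ_incseq_SUP) (auto simp: incseq_def intro!: bdd_aboveI[of _ M])
  have a_A: "a n \<le> A" for n unfolding A_def using a_M by (intro cSUP_upper bdd_aboveI[of _ M]) auto
  have A: "0 \<le> A" using a_A[of 0] a_nonneg[of 0] by simp
  have "\<exists>g\<in>U n. limsup_energy g < a n + \<delta> n" for n
    using cInf_lessD[of "limsup_energy ` U n" "a n + \<delta> n"] U_ne \<delta>[of n] by (auto simp: a_def)
  then obtain g where g: "\<And>n. g n \<in> U n" "\<And>n. limsup_energy (g n) < a n + \<delta> n" by metis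
  have gQ: "g n \<in> Q" and gB: "g n \<in> B" and g_dist: "dist1 (g n) f < \<delta> n" for n
    using g(1)[of n] QB by (auto simp: U_def)
  have C: "0 < C" using C_ge_1 by simp
  \<comment> \<open>The bounds \<open>C * b n\<close> below tend to \<open>2 * C * \<eta> * A\<close>, which this choice makes less than \<open>\<epsilon>\<close>.\<close>
  define \<eta> where "\<eta> = \<epsilon> / (4 * C * (A + 1))"
  have \<eta>: "0 < \<eta>" unfolding \<eta>_def using \<epsilon> C A by (intro divide_pos_pos mult_pos_pos) auto
  obtain K where K: "0 \<le> K" "\<And>u v. u \<in> B \<Longrightarrow> v \<in> B \<Longrightarrow>
      S (\<lambda>x. u x - v x) / C + K * limsup_energy (\<lambda>x. (u x + v x) / 2)
        \<le> (\<eta> + K / 2) * (limsup_energy u + limsup_energy v)"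
    using limsup_energy_uniformly_convex[OF \<eta>] by blast
  define b where "b = (\<lambda>n. (\<eta> + K / 2) * (2 * A + 2 * \<delta> n) - K * a n)"
  have S_le: "S (\<lambda>x. g i x - g n x) \<le> C * b n" if "n \<le> i" for i n
  proof -
    let ?w = "\<lambda>x. (g i x + g n x) / 2"
    have "dist1 ?w f \<le> (dist1 (g i) f + dist1 (g n) f) / 2"
      by (intro dist1_midpoint B_integrable gB f)
    also have "\<dots> < \<delta> n" using g_dist[of i] g_dist[of n] \<delta>_mono[OF that] by (simp add: field_simps)
    finally have "?w \<in> U n" using mid[OF gQ gQ] by (simp add: U_def)
    then have "K * a n \<le> K * limsup_energy ?w" using K(1) by (intro mult_left_mono a_le)
    moreover have "(\<eta> + K / 2) * (limsup_energy (g i) + limsup_energy (g n)) \<le> (\<eta> + K / 2) * (2 * A + 2 * \<delta> n)"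
      using g(2)[of i] g(2)[of n] a_A[of i] a_A[of n] \<delta>_mono[OF that] \<eta> K(1) by (intro mult_left_mono) auto
    ultimately have "S (\<lambda>x. g i x - g n x) / C \<le> b n"
      using K(2)[OF gB[of i] gB[of n]] by (simp add: b_def)
    then show ?thesis using C by (simp add: field_simps)
  qed
  have "(\<lambda>n. C * b n) \<longlonglongrightarrow> C * ((\<eta> + K / 2) * (2 * A + 2 * 0) - K * A)"
    unfolding b_def by (intro tendsto_intros \<delta>_lim a_lim)
  also have "C * ((\<eta> + K / 2) * (2 * A + 2 * 0) - K * A) = \<epsilon> * (A / (2 * (A + 1)))"
  proof -
    have "C * ((\<eta> + K / 2) * (2 * A + 2 * 0) - K * A) = (C * \<eta>) * (2 * A)" by (simp add: algebra_simps)
    also have "C * \<eta> = \<epsilon> / (4 * (A + 1))" using C by (simp add: \<eta>_def)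
    also have "\<epsilon> / (4 * (A + 1)) * (2 * A) = \<epsilon> * (A / (2 * (A + 1)))" using A by (simp add: field_simps)
    finally show ?thesis .
  qed
  finally have "(\<lambda>n. C * b n) \<longlonglongrightarrow> \<epsilon> * (A / (2 * (A + 1)))" .
  moreover have "\<epsilon> * (A / (2 * (A + 1))) < \<epsilon> * 1"
    using A \<epsilon> by (intro mult_strict_left_mono) (auto simp: divide_less_eq)
  ultimately have "eventually (\<lambda>n. C * b n < \<epsilon>) sequentially" by (intro order_tendstoD(2)) auto
  then obtain n where n: "C * b n < \<epsilon>" by (auto simp: eventually_sequentially)
  have "S (\<lambda>x. f x - g n x) \<le> \<epsilon>"
  proof (rule S_lower_semicontinuous(2)[where g = "\<lambda>i x. g i x - g n x" and start = n])
    show "(\<lambda>x. g i x - g n x) \<in> B" for i by (intro B_diff gB)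
    show "(\<lambda>x. f x - g n x) \<in> Lp_fun p m" by (intro B_Lp B_diff f gB)
    have "dist1 (\<lambda>x. g i x - g n x) (\<lambda>x. f x - g n x) = dist1 (g i) f" for i by (simp add: dist1_def)
    moreover have "(\<lambda>i. dist1 (g i) f) \<longlonglongrightarrow> 0"
      by (rule tendsto_sandwich[OF _ _ tendsto_const \<delta>_lim])
        (use g_dist in \<open>auto intro!: always_eventually less_imp_le simp: dist1_def\<close>)
    ultimately show "(\<lambda>i. dist1 (\<lambda>x. g i x - g n x) (\<lambda>x. f x - g n x)) \<longlonglongrightarrow> 0" by simp
    show "S (\<lambda>x. g i x - g n x) \<le> \<epsilon>" if "n \<le> i" for i using S_le[OF that] n by simp
  qed
  then show ?thesis using gQ by blast
qed

text \<open>The approximation principle asks for closure under midpoints, which keeps a countable set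
  countable.  Functions are chosen for each bound \<open>M\<close> on the energy, so that those close to a given
  \<open>f\<close> in \<open>L\<^sup>1\<close> include functions of bounded energy.\<close>

lemma B_separable: "\<exists>Q. countable Q \<and> Q \<subseteq> B \<and> (\<forall>f\<in>B. \<forall>\<epsilon>>0. \<exists>g\<in>Q. S (\<lambda>x. f x - g x) \<le> \<epsilon>)"
proof -
  have "sets \<mu> = sets borel" using sets_\<mu> sets_m by simp
  then obtain D where D: "countable D" "\<And>d. d \<in> D \<Longrightarrow> integrable \<mu> d"
    "\<And>f \<epsilon>. integrable \<mu> f \<Longrightarrow> 0 < \<epsilon> \<Longrightarrow> \<exists>d\<in>D. dist1 f d < \<epsilon>"
    using L1_countable_dense[OF \<mu>_finite] unfolding dist1_def by metis
  define P where "P = (\<lambda>(d, n::nat, M::nat) g. g \<in> B \<and> dist1 g d < 1 / (real n + 1) \<and> limsup_energy g \<le> real M)"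
  define I where "I = {t \<in> D \<times> UNIV \<times> UNIV. \<exists>g. P t g}"
  define sel where "sel = (\<lambda>t. SOME g. P t g)"
  have sel: "P t (sel t)" if "t \<in> I" for t
    unfolding sel_def by (rule someI_ex[of "P t"]) (use that in \<open>auto simp: I_def\<close>)
  have "countable I"
    by (rule countable_subset[of _ "D \<times> UNIV \<times> UNIV"]) (auto simp: I_def intro!: countable_SIGMA D)
  define mids where "mids = (\<lambda>X::('a \<Rightarrow> real) set. X \<union> (\<lambda>(u, v) x. (u x + v x) / 2) ` (X \<times> X))"
  define H where "H = (\<lambda>i. (mids ^^ i) (sel ` I))"
  have H_Suc: "H (Suc i) = mids (H i)" for i by (simp add: H_def)
  have H_mono: "H i \<subseteq> H n" if "i \<le> n" for i n
    using that by (rule lift_Suc_mono_le[rotated]) (auto simp: H_Suc mids_def)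
  have H_count: "countable (H i)" for i
  proof (induction i)
    case 0
    then show ?case using \<open>countable I\<close> by (simp add: H_def)
  next
    case (Suc i)
    then show ?case unfolding H_Suc mids_def by (intro countable_Un countable_image countable_SIGMA)
  qed
  have H_B: "H i \<subseteq> B" for i
  proof (induction i)
    case 0
    then show ?case using sel by (auto simp: H_def P_def)
  next
    case (Suc i)
    then show ?case unfolding H_Suc mids_def using B_midpoint by auto
  qed
  define Q where "Q = (\<Union>i. H i)"
  have Q_mid: "(\<lambda>x. (u x + v x) / 2) \<in> Q" if uv: "u \<in> Q" "v \<in> Q" for u v
  proof -
    obtain i n where "u \<in> H i" "v \<in> H n" using uv by (auto simp: Q_def)
    then have "u \<in> H (max i n)" "v \<in> H (max i n)" using H_mono[of i "max i n"] H_mono[of n "max i n"] by auto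
    then have "(\<lambda>x. (u x + v x) / 2) \<in> H (Suc (max i n))"
      unfolding H_Suc mids_def by (intro UnI2 image_eqI[of _ _ "(u, v)"]) auto
    then show ?thesis by (auto simp: Q_def)
  qed
  have "\<exists>g\<in>Q. S (\<lambda>x. f x - g x) \<le> \<epsilon>" if f: "f \<in> B" and \<epsilon>: "0 < \<epsilon>" for f \<epsilon>
  proof -
    obtain M :: nat where M: "limsup_energy f \<le> real M" using real_arch_simple by blast
    show ?thesis
    proof (rule near_minimiser_approximation[OF _ Q_mid f _ \<epsilon>])
      show "Q \<subseteq> B" using H_B by (auto simp: Q_def)
      show "\<exists>g\<in>Q. dist1 g f < \<epsilon> \<and> limsup_energy g \<le> real M" if "0 < \<epsilon>" for \<epsilon>
      proof -
        obtain n :: nat where "inverse (real (Suc n)) < \<epsilon> / 2"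
          using reals_Archimedean[of "\<epsilon> / 2"] \<open>0 < \<epsilon>\<close> by auto
        then have n: "1 / (real n + 1) < \<epsilon> / 2" by (simp add: inverse_eq_divide add.commute)
        obtain d where d: "d \<in> D" "dist1 f d < 1 / (real n + 1)"
          using D(3)[OF B_integrable[OF f], of "1 / (real n + 1)"] by auto
        let ?t = "(d, n, M)"
        have "P ?t f" using f d M by (simp add: P_def)
        then have t: "?t \<in> I" using d by (auto simp: I_def)
        note s = sel[OF t, unfolded P_def prod.case]
        have "dist1 (sel ?t) f \<le> dist1 (sel ?t) d + dist1 d f"
          using s by (intro dist1_triangle B_integrable f D d) auto
        also have "\<dots> < \<epsilon>" using s d n by (simp add: dist1_commute[of d f])
        finally have "dist1 (sel ?t) f < \<epsilon>" .
        moreover have "sel ?t \<in> H 0" using t by (simp add: H_def)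
        then have "sel ?t \<in> Q" by (auto simp: Q_def)
        ultimately show ?thesis using s by blast
      qed
    qed
  qed
  moreover have "countable Q" unfolding Q_def using H_count by auto
  moreover have "Q \<subseteq> B" using H_B by (auto simp: Q_def)
  ultimately show ?thesis by blast
qed

text \<open>Convergence on the countable dense set carries over to \<open>B\<close> because the \<open>p\<close>-th roots of the
  energies are equicontinuous for \<open>S\<close>.\<close>

theorem convergent_subsequence:
  assumes r': "\<And>n. 0 < r' n"
  shows "\<exists>s::nat \<Rightarrow> nat. strict_mono s \<and> limit_exists p m k (r' \<circ> s)"
proof -
  obtain Q where Q: "countable Q" "Q \<subseteq> B" "\<And>f \<epsilon>. f \<in> B \<Longrightarrow> 0 < \<epsilon> \<Longrightarrow> \<exists>g\<in>Q. S (\<lambda>x. f x - g x) \<le> \<epsilon>"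
    using B_separable by metis
  \<comment> \<open>The diagonal argument wants one bound for all sequences, hence the division.\<close>
  have bd: "norm (j (r' n) g / (1 + S g)) \<le> 1" if "g \<in> Q" for n g
    using j_le_S[of g "r' n"] j_nonneg[of "r' n" g] S_nonneg[of g] r' Q(2) that by (auto simp: divide_le_eq)
  obtain s where s: "strict_mono (s::nat\<Rightarrow>nat)"
    "\<And>g. g \<in> Q \<Longrightarrow> \<exists>l. (\<lambda>n. j (r' (s n)) g / (1 + S g)) \<longlonglongrightarrow> l"
    using function_convergent_subsequence[OF Q(1), where f="\<lambda>n g. j (r' n) g / (1 + S g)", OF bd] by blast
  have conv_Q: "convergent (\<lambda>n. j (r' (s n)) g powr (1 / p))" if g: "g \<in> Q" for g
  proof -
    obtain l where "(\<lambda>n. j (r' (s n)) g / (1 + S g)) \<longlonglongrightarrow> l" using s(2)[OF g] by blast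
    then have "(\<lambda>n. j (r' (s n)) g / (1 + S g) * (1 + S g)) \<longlonglongrightarrow> l * (1 + S g)" by (intro tendsto_intros)
    moreover have "1 + S g \<noteq> 0" using S_nonneg[of g] by linarith
    ultimately have "(\<lambda>n. j (r' (s n)) g) \<longlonglongrightarrow> l * (1 + S g)" by simp
    then have "(\<lambda>n. j (r' (s n)) g powr (1 / p)) \<longlonglongrightarrow> (l * (1 + S g)) powr (1 / p)"
      using p j_nonneg by (intro tendsto_powr2) auto
    then show ?thesis by (auto simp: convergent_def)
  qed
  have conv: "convergent (\<lambda>n. j (r' (s n)) f powr (1 / p))" if f: "f \<in> B" for f
    unfolding Cauchy_convergent_iff[symmetric]
  proof (rule metric_CauchyI)
    fix e :: real assume e: "0 < e"
    obtain g where g: "g \<in> Q" "S (\<lambda>x. f x - g x) \<le> (e / 3) powr p" using Q(3)[OF f, of "(e / 3) powr p"] e by auto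
    have "S (\<lambda>x. f x - g x) powr (1 / p) \<le> ((e / 3) powr p) powr (1 / p)"
      using g p S_nonneg by (intro powr_mono2) auto
    then have Sg: "S (\<lambda>x. f x - g x) powr (1 / p) \<le> e / 3" using e p by (simp add: powr_powr)
    have "Cauchy (\<lambda>n. j (r' (s n)) g powr (1 / p))" using conv_Q[OF g(1)] by (simp add: Cauchy_convergent_iff)
    then obtain n0 where n0: "\<And>i n. n0 \<le> i \<Longrightarrow> n0 \<le> n \<Longrightarrow>
        \<bar>j (r' (s i)) g powr (1 / p) - j (r' (s n)) g powr (1 / p)\<bar> < e / 3"
      using e unfolding Cauchy_def dist_real_def by (metis divide_pos_pos zero_less_numeral)
    have near: "\<bar>j (r' (s n)) f powr (1 / p) - j (r' (s n)) g powr (1 / p)\<bar> \<le> e / 3" for n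
      using j_root_lipschitz[OF f _ r', of g "s n"] g Q(2) Sg by (meson order_trans subsetD)
    have "dist (j (r' (s i)) f powr (1 / p)) (j (r' (s n)) f powr (1 / p)) < e" if "n0 \<le> i" "n0 \<le> n" for i n
      using n0[OF that] near[of i] near[of n] unfolding dist_real_def by linarith
    then show "\<exists>n0. \<forall>i\<ge>n0. \<forall>n\<ge>n0. dist (j (r' (s i)) f powr (1 / p)) (j (r' (s n)) f powr (1 / p)) < e"
      by blast
  qed
  have "\<exists>L::real. 0 \<le> L \<and> (\<lambda>n. J p m k ((r' \<circ> s) n) f) \<longlonglongrightarrow> ennreal L" if f: "f \<in> B" for f
  proof -
    obtain l where l: "(\<lambda>n. j (r' (s n)) f powr (1 / p)) \<longlonglongrightarrow> l" using conv[OF f] by (auto simp: convergent_def)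
    then have "(\<lambda>n. (j (r' (s n)) f powr (1 / p)) powr p) \<longlonglongrightarrow> l powr p"
      using p by (intro tendsto_powr2) auto
    then have "(\<lambda>n. j (r' (s n)) f) \<longlonglongrightarrow> l powr p" using p j_nonneg by (simp add: powr_powr)
    then show ?thesis using r' by (intro exI[of _ "l powr p"]) (auto simp: J_eq_j[OF f])
  qed
  then show ?thesis using s(1) unfolding limit_exists_def by blast
qed

end

section \<open>The limit energy\<close>

text \<open>The difference quotients at a fixed \<open>t\<close> converge, and \<open>D n\<close> differs from them by at most
  \<open>M |t|\<^sup>\<alpha>\<close>, uniformly in \<open>n\<close>; hence \<open>D\<close> is a Cauchy sequence, and the bound passes to the limit.\<close>

lemma derivative_of_limit:
  fixes F :: "nat \<Rightarrow> real \<Rightarrow> real"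
  assumes conv: "\<And>t. (\<lambda>n. F n t) \<longlonglongrightarrow> G t" and \<alpha>: "0 < \<alpha>"
    and rem: "\<And>n t. \<bar>t\<bar> \<le> 1 \<Longrightarrow> \<bar>F n t - F n 0 - t * D n\<bar> \<le> M * \<bar>t\<bar> powr (1 + \<alpha>)"
  shows "\<exists>D'. D \<longlonglongrightarrow> D' \<and> (G has_real_derivative D') (at 0)"
proof -
  have quot: "\<bar>(F n t - F n 0) / t - D n\<bar> \<le> M * \<bar>t\<bar> powr \<alpha>" if t: "t \<noteq> 0" "\<bar>t\<bar> \<le> 1" for n t
  proof -
    have "\<bar>(F n t - F n 0) / t - D n\<bar> = \<bar>F n t - F n 0 - t * D n\<bar> / \<bar>t\<bar>"
      using t(1) by (simp add: abs_divide[symmetric] diff_divide_distrib)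
    also have "\<dots> \<le> M * \<bar>t\<bar> powr (1 + \<alpha>) / \<bar>t\<bar>"
      using t by (intro divide_right_mono rem) auto
    also have "\<dots> = M * \<bar>t\<bar> powr \<alpha>" using t(1) by (simp add: powr_add)
    finally show ?thesis .
  qed
  have small: "((\<lambda>t. M * \<bar>t\<bar> powr \<alpha>) \<longlongrightarrow> 0) (at 0)"
  proof -
    have "((\<lambda>t::real. M * \<bar>t\<bar> powr \<alpha>) \<longlongrightarrow> M * \<bar>0\<bar> powr \<alpha>) (at 0)"
      using \<alpha> by (intro tendsto_mult tendsto_const tendsto_powr2 tendsto_rabs tendsto_ident_at) auto
    then show ?thesis using \<alpha> by simp
  qed
  have "Cauchy D"
  proof (rule metric_CauchyI)
    fix e :: real assume e: "0 < e"
    have "eventually (\<lambda>t. M * \<bar>t\<bar> powr \<alpha> < e / 4 \<and> \<bar>t\<bar> \<le> 1 \<and> t \<noteq> 0) (at (0::real))"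
    proof (intro eventually_conj order_tendstoD(2)[OF small])
      show "eventually (\<lambda>t. \<bar>t\<bar> \<le> 1) (at (0::real))"
        unfolding eventually_at by (intro exI[of _ 1]) auto
    qed (use e in \<open>auto simp: eventually_at_filter\<close>)
    from eventually_happens'[OF _ this] obtain t where t: "M * \<bar>t\<bar> powr \<alpha> < e / 4" "\<bar>t\<bar> \<le> 1" "t \<noteq> 0"
      by auto
    have "(\<lambda>n. (F n t - F n 0) / t) \<longlonglongrightarrow> (G t - G 0) / t" using t(3) by (intro tendsto_intros conv)
    then have "Cauchy (\<lambda>n. (F n t - F n 0) / t)" by (rule LIMSEQ_imp_Cauchy)
    then obtain n0 where n0: "\<And>i n. n0 \<le> i \<Longrightarrow> n0 \<le> n \<Longrightarrow>
        \<bar>(F i t - F i 0) / t - (F n t - F n 0) / t\<bar> < e / 4"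
      using e unfolding Cauchy_def dist_real_def by (metis divide_pos_pos zero_less_numeral)
    have "dist (D i) (D n) < e" if "n0 \<le> i" "n0 \<le> n" for i n
      using n0[OF that] quot[OF t(3,2), of i] quot[OF t(3,2), of n] t(1) e unfolding dist_real_def by linarith
    then show "\<exists>n0. \<forall>i\<ge>n0. \<forall>n\<ge>n0. dist (D i) (D n) < e" by blast
  qed
  then obtain D' where D': "D \<longlonglongrightarrow> D'" using Cauchy_convergent_iff convergent_def by blast
  have quot': "\<bar>(G t - G 0) / t - D'\<bar> \<le> M * \<bar>t\<bar> powr \<alpha>" if t: "t \<noteq> 0" "\<bar>t\<bar> \<le> 1" for t
  proof (rule tendsto_upperbound)
    show "(\<lambda>n. \<bar>(F n t - F n 0) / t - D n\<bar>) \<longlonglongrightarrow> \<bar>(G t - G 0) / t - D'\<bar>"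
      using t by (intro tendsto_intros conv D')
  qed (use quot[OF t] in auto)
  have "((\<lambda>t. (G t - G 0) / t - D') \<longlongrightarrow> 0) (at 0)"
  proof (rule Lim_null_comparison[OF _ small])
    have "eventually (\<lambda>t. \<bar>t\<bar> \<le> 1 \<and> t \<noteq> 0) (at (0::real))"
      unfolding eventually_at by (intro exI[of _ 1]) auto
    then show "eventually (\<lambda>t. norm ((G t - G 0) / t - D') \<le> M * \<bar>t\<bar> powr \<alpha>) (at 0)"
      by eventually_elim (use quot' in auto)
  qed
  then have "(G has_real_derivative D') (at 0)"
    unfolding DERIV_def by (simp add: LIM_zero_iff)
  then show ?thesis using D' by blast
qed

lemma rpow_mono: "0 \<le> x \<Longrightarrow> x \<le> y \<Longrightarrow> 0 \<le> a \<Longrightarrow> rpow x a \<le> rpow y a"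
  by (auto simp: rpow_def intro: powr_mono2)

lemma rpow_nonneg: "0 \<le> rpow x a"
  by (auto simp: rpow_def)

lemma tendsto_rpow:
  assumes "(f \<longlongrightarrow> x) F" "\<And>n. 0 \<le> f n" "0 \<le> a"
  shows "((\<lambda>n. rpow (f n) a) \<longlongrightarrow> rpow x a) F"
  using assms unfolding rpow_def by (cases "a = 0") (auto intro!: tendsto_powr2 always_eventually)

lemma lq_norm_mono:
  assumes "0 < q" "\<And>i. i < n \<Longrightarrow> \<bar>x i\<bar> \<le> \<bar>y i\<bar>"
  shows "lq_norm n (ereal q) x \<le> lq_norm n (ereal q) y"
  unfolding lq_norm_real using assms by (intro powr_mono2 sum_mono sum_nonneg) auto

lemma form_diff_const_pos: "1 < p \<Longrightarrow> 0 < form_diff_const p"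
  by (auto simp: form_diff_const_def)

context kernel_energy
begin

text \<open>A map with the contraction property is continuous for the product topology and depends on
  finitely many coordinates only; this is what makes its compositions with measurable functions
  measurable.\<close>

lemma contraction_compose_Lp:
  assumes n: "1 \<le> n1" "1 \<le> n2" and q: "0 < q1" "q1 \<le> p" "ereal p \<le> q2"
    and T0: "\<And>l. l < n2 \<Longrightarrow> T (\<lambda>_. 0) l = 0"
    and T: "\<And>x y. lq_norm n2 q2 (\<lambda>l. T x l - T y l) \<le> lq_norm n1 (ereal q1) (\<lambda>i. x i - y i)"
    and u: "\<And>i. i < n1 \<Longrightarrow> u i \<in> Lp_fun p m" and l: "l < n2"
  shows "(\<lambda>z. T (\<lambda>i. u i z) l) \<in> Lp_fun p m"
proof -
  have q2: "0 < q2" using p q(3) by (rule exponent_pos)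
  have q1: "0 < ereal q1" using q by simp
  have lip: "\<bar>T x l - T y l\<bar> \<le> lq_norm n1 (ereal q1) (\<lambda>i. x i - y i)" for x y
    using abs_le_lq_norm[OF l q2, of "\<lambda>l. T x l - T y l"] T[of x y] by simp
  have lq0: "lq_norm n1 (ereal q1) (\<lambda>i. 0) = 0" using q by (simp add: lq_norm_real)
  define w where "w = (\<lambda>z i. if i < n1 then u i z else 0)"
  have eq: "T (\<lambda>i. u i z) l = T (w z) l" for z
  proof -
    have "lq_norm n1 (ereal q1) (\<lambda>i. u i z - w z i) = lq_norm n1 (ereal q1) (\<lambda>i. 0)"
      by (rule lq_norm_cong) (simp add: w_def)
    then show ?thesis using lip[of "\<lambda>i. u i z" "w z"] lq0 by simp
  qed
  have "continuous_on UNIV (\<lambda>x. T x l)"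
  proof (rule continuous_at_imp_continuous_on, rule ballI)
    fix y :: "nat \<Rightarrow> real"
    have coord: "((\<lambda>x. x i) \<longlongrightarrow> y i) (at y)" for i
      using continuous_on_product_coordinates[of i] by (auto simp: continuous_on_def)
    have "((\<lambda>x. lq_norm n1 (ereal q1) (\<lambda>i. x i - y i)) \<longlongrightarrow> lq_norm n1 (ereal q1) (\<lambda>i. y i - y i)) (at y)"
      by (intro tendsto_lq_norm[OF n(1) q1] tendsto_diff tendsto_const coord)
    then have lim0: "((\<lambda>x. lq_norm n1 (ereal q1) (\<lambda>i. x i - y i)) \<longlongrightarrow> 0) (at y)"
      unfolding diff_self lq0 .
    have "((\<lambda>x. T x l - T y l) \<longlongrightarrow> 0) (at y)"
      by (rule Lim_null_comparison[OF always_eventually lim0]) (simp only: real_norm_def lip simp_thms)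
    then show "isCont (\<lambda>x. T x l) y" by (simp add: isCont_def LIM_zero_iff)
  qed
  then have Tm: "(\<lambda>x. T x l) \<in> borel_measurable borel" by (rule borel_measurable_continuous_onI)
  have wm: "w \<in> measurable m borel"
  proof (rule measurable_coordinatewise_then_product)
    fix i show "(\<lambda>z. w z i) \<in> borel_measurable m"
      by (cases "i < n1") (simp_all add: w_def Lp_fun_measurable[OF u])
  qed
  have "(\<lambda>z. T (w z) l) \<in> borel_measurable m" by (rule measurable_compose[OF wm Tm])
  then have meas: "(\<lambda>z. T (\<lambda>i. u i z) l) \<in> borel_measurable m" by (simp add: eq)
  have G: "(\<lambda>z. lq_norm n1 (ereal q1) (\<lambda>i. u i z)) \<in> Lp_fun p m"
    by (rule lq_norm_Minkowski(1)[OF p n(1) q(1,2) u])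
  show ?thesis
  proof (rule Lp_fun_dominated[OF meas _ Lp_fun_integrable[OF G]])
    have "\<bar>T (\<lambda>i. u i z) l\<bar> \<le> \<bar>lq_norm n1 (ereal q1) (\<lambda>i. u i z)\<bar>" for z
      using lip[of "\<lambda>i. u i z" "\<lambda>_. 0"] T0[OF l] by simp
    then show "AE z in m. \<bar>T (\<lambda>i. u i z) l\<bar> powr p \<le> \<bar>lq_norm n1 (ereal q1) (\<lambda>i. u i z)\<bar> powr p"
      using p by (intro AE_I2 powr_mono2) auto
  qed
qed

text \<open>The remainder is bounded by the increment of the derivative, and that increment by the Hoelder
  bound, in which all energies may be replaced by suprema over \<open>r\<close>; thus \<open>M\<close> does not depend on \<open>r\<close>.\<close>

lemma j_Taylor:
  assumes f: "f \<in> B" and g: "g \<in> B"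
  shows "\<exists>M. \<forall>r>0. \<forall>t. \<bar>t\<bar> \<le> 1 \<longrightarrow>
    \<bar>j r (\<lambda>x. f x + t * g x) - j r f - t * (p * ppair p (N r) (grad f) (grad g))\<bar>
      \<le> M * \<bar>t\<bar> powr (1 + min (p - 1) 1)"
proof -
  define \<alpha> where "\<alpha> = min (p - 1) 1"
  define \<beta> where "\<beta> = max (p - 2) 0 / p"
  define R where "R = 2 powr p * (S f + S g)"
  have \<alpha>: "0 < \<alpha>" and \<beta>: "0 \<le> \<beta>" using p by (auto simp: \<alpha>_def \<beta>_def)
  define M where "M = p * (form_diff_const p * rpow R \<beta> * rpow (S g) (\<alpha> / p) * rpow (S g) (1 / p))"
  have "\<bar>j r (\<lambda>x. f x + t * g x) - j r f - t * (p * ppair p (N r) (grad f) (grad g))\<bar> \<le> M * \<bar>t\<bar> powr (1 + \<alpha>)"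
    if r: "0 < r" and t: "\<bar>t\<bar> \<le> 1" for r t
  proof -
    note L = grad_Lp[OF f r] grad_Lp[OF g r]
    have tp: "\<bar>t\<bar> powr p \<le> 1" using t p powr_le_one_le[of "\<bar>t\<bar>" p] by (cases "t = 0") auto
    have "j r (\<lambda>x. f x + t * g x) \<le> 2 powr p * (j r f + j r (\<lambda>x. t * g x))"
      unfolding j_def grad_add by (intro pint_add_le p0 grad_Lp B_cmult f g r)
    also have "\<dots> \<le> 2 powr p * (S f + 1 * S g)"
      unfolding j_cmult using tp j_le_S[OF f r] j_le_S[OF g r] j_nonneg
      by (intro mult_left_mono add_mono mult_mono) auto
    finally have j1: "j r (\<lambda>x. f x + t * g x) \<le> R" by (simp add: R_def)
    have "1 * S f \<le> 2 powr p * (S f + S g)"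
      using p S_nonneg[of f] S_nonneg[of g] by (intro mult_mono) (auto intro: ge_one_powr_ge_zero)
    then have j2: "j r f \<le> R" using j_le_S[OF f r] by (simp add: R_def)
    have "\<bar>ppair p (N r) (\<lambda>z. grad f z + t * grad g z) (grad g) - ppair p (N r) (grad f) (grad g)\<bar>
      \<le> form_diff_const p * rpow (max (pint p (N r) (\<lambda>z. grad f z + t * grad g z)) (pint p (N r) (grad f))) \<beta>
      * rpow (pint p (N r) (\<lambda>z. (grad f z + t * grad g z) - grad f z)) (\<alpha> / p) * rpow (pint p (N r) (grad g)) (1 / p)"
      unfolding \<alpha>_def \<beta>_def by (intro ppair_diff_le p L Lp_fun_add p0 Lp_fun_cmult)
    also have "\<dots> = form_diff_const p * rpow (max (j r (\<lambda>x. f x + t * g x)) (j r f)) \<beta>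
      * rpow (\<bar>t\<bar> powr p * j r g) (\<alpha> / p) * rpow (j r g) (1 / p)"
      by (simp add: j_def grad_add grad_cmult pint_cmult)
    also have "rpow (\<bar>t\<bar> powr p * j r g) (\<alpha> / p) = \<bar>t\<bar> powr \<alpha> * rpow (j r g) (\<alpha> / p)"
      using \<alpha> p by (simp add: rpow_def powr_mult powr_powr)
    also have "form_diff_const p * rpow (max (j r (\<lambda>x. f x + t * g x)) (j r f)) \<beta>
      * (\<bar>t\<bar> powr \<alpha> * rpow (j r g) (\<alpha> / p)) * rpow (j r g) (1 / p)
      \<le> form_diff_const p * rpow R \<beta> * (\<bar>t\<bar> powr \<alpha> * rpow (S g) (\<alpha> / p)) * rpow (S g) (1 / p)"
      using j1 j2 \<alpha> \<beta> p j_le_S[OF g r] j_nonneg form_diff_const_pos[OF p]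
      by (intro mult_mono mult_nonneg_nonneg rpow_mono rpow_nonneg order_refl) (auto simp: le_max_iff_disj)
    finally have "p * \<bar>t\<bar> * \<bar>ppair p (N r) (\<lambda>z. grad f z + t * grad g z) (grad g) - ppair p (N r) (grad f) (grad g)\<bar>
      \<le> p * \<bar>t\<bar> * (form_diff_const p * rpow R \<beta> * (\<bar>t\<bar> powr \<alpha> * rpow (S g) (\<alpha> / p)) * rpow (S g) (1 / p))"
      using p by (intro mult_left_mono) auto
    also have "\<dots> = M * \<bar>t\<bar> powr (1 + \<alpha>)" by (simp add: M_def powr_add)
    finally show ?thesis
      using pint_Taylor_remainder[OF p L, of t] by (simp add: j_def grad_add grad_cmult mult.assoc mult.left_commute)
  qed
  then show ?thesis unfolding \<alpha>_def by blast
qed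

lemma nn_integral_compose_preserving:
  assumes T: "T \<in> measurable m m" and d: "distr m m T = m" and g: "g \<in> borel_measurable (m \<Otimes>\<^sub>M m)"
  shows "(\<integral>\<^sup>+x. \<integral>\<^sup>+y. g (T x, T y) \<partial>m \<partial>m) = (\<integral>\<^sup>+x. \<integral>\<^sup>+y. g (x, y) \<partial>m \<partial>m)"
proof -
  note [measurable] = g
  have inner: "(\<integral>\<^sup>+y. g (x, T y) \<partial>m) = (\<integral>\<^sup>+y. g (x, y) \<partial>m)" for x
  proof -
    have "(\<integral>\<^sup>+y. g (x, y) \<partial>distr m m T) = (\<integral>\<^sup>+y. g (x, T y) \<partial>m)"
      by (rule nn_integral_distr[OF T]) (simp add: space_m)
    then show ?thesis by (simp add: d)
  qed
  have "(\<integral>\<^sup>+x. (\<integral>\<^sup>+y. g (x, y) \<partial>m) \<partial>distr m m T) = (\<integral>\<^sup>+x. (\<integral>\<^sup>+y. g (T x, y) \<partial>m) \<partial>m)"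
    by (rule nn_integral_distr[OF T]) (simp add: d m.borel_measurable_nn_integral_fst[OF g])
  then show ?thesis by (simp add: d inner)
qed

text \<open>Writing \<open>k r (T x) (T y)\<close> for \<open>k r x y\<close>, one obtains an integrand that depends on \<open>(x, y)\<close> only
  through \<open>(T x, T y)\<close>, and \<open>T\<close> preserves \<open>m\<close> in each variable.\<close>

lemma invariant_compose:
  assumes T: "\<And>A. A \<in> sets borel \<Longrightarrow> T -` A \<in> sets borel \<and> emeasure m (T -` A) = emeasure m A"
    and kT: "\<And>\<rho>. 0 < \<rho> \<Longrightarrow> AE (x, y) in m \<Otimes>\<^sub>M m. k \<rho> (T x) (T y) = k \<rho> x y" and f: "f \<in> B"
  shows "f \<circ> T \<in> B" and "\<And>r. 0 < r \<Longrightarrow> J p m k r (f \<circ> T) = J p m k r f"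
proof -
  have Tm [measurable]: "T \<in> measurable m m"
    using T by (intro measurableI) (auto simp: space_m sets_m)
  have d: "distr m m T = m"
    using T by (intro measure_eqI) (auto simp: emeasure_distr[OF Tm] space_m sets_m)
  note [measurable] = B_measurable[OF f]
  have L: "f \<circ> T \<in> Lp_fun p m"
  proof -
    have "(\<integral>\<^sup>+x. ennreal (\<bar>f x\<bar> powr p) \<partial>distr m m T) = (\<integral>\<^sup>+x. ennreal (\<bar>f (T x)\<bar> powr p) \<partial>m)"
      by (rule nn_integral_distr[OF Tm]) measurable
    then show ?thesis using B_Lp[OF f] unfolding Lp_fun_def by (simp add: d)
  qed
  show J: "J p m k r (f \<circ> T) = J p m k r f" if r: "0 < r" for r
  proof -
    note [measurable] = measurable_k[OF r]
    define g where "g = (\<lambda>z. ennreal (\<bar>grad f z\<bar> powr p) * (case z of (x, y) \<Rightarrow> k r x y))"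
    have g [measurable]: "g \<in> borel_measurable (m \<Otimes>\<^sub>M m)"
      unfolding g_def grad_def by measurable
    have "(\<lambda>z. (T (fst z), T (snd z))) \<in> measurable (m \<Otimes>\<^sub>M m) (m \<Otimes>\<^sub>M m)" by measurable
    from measurable_compose[OF this g]
    have gT: "(\<lambda>z. g (T (fst z), T (snd z))) \<in> borel_measurable (m \<Otimes>\<^sub>M m)" .
    have h: "(\<lambda>z. ennreal (\<bar>f (T (fst z)) - f (T (snd z))\<bar> powr p) * (case z of (x, y) \<Rightarrow> k r x y))
       \<in> borel_measurable (m \<Otimes>\<^sub>M m)" by measurable
    have "J p m k r (f \<circ> T) = (\<integral>\<^sup>+z. ennreal (\<bar>f (T (fst z)) - f (T (snd z))\<bar> powr p) * (case z of (x, y) \<Rightarrow> k r x y) \<partial>(m \<Otimes>\<^sub>M m))"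
      unfolding J_def by (subst m.nn_integral_fst[OF h, symmetric]) simp
    also have "\<dots> = (\<integral>\<^sup>+z. g (T (fst z), T (snd z)) \<partial>(m \<Otimes>\<^sub>M m))"
    proof (rule nn_integral_cong_AE)
      show "AE z in m \<Otimes>\<^sub>M m. ennreal (\<bar>f (T (fst z)) - f (T (snd z))\<bar> powr p) * (case z of (x, y) \<Rightarrow> k r x y)
          = g (T (fst z), T (snd z))"
        using kT[OF r] by eventually_elim (auto simp: g_def grad_def split_beta)
    qed
    also have "\<dots> = (\<integral>\<^sup>+x. \<integral>\<^sup>+y. g (T x, T y) \<partial>m \<partial>m)"
      by (subst m.nn_integral_fst[OF gT, symmetric]) simp
    also have "\<dots> = (\<integral>\<^sup>+x. \<integral>\<^sup>+y. g (x, y) \<partial>m \<partial>m)" by (rule nn_integral_compose_preserving[OF Tm d g])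
    also have "\<dots> = J p m k r f" by (simp add: J_def g_def grad_def)
    finally show ?thesis .
  qed
  show "f \<circ> T \<in> B" using f L J by (auto simp: B_space_def)
qed

end

locale limit_energy = kernel_energy +
  fixes r :: "nat \<Rightarrow> real"
  assumes r_pos: "\<And>n. 0 < r n" and r_lim: "r \<longlonglongrightarrow> 0" and r_limit_exists: "limit_exists p m k r"
begin

definition E :: "('a \<Rightarrow> real) \<Rightarrow> real" where
  "E = limit_form p m k r"

definition E2 :: "('a \<Rightarrow> real) \<Rightarrow> ('a \<Rightarrow> real) \<Rightarrow> real" where
  "E2 = form_deriv p E"

lemma r_at_right: "filterlim r (at_right 0) sequentially"
  unfolding filterlim_at using r_lim r_pos r_pos[THEN less_imp_neq, symmetric] by auto

lemma E_limit:
  assumes "f \<in> B"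
  shows "(\<lambda>n. j (r n) f) \<longlonglongrightarrow> E f"
proof -
  obtain L where L: "0 \<le> L" "(\<lambda>n. J p m k (r n) f) \<longlonglongrightarrow> ennreal L"
    using r_limit_exists assms unfolding limit_exists_def by blast
  then have "E f = L" unfolding E_def limit_form_def by (simp add: limI)
  moreover have "(\<lambda>n. j (r n) f) \<longlonglongrightarrow> L"
    using L r_pos by (simp add: J_eq_j[OF assms] j_nonneg)
  ultimately show ?thesis by simp
qed

lemma E_nonneg: "0 \<le> E f"
  by (simp add: E_def limit_form_def)

lemma E_le_S: "f \<in> B \<Longrightarrow> E f \<le> S f"
  using LIMSEQ_le_const2[OF E_limit, of f "S f"] j_le_S[OF _ r_pos] by auto

lemma E_eqI: "f \<in> B \<Longrightarrow> (\<lambda>n. j (r n) f) \<longlonglongrightarrow> L \<Longrightarrow> E f = L"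
  by (rule LIMSEQ_unique[OF E_limit])

lemma S_le_C_E:
  assumes f: "f \<in> B"
  shows "S f / C \<le> E f"
proof (rule dense_le)
  fix c assume "c < S f / C"
  then have "eventually (\<lambda>n. c < j (r n) f) sequentially"
    by (rule eventually_compose_filterlim[OF weak_monotonicity_eventually[OF f] r_at_right])
  then have "eventually (\<lambda>n. c \<le> j (r n) f) sequentially" by eventually_elim simp
  then show "c \<le> E f" by (intro tendsto_lowerbound[OF E_limit[OF f]]) auto
qed

lemma E_cong:
  "(\<And>n. J p m k (r n) f = J p m k (r n) g) \<Longrightarrow> E f = E g"
  by (simp add: E_def limit_form_def)

lemma E_cmult:
  assumes "f \<in> B"
  shows "E (\<lambda>x. a * f x) = \<bar>a\<bar> powr p * E f"
  unfolding j_cmult[symmetric] using assms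
  by (intro E_eqI B_cmult) (auto simp: j_cmult intro!: tendsto_intros E_limit)

lemma E_root_triangle:
  assumes "f \<in> B" "g \<in> B"
  shows "E (\<lambda>x. f x + g x) powr (1 / p) \<le> E f powr (1 / p) + E g powr (1 / p)"
proof (rule LIMSEQ_le)
  show "(\<lambda>n. j (r n) (\<lambda>x. f x + g x) powr (1 / p)) \<longlonglongrightarrow> E (\<lambda>x. f x + g x) powr (1 / p)"
    using p assms j_nonneg by (intro tendsto_powr2 E_limit B_add tendsto_const) auto
  show "(\<lambda>n. j (r n) f powr (1 / p) + j (r n) g powr (1 / p)) \<longlonglongrightarrow> E f powr (1 / p) + E g powr (1 / p)"
    using p assms j_nonneg by (intro tendsto_add tendsto_powr2 E_limit tendsto_const) auto
qed (use j_root_triangle[OF assms r_pos] in auto)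

lemma E_p_energy_form: "p_energy_form p m B E"
  unfolding p_energy_form_def
proof (intro conjI ballI allI impI)
  show "B \<subseteq> borel_measurable m" using B_measurable by auto
  show "v \<in> B" "E v = E u" if u: "u \<in> B" and v: "v \<in> borel_measurable m" and eq: "AE x in m. u x = v x" for u v
  proof -
    have J: "J p m k \<rho> u = J p m k \<rho> v" if "0 < \<rho>" for \<rho>
      by (rule J_cong_AE[OF that B_measurable[OF u] v eq])
    have "(\<integral>\<^sup>+x. ennreal (\<bar>u x\<bar> powr p) \<partial>m) = (\<integral>\<^sup>+x. ennreal (\<bar>v x\<bar> powr p) \<partial>m)"
      by (rule nn_integral_cong_AE) (use eq in \<open>eventually_elim, simp\<close>)
    then show "v \<in> B" using u v J by (auto simp: B_space_def Lp_fun_def)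
    show "E v = E u" by (rule E_cong) (simp add: J r_pos)
  qed
qed (auto intro: zero_B B_add B_cmult E_nonneg E_cmult E_root_triangle)

lemma E_comparable:
  assumes f: "f \<in> B"
  shows "ennreal (1 / C) * (SUP r\<in>{0<..}. J p m k r f) \<le> ennreal (E f)"
    and "ennreal (E f) \<le> ennreal C * Liminf (at_right 0) (\<lambda>r. J p m k r f)"
proof -
  have "ennreal (1 / C) * ennreal (S f) = ennreal (S f / C)"
    using C_ge_1 S_nonneg by (subst ennreal_mult[symmetric]) auto
  then show "ennreal (1 / C) * (SUP r\<in>{0<..}. J p m k r f) \<le> ennreal (E f)"
    using S_le_C_E[OF f] by (simp add: SUP_J[OF f] ennreal_leI)
  have "ennreal (E f) \<le> ennreal (S f)" by (rule ennreal_leI[OF E_le_S[OF f]])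
  also have "\<dots> \<le> ennreal C * Liminf (at_right 0) (\<lambda>r. J p m k r f)"
    using WM f by (simp add: weak_monotonicity_def SUP_J)
  finally show "ennreal (E f) \<le> ennreal C * Liminf (at_right 0) (\<lambda>r. J p m k r f)" .
qed

lemma E_constant:
  assumes "emeasure m UNIV < \<infinity>"
  shows "(\<lambda>_. 1) \<in> B" and "E (\<lambda>_. 1) = 0"
proof -
  have "(\<lambda>_. 1) \<in> Lp_fun p m" using assms by (simp add: Lp_fun_def space_m)
  then show 1: "(\<lambda>_. 1) \<in> B" by (auto simp: B_space_def J_def)
  have "j \<rho> (\<lambda>_. 1) = 0" for \<rho> by (simp add: j_def grad_def pint_def)
  then show "E (\<lambda>_. 1) = 0" by (intro E_eqI[OF 1]) simp
qed

lemma E_contraction: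
  assumes n: "1 \<le> n1" "1 \<le> n2" and q: "0 < q1" "q1 \<le> p" "ereal p \<le> q2"
    and u: "\<And>i. i < n1 \<Longrightarrow> u i \<in> B" and v: "\<And>l. l < n2 \<Longrightarrow> v l \<in> Lp_fun p m"
    and le: "AE (x, y) in m \<Otimes>\<^sub>M m. lq_norm n2 q2 (\<lambda>l. v l x - v l y) \<le> lq_norm n1 (ereal q1) (\<lambda>i. u i x - u i y)"
  shows "\<And>l. l < n2 \<Longrightarrow> v l \<in> B"
    and "lq_norm n2 q2 (\<lambda>l. E (v l) powr (1 / p)) \<le> lq_norm n1 (ereal q1) (\<lambda>i. E (u i) powr (1 / p))"
proof -
  have q2: "0 < q2" using p q(3) by (rule exponent_pos)
  have le_N: "AE z in N \<rho>. lq_norm n2 q2 (\<lambda>l. grad (v l) z) \<le> lq_norm n1 (ereal q1) (\<lambda>i. grad (u i) z)"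
    if \<rho>: "0 < \<rho>" for \<rho>
  proof (rule AE_N[OF \<rho>])
    show "AE z in m \<Otimes>\<^sub>M m. lq_norm n2 q2 (\<lambda>l. grad (v l) z) \<le> lq_norm n1 (ereal q1) (\<lambda>i. grad (u i) z)"
      using le by (simp add: grad_def split_beta)
  qed
  have grad_v: "grad (v l) \<in> Lp_fun p (N \<rho>)" if "0 < \<rho>" "l < n2" for \<rho> l
    by (rule lq_norm_contraction(1)[where u="\<lambda>i. grad (u i)" and v="\<lambda>l. grad (v l)", OF p n q _ _ le_N[OF that(1)] that(2)])
      (auto intro!: grad_Lp u that measurable_grad Lp_fun_measurable[OF v])
  have lq: "lq_norm n2 q2 (\<lambda>l. j \<rho> (v l) powr (1 / p)) \<le> lq_norm n1 (ereal q1) (\<lambda>i. j \<rho> (u i) powr (1 / p))"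
    if \<rho>: "0 < \<rho>" for \<rho>
    unfolding j_def
    by (rule lq_norm_contraction(2)[where u="\<lambda>i. grad (u i)" and v="\<lambda>l. grad (v l)", OF p n q _ _ le_N[OF \<rho>]])
      (auto intro!: grad_Lp u \<rho> measurable_grad Lp_fun_measurable[OF v])
  show vB: "v l \<in> B" if l: "l < n2" for l
  proof (rule BI(1))
    show "v l \<in> Lp_fun p m" by (rule v[OF l])
    fix \<rho> :: real assume \<rho>: "0 < \<rho>"
    show "grad (v l) \<in> Lp_fun p (N \<rho>)" by (rule grad_v[OF \<rho> l])
    let ?c = "lq_norm n1 (ereal q1) (\<lambda>i. S (u i) powr (1 / p))"
    have "j \<rho> (v l) powr (1 / p) = \<bar>j \<rho> (v l) powr (1 / p)\<bar>" by simp
    also have "\<dots> \<le> lq_norm n2 q2 (\<lambda>l. j \<rho> (v l) powr (1 / p))" by (rule abs_le_lq_norm[OF l q2])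
    also have "\<dots> \<le> lq_norm n1 (ereal q1) (\<lambda>i. j \<rho> (u i) powr (1 / p))" by (rule lq[OF \<rho>])
    also have "\<dots> \<le> ?c"
      using q p by (intro lq_norm_mono) (auto intro!: powr_mono2 j_nonneg j_le_S u \<rho>)
    finally have "(j \<rho> (v l) powr (1 / p)) powr p \<le> ?c powr p" using p by (intro powr_mono2) auto
    then show "j \<rho> (v l) \<le> ?c powr p" using p j_nonneg by (simp add: powr_powr)
  qed
  show "lq_norm n2 q2 (\<lambda>l. E (v l) powr (1 / p)) \<le> lq_norm n1 (ereal q1) (\<lambda>i. E (u i) powr (1 / p))"
  proof (rule LIMSEQ_le)
    show "(\<lambda>n. lq_norm n2 q2 (\<lambda>l. j (r n) (v l) powr (1 / p))) \<longlonglongrightarrow> lq_norm n2 q2 (\<lambda>l. E (v l) powr (1 / p))"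
      using p j_nonneg by (intro tendsto_lq_norm n q2 tendsto_powr2 E_limit vB tendsto_const) auto
    show "(\<lambda>n. lq_norm n1 (ereal q1) (\<lambda>i. j (r n) (u i) powr (1 / p))) \<longlonglongrightarrow> lq_norm n1 (ereal q1) (\<lambda>i. E (u i) powr (1 / p))"
      using p q j_nonneg by (intro tendsto_lq_norm n tendsto_powr2 E_limit u tendsto_const) auto
  qed (use lq[OF r_pos] in auto)
qed

lemma E_GC: "GC p B E"
  unfolding GC_def
proof (intro allI impI)
  fix n1 n2 :: nat and q1 :: real and q2 :: ereal and T :: "(nat \<Rightarrow> real) \<Rightarrow> nat \<Rightarrow> real" and u :: "nat \<Rightarrow> 'a \<Rightarrow> real"
  assume n: "1 \<le> n1" "1 \<le> n2" and q: "0 < q1" "q1 \<le> p" "ereal p \<le> q2"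
    and T0: "\<forall>l<n2. T (\<lambda>_. 0) l = 0"
    and T: "\<forall>x y. lq_norm n2 q2 (\<lambda>l. T x l - T y l) \<le> lq_norm n1 (ereal q1) (\<lambda>i. x i - y i)"
    and u: "\<forall>i<n1. u i \<in> B"
  let ?v = "\<lambda>l z. T (\<lambda>i. u i z) l"
  have u': "u i \<in> B" if "i < n1" for i using u that by blast
  have L: "?v l \<in> Lp_fun p m" if "l < n2" for l
    by (rule contraction_compose_Lp[where T=T and u=u, OF n q _ _ _ that]) (use T0 T u in \<open>auto intro: B_Lp\<close>)
  have le: "AE (x, y) in m \<Otimes>\<^sub>M m. lq_norm n2 q2 (\<lambda>l. ?v l x - ?v l y) \<le> lq_norm n1 (ereal q1) (\<lambda>i. u i x - u i y)"
    using T by (intro AE_I2) auto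
  show "(\<forall>l<n2. ?v l \<in> B) \<and> lq_norm n2 q2 (\<lambda>l. E (?v l) powr (1 / p)) \<le> lq_norm n1 (ereal q1) (\<lambda>i. E (u i) powr (1 / p))"
  proof (intro conjI allI impI)
    show "?v l \<in> B" if "l < n2" for l
      by (rule E_contraction(1)[where u=u and v="?v", OF n q _ _ le that]) (auto intro: u' L)
    show "lq_norm n2 q2 (\<lambda>l. E (?v l) powr (1 / p)) \<le> lq_norm n1 (ereal q1) (\<lambda>i. E (u i) powr (1 / p))"
      by (rule E_contraction(2)[where u=u and v="?v", OF n q _ _ le]) (auto intro: u' L)
  qed
qed

abbreviation A :: "nat \<Rightarrow> ('a \<Rightarrow> real) \<Rightarrow> ('a \<Rightarrow> real) \<Rightarrow> real" where
  "A n f g \<equiv> ppair p (N (r n)) (grad f) (grad g)"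

text \<open>Limits of derivatives apply twice: to the energies along the sequence, and to a constant
  sequence, which identifies the derivative of a single energy.\<close>

lemma E_derivative:
  assumes f: "f \<in> B" and g: "g \<in> B"
  shows "((\<lambda>t. E (\<lambda>x. f x + t * g x)) has_real_derivative p * E2 f g) (at 0)"
    and "(\<lambda>n. A n f g) \<longlonglongrightarrow> E2 f g"
    and "form_deriv p (\<lambda>u. enn2real (J p m k (r n) u)) f g = A n f g"
proof -
  define \<alpha> where "\<alpha> = min (p - 1) 1"
  have \<alpha>: "0 < \<alpha>" using p by (simp add: \<alpha>_def)
  obtain M where M: "\<And>\<rho> t. 0 < \<rho> \<Longrightarrow> \<bar>t\<bar> \<le> 1 \<Longrightarrow>
    \<bar>j \<rho> (\<lambda>x. f x + t * g x) - j \<rho> f - t * (p * ppair p (N \<rho>) (grad f) (grad g))\<bar> \<le> M * \<bar>t\<bar> powr (1 + \<alpha>)"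
    using j_Taylor[OF f g] unfolding \<alpha>_def by blast
  have line: "(\<lambda>x. f x + t * g x) \<in> B" for t by (intro B_add B_cmult f g)
  have "\<exists>D'. (\<lambda>n. p * A n f g) \<longlonglongrightarrow> D' \<and> ((\<lambda>t. E (\<lambda>x. f x + t * g x)) has_real_derivative D') (at 0)"
    by (rule derivative_of_limit[where F="\<lambda>n t. j (r n) (\<lambda>x. f x + t * g x)" and \<alpha>=\<alpha> and M=M])
      (use M r_pos \<alpha> line E_limit in auto)
  then obtain D' where D': "(\<lambda>n. p * A n f g) \<longlonglongrightarrow> D'"
    "((\<lambda>t. E (\<lambda>x. f x + t * g x)) has_real_derivative D') (at 0)" by blast
  then have E2: "E2 f g = D' / p" by (simp add: E2_def form_deriv_def DERIV_imp_deriv)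
  show "((\<lambda>t. E (\<lambda>x. f x + t * g x)) has_real_derivative p * E2 f g) (at 0)"
    using D'(2) p by (simp add: E2)
  have "(\<lambda>n. p * A n f g / p) \<longlonglongrightarrow> D' / p" using p by (intro tendsto_divide D' tendsto_const) auto
  then show "(\<lambda>n. A n f g) \<longlonglongrightarrow> E2 f g" using p by (simp add: E2)
  have "\<exists>D'. (\<lambda>i::nat. p * A n f g) \<longlonglongrightarrow> D' \<and> ((\<lambda>t. j (r n) (\<lambda>x. f x + t * g x)) has_real_derivative D') (at 0)"
    by (rule derivative_of_limit[where F="\<lambda>i t. j (r n) (\<lambda>x. f x + t * g x)" and \<alpha>=\<alpha> and M=M])
      (use M r_pos \<alpha> in auto)
  then have "((\<lambda>t. j (r n) (\<lambda>x. f x + t * g x)) has_real_derivative p * A n f g) (at 0)"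
    by (auto dest: LIMSEQ_unique[OF tendsto_const])
  then have "((\<lambda>t. enn2real (J p m k (r n) (\<lambda>x. f x + t * g x))) has_real_derivative p * A n f g) (at 0)"
    using line r_pos by (simp add: J_eq_j j_nonneg)
  then show "form_deriv p (\<lambda>u. enn2real (J p m k (r n) u)) f g = A n f g"
    using p by (simp add: form_deriv_def DERIV_imp_deriv)
qed

lemma E_differentiable:
  assumes f: "f \<in> B" and g: "g \<in> B"
  shows "(\<lambda>t. E (\<lambda>x. f x + t * g x)) differentiable (at t)"
proof -
  have "((\<lambda>h. E (\<lambda>x. (f x + t * g x) + h * g x)) has_real_derivative p * E2 (\<lambda>x. f x + t * g x) g) (at 0)"
    by (intro E_derivative B_add B_cmult f g)
  then have "((\<lambda>h. E (\<lambda>x. f x + (h + t) * g x)) has_real_derivative p * E2 (\<lambda>x. f x + t * g x) g) (at 0)"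
    by (simp add: algebra_simps)
  then have "((\<lambda>s. E (\<lambda>x. f x + s * g x)) has_real_derivative p * E2 (\<lambda>x. f x + t * g x) g) (at (0 + t))"
    by (subst DERIV_shift)
  then show ?thesis by (auto simp: real_differentiable_def)
qed

lemma E2_diff_le:
  assumes B: "f1 \<in> B" "f2 \<in> B" "g \<in> B"
  shows "\<bar>E2 f1 g - E2 f2 g\<bar> \<le> form_diff_const p * rpow (max (E f1) (E f2)) (max (p - 2) 0 / p)
     * rpow (E (\<lambda>x. f1 x - f2 x)) (min (p - 1) 1 / p) * rpow (E g) (1 / p)"
    (is "_ \<le> ?R E")
proof (rule LIMSEQ_le)
  show "(\<lambda>n. \<bar>A n f1 g - A n f2 g\<bar>) \<longlonglongrightarrow> \<bar>E2 f1 g - E2 f2 g\<bar>"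
    by (intro tendsto_intros E_derivative(2) B)
  show "(\<lambda>n. ?R (j (r n))) \<longlonglongrightarrow> ?R E"
    using p j_nonneg by (intro tendsto_mult tendsto_const tendsto_rpow tendsto_max E_limit B B_diff)
      (auto simp: le_max_iff_disj)
  show "\<exists>n0. \<forall>n\<ge>n0. \<bar>A n f1 g - A n f2 g\<bar> \<le> ?R (j (r n))"
    unfolding j_def grad_diff by (intro exI[of _ 0] allI impI ppair_diff_le p grad_Lp B r_pos)
qed

end

section \<open>Locality\<close>

text \<open>On the complement of each closed set competing in the definition of the support, \<open>f\<close> vanishes
  almost everywhere; by the Lindeloef property countably many of these open sets cover their union.\<close>

lemma supp_m_properties:
  fixes m :: "'a::{metric_space, second_countable_topology} measure"
  assumes sets_m: "sets m = sets borel" and f [measurable]: "f \<in> borel_measurable m"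
  shows "closed (supp_m m f)" and "AE x in m. x \<notin> supp_m m f \<longrightarrow> f x = 0"
proof -
  define P where "P = (\<lambda>F. closed F \<and> (\<integral>\<^sup>+x\<in>- F. ennreal \<bar>f x\<bar> \<partial>m) = 0)"
  have null: "(\<integral>\<^sup>+x\<in>- F. ennreal \<bar>f x\<bar> \<partial>m) = 0 \<longleftrightarrow> (AE x in m. x \<notin> F \<longrightarrow> f x = 0)" if "closed F" for F
  proof -
    have [measurable]: "- F \<in> sets m" using that by (simp add: sets_m borel_open open_Compl)
    have "(\<lambda>x. ennreal \<bar>f x\<bar> * indicator (- F) x) \<in> borel_measurable m" by measurable
    then show ?thesis by (subst nn_integral_0_iff_AE) (auto simp: indicator_def intro!: AE_cong)
  qed
  define F0 where "F0 = \<Inter>(Collect P)"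
  have "closed F0" unfolding F0_def by (rule closed_Inter) (auto simp: P_def)
  obtain G where G: "G \<subseteq> uminus ` Collect P" "countable G" "\<Union>G = \<Union>(uminus ` Collect P)"
  proof (rule Lindelof)
    show "open U" if "U \<in> uminus ` Collect P" for U using that by (auto simp: P_def)
  qed
  have F0_eq: "- F0 = \<Union>G" unfolding G(3) F0_def by auto
  have "AE x in m. \<forall>U\<in>G. x \<in> U \<longrightarrow> f x = 0"
    unfolding AE_ball_countable[OF G(2)]
  proof
    fix U assume "U \<in> G"
    then obtain F where F: "U = - F" "P F" using G(1) by auto
    then have "AE x in m. x \<notin> F \<longrightarrow> f x = 0" using null[of F] by (auto simp: P_def)
    then show "AE x in m. x \<in> U \<longrightarrow> f x = 0" using F by simp
  qed
  then have AE0: "AE x in m. x \<notin> F0 \<longrightarrow> f x = 0"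
    by (rule AE_mp) (use F0_eq in \<open>auto intro!: AE_I2\<close>)
  then have "P F0" using null[OF \<open>closed F0\<close>] \<open>closed F0\<close> by (simp add: P_def)
  moreover have "F0 \<subseteq> F" if "P F" for F using that by (auto simp: F0_def)
  ultimately have "Least P = F0" by (rule Least_equality)
  then have "supp_m m f = F0" by (simp add: supp_m_def P_def)
  then show "closed (supp_m m f)" "AE x in m. x \<notin> supp_m m f \<longrightarrow> f x = 0"
    using \<open>closed F0\<close> AE0 by simp_all
qed

lemma compact_closed_positive_distance:
  fixes A B :: "'a::metric_space set"
  assumes "compact A" "closed B" "A \<inter> B = {}"
  shows "\<exists>d>0. \<forall>x\<in>A. \<forall>y\<in>B. d \<le> dist x y"
proof (cases "A = {} \<or> B = {}")
  case True
  then show ?thesis by (intro exI[of _ 1]) auto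
next
  case False
  have "continuous_on A (\<lambda>x. infdist x B)" by (intro continuous_intros)
  then obtain x0 where x0: "x0 \<in> A" "\<And>x. x \<in> A \<Longrightarrow> infdist x0 B \<le> infdist x B"
    using continuous_attains_inf[OF assms(1)] False by blast
  have "x0 \<notin> B" using x0(1) assms(3) by blast
  then have "infdist x0 B \<noteq> 0" using in_closed_iff_infdist_zero[OF assms(2)] False by blast
  then have "0 < infdist x0 B" using infdist_nonneg[of x0 B] by simp
  moreover have "infdist x0 B \<le> dist x y" if "x \<in> A" "y \<in> B" for x y
    using x0(2)[OF that(1)] infdist_le[OF that(2), of x] by simp
  ultimately show ?thesis by blast
qed

lemma DERIV_abs_powr_at_0:
  assumes p: "1 < (p::real)"
  shows "((\<lambda>t. \<bar>t\<bar> powr p * c) has_real_derivative 0) (at 0)"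
proof -
  have lim: "((\<lambda>h::real. \<bar>h\<bar> powr (p - 1) * \<bar>c\<bar>) \<longlongrightarrow> 0) (at 0)"
  proof -
    have "((\<lambda>h::real. \<bar>h\<bar> powr (p - 1) * \<bar>c\<bar>) \<longlongrightarrow> \<bar>0\<bar> powr (p - 1) * \<bar>c\<bar>) (at 0)"
      using p by (intro tendsto_mult tendsto_const tendsto_powr2 tendsto_rabs tendsto_ident_at) auto
    then show ?thesis using p by simp
  qed
  have eq: "norm ((\<bar>0 + h\<bar> powr p * c - \<bar>0\<bar> powr p * c) / h) = \<bar>h\<bar> powr (p - 1) * \<bar>c\<bar>" if "h \<noteq> 0" for h :: real
    using that p by (simp add: powr_diff abs_mult)
  have ev: "eventually (\<lambda>h. norm ((\<bar>0 + h\<bar> powr p * c - \<bar>0\<bar> powr p * c) / h) \<le> \<bar>h\<bar> powr (p - 1) * \<bar>c\<bar>) (at (0::real))"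
    using eventually_neq_at_within[of "0::real" 0 UNIV]
  proof eventually_elim
    case (elim h)
    show ?case by (rule eq_refl[OF eq[OF elim]])
  qed
  show ?thesis unfolding DERIV_def by (rule Lim_null_comparison[OF ev lim])
qed

context kernel_energy
begin

lemma truncation_B:
  assumes f: "f \<in> B" and c: "0 \<le> c"
  shows "(\<lambda>x. max (- c) (min c (f x))) \<in> B" and "S (\<lambda>x. max (- c) (min c (f x))) \<le> S f"
proof -
  let ?g = "\<lambda>x. max (- c) (min c (f x))"
  have [measurable]: "f \<in> borel_measurable m" by (rule B_measurable[OF f])
  have meas: "?g \<in> borel_measurable m" by measurable
  have "\<bar>?g x\<bar> powr p \<le> \<bar>f x\<bar> powr p" for x using p c by (intro powr_mono2) auto
  then have L: "?g \<in> Lp_fun p m"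
    by (intro Lp_fun_dominated[OF meas _ Lp_fun_integrable[OF B_Lp[OF f]]] AE_I2)
  have le: "\<bar>grad ?g z\<bar> powr p \<le> \<bar>grad f z\<bar> powr p" for z
    using p unfolding grad_def by (intro powr_mono2) auto
  have G: "grad ?g \<in> Lp_fun p (N r)" if "0 < r" for r
    by (rule Lp_fun_dominated[OF measurable_grad[OF meas] _ Lp_fun_integrable[OF grad_Lp[OF f that]]]) (use le in auto)
  have "j r ?g \<le> S f" if "0 < r" for r
  proof -
    have "j r ?g \<le> j r f" unfolding j_def pint_def
      by (rule integral_mono[OF Lp_fun_integrable[OF G[OF that]] Lp_fun_integrable[OF grad_Lp[OF f that]] le])
    then show ?thesis using j_le_S[OF f that] by simp
  qed
  then show "?g \<in> B" "S ?g \<le> S f" using BI[OF L G] by auto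
qed

text \<open>Truncations of \<open>f\<close> are bounded, equal to \<open>a\<close> where \<open>f\<close> is, converge in \<open>L\<^sup>1\<close> and do not increase
  the energy.  The functions with the first two properties are closed under midpoints, so the
  approximation principle improves the convergence to convergence for \<open>S\<close>.\<close>

lemma bounded_approximation:
  assumes f: "f \<in> B" and \<epsilon>: "0 < \<epsilon>"
  shows "\<exists>g\<in>B. (\<exists>M. \<forall>x. \<bar>g x\<bar> \<le> M) \<and> (\<forall>x. f x = a \<longrightarrow> g x = a) \<and> S (\<lambda>x. f x - g x) \<le> \<epsilon>"
proof -
  define Q where "Q = {g \<in> B. (\<exists>M. \<forall>x. \<bar>g x\<bar> \<le> M) \<and> (\<forall>x. f x = a \<longrightarrow> g x = a)}"
  have "\<exists>g\<in>Q. S (\<lambda>x. f x - g x) \<le> \<epsilon>"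
  proof (rule near_minimiser_approximation[OF _ _ f _ \<epsilon>])
    show "Q \<subseteq> B" by (auto simp: Q_def)
    show "(\<lambda>x. (u x + v x) / 2) \<in> Q" if uv: "u \<in> Q" "v \<in> Q" for u v
    proof -
      obtain M M' where M: "\<And>x. \<bar>u x\<bar> \<le> M" "\<And>x. \<bar>v x\<bar> \<le> M'" using uv by (auto simp: Q_def)
      have "\<bar>(u x + v x) / 2\<bar> \<le> (M + M') / 2" for x
        using M(1)[of x] M(2)[of x] by (simp add: abs_le_iff)
      then have "\<exists>M. \<forall>x. \<bar>(u x + v x) / 2\<bar> \<le> M" by blast
      then show ?thesis using uv B_midpoint[of u v] unfolding Q_def by auto
    qed
    show "\<exists>g\<in>Q. dist1 g f < e \<and> limsup_energy g \<le> S f" if e: "0 < e" for e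
    proof -
      define tr where "tr = (\<lambda>(n::nat) x. max (- real n) (min (real n) (f x)))"
      have tr_B: "tr n \<in> B" and tr_S: "S (tr n) \<le> S f" for n
        unfolding tr_def by (rule truncation_B[OF f]; simp)+
      note [measurable] = borel_measurable_integrable[OF B_integrable[OF f]] borel_measurable_integrable[OF B_integrable[OF tr_B]]
      have "(\<lambda>n. dist1 (tr n) f) \<longlonglongrightarrow> (\<integral>x. 0 \<partial>\<mu>)"
        unfolding dist1_def
      proof (rule integral_dominated_convergence)
        show "AE x in \<mu>. (\<lambda>n. \<bar>tr n x - f x\<bar>) \<longlonglongrightarrow> 0"
        proof (rule AE_I2)
          fix x
          have "eventually (\<lambda>n. \<bar>f x\<bar> \<le> real n) sequentially"
            using filterlim_real_sequentially unfolding filterlim_at_top by blast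
          then have "eventually (\<lambda>n. \<bar>tr n x - f x\<bar> = 0) sequentially"
            by eventually_elim (auto simp: tr_def)
          then show "(\<lambda>n. \<bar>tr n x - f x\<bar>) \<longlonglongrightarrow> 0" by (rule tendsto_eventually)
        qed
        show "AE x in \<mu>. norm \<bar>tr n x - f x\<bar> \<le> \<bar>f x\<bar>" for n
          by (rule AE_I2) (auto simp: tr_def)
        show "integrable \<mu> (\<lambda>x. \<bar>f x\<bar>)" using B_integrable[OF f] by simp
      qed measurable
      then have "eventually (\<lambda>n. dist1 (tr n) f < e) sequentially"
        using e by (auto dest: order_tendstoD)
      moreover have "eventually (\<lambda>n. \<bar>a\<bar> \<le> real n) sequentially"
        using filterlim_real_sequentially unfolding filterlim_at_top by blast
      ultimately have "eventually (\<lambda>n. dist1 (tr n) f < e \<and> \<bar>a\<bar> \<le> real n) sequentially" by (rule eventually_conj)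
      then obtain n where n: "dist1 (tr n) f < e" "\<bar>a\<bar> \<le> real n" by (auto simp: eventually_sequentially)
      have "\<bar>tr n x\<bar> \<le> real n" for x by (auto simp: tr_def)
      moreover have "tr n x = a" if "f x = a" for x using that n(2) by (auto simp: tr_def)
      ultimately have "tr n \<in> Q" using tr_B by (auto simp: Q_def)
      moreover have "limsup_energy (tr n) \<le> S f"
      proof (rule limsup_energy_le)
        show "eventually (\<lambda>r. j r (tr n) \<le> S f) (at_right 0)"
          using eventually_at_right_less[of "0::real"]
          by eventually_elim (use j_le_S[OF tr_B] tr_S in \<open>blast intro: order_trans\<close>)
      qed
      ultimately show ?thesis using n by blast
    qed
  qed
  then show ?thesis by (auto simp: Q_def)
qed

definition off_diagonal :: "real \<Rightarrow> ('a \<times> 'a) set" where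
  "off_diagonal \<delta> = {z. \<delta> \<le> dist (fst z) (snd z)}"

lemma off_diagonal_sets: "off_diagonal \<delta> \<in> sets (m \<Otimes>\<^sub>M m)"
  unfolding sets_mm off_diagonal_def by (intro borel_closed closed_Collect_le continuous_intros)

lemma nn_integral_off_diagonal:
  assumes r: "0 < r"
  shows "(\<integral>\<^sup>+z. indicator (off_diagonal \<delta>) z \<partial>N r) = (\<integral>\<^sup>+x. (\<integral>\<^sup>+y\<in>- ball x \<delta>. k r x y \<partial>m) \<partial>m)"
proof -
  note [measurable] = off_diagonal_sets measurable_k[OF r]
  have meas: "(\<lambda>z. (case z of (x, y) \<Rightarrow> k r x y) * indicator (off_diagonal \<delta>) z) \<in> borel_measurable (m \<Otimes>\<^sub>M m)"
    by measurable
  have "(\<integral>\<^sup>+z. indicator (off_diagonal \<delta>) z \<partial>N r)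
     = (\<integral>\<^sup>+z. (case z of (x, y) \<Rightarrow> k r x y) * indicator (off_diagonal \<delta>) z \<partial>(m \<Otimes>\<^sub>M m))"
    unfolding N_def by (rule nn_integral_density[OF measurable_k[OF r]]) measurable
  also have "\<dots> = (\<integral>\<^sup>+x. \<integral>\<^sup>+y. k r x y * indicator (off_diagonal \<delta>) (x, y) \<partial>m \<partial>m)"
    by (subst m.nn_integral_fst[OF meas, symmetric]) simp
  also have "\<dots> = (\<integral>\<^sup>+x. (\<integral>\<^sup>+y\<in>- ball x \<delta>. k r x y \<partial>m) \<partial>m)"
    by (intro nn_integral_cong) (auto simp: off_diagonal_def indicator_def)
  finally show ?thesis .
qed

end

context limit_energy
begin

text \<open>For \<open>r\<close> so small that \<open>\<delta> r\<close> is less than the distance of the two sets, at most one of the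
  increments of \<open>f1\<close> and \<open>f2\<close> is nonzero at almost every pair closer than \<open>\<delta> r\<close>, and the integrand
  of the difference of both sides vanishes.  The remaining pairs contribute nothing in the limit
  since the functions are bounded.\<close>

lemma local_additivity_bounded:
  assumes loc: "asymptotically_local m k" and B: "f1 \<in> B" "f2 \<in> B" "g \<in> B"
    and bd: "\<And>x. \<bar>f1 x\<bar> \<le> M" "\<And>x. \<bar>f2 x\<bar> \<le> M" "\<And>x. \<bar>g x\<bar> \<le> M"
    and sep: "0 < d" "\<And>x y. x \<in> A1 \<Longrightarrow> y \<in> A2 \<Longrightarrow> d \<le> dist x y"
    and c1: "AE x in m. x \<notin> A1 \<longrightarrow> f1 x = a1" and c2: "AE x in m. x \<notin> A2 \<longrightarrow> f2 x = a2"
  shows "E (\<lambda>x. f1 x + f2 x + g x) + E g = E (\<lambda>x. f1 x + g x) + E (\<lambda>x. f2 x + g x)"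
proof -
  obtain \<delta> :: "real \<Rightarrow> real" where \<delta>: "(\<delta> \<longlongrightarrow> 0) (at_right 0)"
    and off: "((\<lambda>r. \<integral>\<^sup>+x. (\<integral>\<^sup>+y\<in>- ball x (\<delta> r). k r x y \<partial>m) \<partial>m) \<longlongrightarrow> 0) (at_right 0)"
    using loc unfolding asymptotically_local_def by blast
  define \<kappa> where "\<kappa> = (\<lambda>r. \<integral>\<^sup>+x. (\<integral>\<^sup>+y\<in>- ball x (\<delta> r). k r x y \<partial>m) \<partial>m)"
  have M: "0 \<le> M" using bd(1) abs_ge_zero order_trans by blast
  define \<Delta> where "\<Delta> = (\<lambda>r. j r (\<lambda>x. f1 x + f2 x + g x) + j r g - j r (\<lambda>x. f1 x + g x) - j r (\<lambda>x. f2 x + g x))"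
  define G where "G = (\<lambda>z. \<bar>grad f1 z + grad f2 z + grad g z\<bar> powr p + \<bar>grad g z\<bar> powr p
     - \<bar>grad f1 z + grad g z\<bar> powr p - \<bar>grad f2 z + grad g z\<bar> powr p)"
  define R where "R = 4 * (6 * M) powr p"
  have G_le: "\<bar>G z\<bar> \<le> R" for z
  proof -
    have gr: "\<bar>grad f1 z\<bar> \<le> 2 * M" "\<bar>grad f2 z\<bar> \<le> 2 * M" "\<bar>grad g z\<bar> \<le> 2 * M"
      using bd(1)[of "fst z"] bd(1)[of "snd z"] bd(2)[of "fst z"] bd(2)[of "snd z"] bd(3)[of "fst z"] bd(3)[of "snd z"]
      by (auto simp: grad_def)
    have pw: "0 \<le> \<bar>s\<bar> powr p \<and> \<bar>s\<bar> powr p \<le> (6 * M) powr p" if "\<bar>s\<bar> \<le> 6 * M" for s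
      using that p by (auto intro!: powr_mono2)
    have "\<bar>grad f1 z + grad f2 z + grad g z\<bar> \<le> 6 * M" "\<bar>grad g z\<bar> \<le> 6 * M"
      "\<bar>grad f1 z + grad g z\<bar> \<le> 6 * M" "\<bar>grad f2 z + grad g z\<bar> \<le> 6 * M" using gr by linarith+
    note bds = this[THEN pw]
    have "\<bar>a + b - c - e\<bar> \<le> 4 * R'" if "0 \<le> a \<and> a \<le> R'" "0 \<le> b \<and> b \<le> R'" "0 \<le> c \<and> c \<le> R'" "0 \<le> e \<and> e \<le> R'"
      for a b c e R' :: real using that by linarith
    from this[OF bds] show ?thesis unfolding G_def R_def .
  qed
  have sums: "(\<lambda>x. f1 x + f2 x + g x) \<in> B" "(\<lambda>x. f1 x + g x) \<in> B" "(\<lambda>x. f2 x + g x) \<in> B"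
    by (intro B_add B)+
  have le: "ennreal \<bar>\<Delta> \<rho>\<bar> \<le> ennreal R * \<kappa> \<rho>"
    if \<rho>: "0 < \<rho>" "\<delta> \<rho> < d" for \<rho>
  proof -
    note i = Lp_fun_integrable[OF grad_Lp[OF sums(1) \<rho>(1)]] Lp_fun_integrable[OF grad_Lp[OF B(3) \<rho>(1)]]
      Lp_fun_integrable[OF grad_Lp[OF sums(2) \<rho>(1)]] Lp_fun_integrable[OF grad_Lp[OF sums(3) \<rho>(1)]]
    have iG: "integrable (N \<rho>) G" unfolding G_def using i by (simp add: grad_add)
    have "\<Delta> \<rho> = (\<integral>z. G z \<partial>N \<rho>)"
      unfolding \<Delta>_def G_def j_def pint_def using i by (simp add: grad_add)
    then have "ennreal \<bar>\<Delta> \<rho>\<bar> \<le> (\<integral>\<^sup>+z. ennreal \<bar>G z\<bar> \<partial>N \<rho>)"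
      using integral_norm_bound_ennreal[OF iG] by simp
    also have "\<dots> \<le> (\<integral>\<^sup>+z. ennreal R * indicator (off_diagonal (\<delta> \<rho>)) z \<partial>N \<rho>)"
    proof (rule nn_integral_mono_AE)
      show "AE z in N \<rho>. ennreal \<bar>G z\<bar> \<le> ennreal R * indicator (off_diagonal (\<delta> \<rho>)) z"
        using AE_N_both[OF \<rho>(1) c1] AE_N_both[OF \<rho>(1) c2]
      proof eventually_elim
        case (elim z)
        show ?case
        proof (cases "z \<in> off_diagonal (\<delta> \<rho>)")
          case True
          then show ?thesis using G_le[of z] by (simp add: ennreal_leI)
        next
          case False
          then have near: "dist (fst z) (snd z) < d" using \<rho>(2) by (simp add: off_diagonal_def)
          have "grad f1 z = 0 \<or> grad f2 z = 0"
          proof (cases "fst z \<in> A1 \<or> snd z \<in> A1")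
            case True
            then have "fst z \<notin> A2 \<and> snd z \<notin> A2"
              using near sep(1) sep(2)[of "fst z" "snd z"] sep(2)[of "snd z" "fst z"] sep(2)[of "fst z" "fst z"]
                sep(2)[of "snd z" "snd z"] by (auto simp: dist_commute)
            then show ?thesis using elim(2) by (simp add: grad_def)
          next
            case False
            then show ?thesis using elim(1) by (simp add: grad_def)
          qed
          then have "G z = 0" unfolding G_def by auto
          then show ?thesis by simp
        qed
      qed
    qed
    also have "\<dots> = ennreal R * \<kappa> \<rho>"
      using off_diagonal_sets[of "\<delta> \<rho>"] by (subst nn_integral_cmult) (auto intro!: borel_measurable_indicator simp: sets_N \<kappa>_def nn_integral_off_diagonal[OF \<rho>(1)])
    finally show ?thesis .
  qed
  have "((\<lambda>\<rho>. ennreal R * \<kappa> \<rho>) \<longlongrightarrow> ennreal R * 0) (at_right 0)"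
    by (rule ennreal_tendsto_cmult[OF _ off[folded \<kappa>_def]]) simp
  then have up: "((\<lambda>\<rho>. ennreal R * \<kappa> \<rho>) \<longlongrightarrow> 0) (at_right 0)" by simp
  have "((\<lambda>\<rho>. ennreal \<bar>\<Delta> \<rho>\<bar>) \<longlongrightarrow> ennreal 0) (at_right 0)"
    unfolding ennreal_0
  proof (rule tendsto_sandwich[OF _ _ tendsto_const up])
    show "eventually (\<lambda>\<rho>. ennreal \<bar>\<Delta> \<rho>\<bar> \<le> ennreal R * \<kappa> \<rho>) (at_right 0)"
      using order_tendstoD(2)[OF \<delta> sep(1)] eventually_at_right_less[of "0::real"]
      by eventually_elim (rule le)
  qed simp
  then have "((\<lambda>\<rho>. \<bar>\<Delta> \<rho>\<bar>) \<longlongrightarrow> 0) (at_right 0)"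
    by (subst (asm) tendsto_ennreal_iff) auto
  then have "(\<Delta> \<longlongrightarrow> 0) (at_right 0)" by (rule tendsto_rabs_zero_cancel)
  then have "(\<lambda>n. \<Delta> (r n)) \<longlonglongrightarrow> 0" using r_at_right by (rule filterlim_compose)
  moreover have "(\<lambda>n. \<Delta> (r n)) \<longlonglongrightarrow> E (\<lambda>x. f1 x + f2 x + g x) + E g - E (\<lambda>x. f1 x + g x) - E (\<lambda>x. f2 x + g x)"
    unfolding \<Delta>_def by (intro tendsto_intros E_limit sums B)
  ultimately have "E (\<lambda>x. f1 x + f2 x + g x) + E g - E (\<lambda>x. f1 x + g x) - E (\<lambda>x. f2 x + g x) = 0"
    by (rule LIMSEQ_unique[symmetric])
  then show ?thesis by simp
qed

text \<open>The root \<open>E\<^sup>1\<^sup>/\<^sup>p\<close> is Lipschitz for \<open>S\<^sup>1\<^sup>/\<^sup>p\<close>, as are the roots of the energies.\<close>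

lemma E_continuous:
  assumes f: "f \<in> B" and b: "\<And>n. b n \<in> B" and lim: "(\<lambda>n. S (\<lambda>x. f x - b n x)) \<longlonglongrightarrow> 0"
  shows "(\<lambda>n. E (b n)) \<longlonglongrightarrow> E f"
proof -
  have le: "\<bar>E (b n) powr (1 / p) - E f powr (1 / p)\<bar> \<le> S (\<lambda>x. f x - b n x) powr (1 / p)" for n
  proof (rule tendsto_upperbound)
    show "(\<lambda>i. \<bar>j (r i) (b n) powr (1 / p) - j (r i) f powr (1 / p)\<bar>) \<longlonglongrightarrow> \<bar>E (b n) powr (1 / p) - E f powr (1 / p)\<bar>"
      using p j_nonneg by (intro tendsto_rabs tendsto_diff tendsto_powr2 E_limit f b tendsto_const) auto
    show "eventually (\<lambda>i. \<bar>j (r i) (b n) powr (1 / p) - j (r i) f powr (1 / p)\<bar> \<le> S (\<lambda>x. f x - b n x) powr (1 / p)) sequentially"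
      using j_root_lipschitz[OF f b r_pos] by (intro always_eventually) (simp add: abs_minus_commute)
  qed simp
  have "(\<lambda>n. S (\<lambda>x. f x - b n x) powr (1 / p)) \<longlonglongrightarrow> 0 powr (1 / p)"
    using p S_nonneg by (intro tendsto_powr2 lim tendsto_const) auto
  then have "(\<lambda>n. S (\<lambda>x. f x - b n x) powr (1 / p)) \<longlonglongrightarrow> 0" by simp
  then have "(\<lambda>n. E (b n) powr (1 / p) - E f powr (1 / p)) \<longlonglongrightarrow> 0"
    by (rule Lim_null_comparison[rotated]) (simp add: le)
  then have lim': "(\<lambda>n. E (b n) powr (1 / p)) \<longlonglongrightarrow> E f powr (1 / p)" by (simp only: LIM_zero_iff)
  have "(\<lambda>n. (E (b n) powr (1 / p)) powr p) \<longlonglongrightarrow> (E f powr (1 / p)) powr p"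
    by (rule tendsto_powr2[OF lim' tendsto_const]) (use p in auto)
  then show ?thesis using p E_nonneg by (simp add: powr_powr)
qed

lemma S_add_null:
  assumes B: "f \<in> B" "g \<in> B" "\<And>n. b n \<in> B" "\<And>n. c n \<in> B"
    and lim: "(\<lambda>n. S (\<lambda>x. f x - b n x)) \<longlonglongrightarrow> 0" "(\<lambda>n. S (\<lambda>x. g x - c n x)) \<longlonglongrightarrow> 0"
  shows "(\<lambda>n. S (\<lambda>x. (f x + g x) - (b n x + c n x))) \<longlonglongrightarrow> 0"
proof -
  have "(\<lambda>n. 2 powr p * (S (\<lambda>x. f x - b n x) + S (\<lambda>x. g x - c n x))) \<longlonglongrightarrow> 2 powr p * (0 + 0)"
    by (intro tendsto_intros lim)
  then have lim0: "(\<lambda>n. 2 powr p * (S (\<lambda>x. f x - b n x) + S (\<lambda>x. g x - c n x))) \<longlonglongrightarrow> 0" by simp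
  show ?thesis
  proof (rule Lim_null_comparison[OF _ lim0], intro always_eventually allI)
    fix n
    have "S (\<lambda>x. (f x - b n x) + (g x - c n x)) \<le> 2 powr p * (S (\<lambda>x. f x - b n x) + S (\<lambda>x. g x - c n x))"
      by (intro S_add B_diff B)
    moreover have "(\<lambda>x. (f x + g x) - (b n x + c n x)) = (\<lambda>x. (f x - b n x) + (g x - c n x))" by (auto simp: algebra_simps)
    ultimately show "norm (S (\<lambda>x. (f x + g x) - (b n x + c n x))) \<le> 2 powr p * (S (\<lambda>x. f x - b n x) + S (\<lambda>x. g x - c n x))"
      using S_nonneg by simp
  qed
qed

lemma bounded_approximating_sequence:
  assumes f: "f \<in> B"
  shows "\<exists>b. (\<forall>n. b n \<in> B) \<and> (\<forall>n. \<exists>M. \<forall>x. \<bar>b n x\<bar> \<le> M) \<and> (\<forall>n x. f x = a \<longrightarrow> b n x = a) \<and>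
    (\<lambda>n. S (\<lambda>x. f x - b n x)) \<longlonglongrightarrow> 0"
proof -
  have "\<exists>g. g \<in> B \<and> (\<exists>M. \<forall>x. \<bar>g x\<bar> \<le> M) \<and> (\<forall>x. f x = a \<longrightarrow> g x = a) \<and> S (\<lambda>x. f x - g x) \<le> inverse (real (Suc n))" for n
    using bounded_approximation[OF f, of "inverse (real (Suc n))" a] by auto
  then obtain b where b: "\<And>n. b n \<in> B" "\<And>n. \<exists>M. \<forall>x. \<bar>b n x\<bar> \<le> M" "\<And>n x. f x = a \<Longrightarrow> b n x = a"
    "\<And>n. S (\<lambda>x. f x - b n x) \<le> inverse (real (Suc n))" by metis
  have "(\<lambda>n. S (\<lambda>x. f x - b n x)) \<longlonglongrightarrow> 0"
    by (rule tendsto_sandwich[OF _ _ tendsto_const LIMSEQ_inverse_real_of_nat])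
      (use b(4) S_nonneg in \<open>auto intro!: always_eventually\<close>)
  then show ?thesis using b by blast
qed

text \<open>This follows from disjointness of the supports of \<open>f - a\<close> and \<open>g - b\<close>, one of them compact, and
  unlike it is plainly preserved when the functions are scaled, also by 0.\<close>

definition separated :: "('a \<Rightarrow> real) \<Rightarrow> ('a \<Rightarrow> real) \<Rightarrow> bool" where
  "separated f g \<longleftrightarrow> (\<exists>d>0. \<exists>A1 A2 a b. (\<forall>x\<in>A1. \<forall>y\<in>A2. d \<le> dist x y) \<and>
     (AE x in m. x \<notin> A1 \<longrightarrow> f x = a) \<and> (AE x in m. x \<notin> A2 \<longrightarrow> g x = b))"

lemma separated_scale:
  assumes "separated f g"
  shows "separated (\<lambda>x. s * f x) (\<lambda>x. t * g x)"
proof -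
  obtain d A1 A2 a b where *: "0 < d" "\<forall>x\<in>A1. \<forall>y\<in>A2. d \<le> dist x y"
    "AE x in m. x \<notin> A1 \<longrightarrow> f x = a" "AE x in m. x \<notin> A2 \<longrightarrow> g x = b"
    using assms unfolding separated_def by blast
  have "AE x in m. x \<notin> A1 \<longrightarrow> s * f x = s * a" "AE x in m. x \<notin> A2 \<longrightarrow> t * g x = t * b"
    using *(3,4) by (eventually_elim, simp)+
  then show ?thesis using *(1,2) unfolding separated_def by blast
qed

lemma local_additivity:
  assumes loc: "asymptotically_local m k" and B: "f1 \<in> B" "f2 \<in> B" "g \<in> B" and sep: "separated f1 f2"
  shows "E (\<lambda>x. f1 x + f2 x + g x) + E g = E (\<lambda>x. f1 x + g x) + E (\<lambda>x. f2 x + g x)"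
proof -
  obtain d A1 A2 a1 a2 where d: "0 < d" "\<And>x y. x \<in> A1 \<Longrightarrow> y \<in> A2 \<Longrightarrow> d \<le> dist x y"
    and c1: "AE x in m. x \<notin> A1 \<longrightarrow> f1 x = a1" and c2: "AE x in m. x \<notin> A2 \<longrightarrow> f2 x = a2"
    using sep unfolding separated_def by blast
  obtain b1 where b1: "\<And>n. b1 n \<in> B" "\<And>n. \<exists>M. \<forall>x. \<bar>b1 n x\<bar> \<le> M" "\<And>n x. f1 x = a1 \<Longrightarrow> b1 n x = a1"
    and l1: "(\<lambda>n. S (\<lambda>x. f1 x - b1 n x)) \<longlonglongrightarrow> 0" using bounded_approximating_sequence[OF B(1), of a1] by blast
  obtain b2 where b2: "\<And>n. b2 n \<in> B" "\<And>n. \<exists>M. \<forall>x. \<bar>b2 n x\<bar> \<le> M" "\<And>n x. f2 x = a2 \<Longrightarrow> b2 n x = a2"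
    and l2: "(\<lambda>n. S (\<lambda>x. f2 x - b2 n x)) \<longlonglongrightarrow> 0" using bounded_approximating_sequence[OF B(2), of a2] by blast
  obtain c where c: "\<And>n. c n \<in> B" "\<And>n. \<exists>M. \<forall>x. \<bar>c n x\<bar> \<le> M"
    and lc: "(\<lambda>n. S (\<lambda>x. g x - c n x)) \<longlonglongrightarrow> 0" using bounded_approximating_sequence[OF B(3)] by blast
  have eq: "E (\<lambda>x. b1 n x + b2 n x + c n x) + E (c n) = E (\<lambda>x. b1 n x + c n x) + E (\<lambda>x. b2 n x + c n x)" for n
  proof -
    obtain M1 M2 M3 where M: "\<And>x. \<bar>b1 n x\<bar> \<le> M1" "\<And>x. \<bar>b2 n x\<bar> \<le> M2" "\<And>x. \<bar>c n x\<bar> \<le> M3"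
      using b1(2) b2(2) c(2) by metis
    let ?M = "max M1 (max M2 M3)"
    have bd: "\<bar>b1 n x\<bar> \<le> ?M" "\<bar>b2 n x\<bar> \<le> ?M" "\<bar>c n x\<bar> \<le> ?M" for x
      using M(1)[of x] M(2)[of x] M(3)[of x] by linarith+
    have c1': "AE x in m. x \<notin> A1 \<longrightarrow> b1 n x = a1" using c1 by eventually_elim (use b1(3) in auto)
    have c2': "AE x in m. x \<notin> A2 \<longrightarrow> b2 n x = a2" using c2 by eventually_elim (use b2(3) in auto)
    show ?thesis
      by (rule local_additivity_bounded[OF loc b1(1) b2(1) c(1) bd d c1' c2'])
  qed
  note l12 = S_add_null[OF B(1,2) b1(1) b2(1) l1 l2]
  have "(\<lambda>n. E (\<lambda>x. b1 n x + b2 n x + c n x) + E (c n)) \<longlonglongrightarrow> E (\<lambda>x. f1 x + f2 x + g x) + E g"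
    by (intro tendsto_add E_continuous B_add B b1(1) b2(1) c(1) lc S_add_null[OF _ _ _ _ l12 lc])
  moreover have "(\<lambda>n. E (\<lambda>x. b1 n x + c n x) + E (\<lambda>x. b2 n x + c n x)) \<longlonglongrightarrow> E (\<lambda>x. f1 x + g x) + E (\<lambda>x. f2 x + g x)"
    by (intro tendsto_add E_continuous B_add B b1(1) b2(1) c(1) S_add_null[OF B(1,3) b1(1) c(1) l1 lc]
        S_add_null[OF B(2,3) b2(1) c(1) l2 lc])
  ultimately show ?thesis unfolding eq by (rule LIMSEQ_unique)
qed

lemma E_scaled_derivative_0:
  assumes "g \<in> B"
  shows "((\<lambda>t. E (\<lambda>x. t * g x)) has_real_derivative 0) (at 0)"
  unfolding E_cmult[OF assms] by (rule DERIV_abs_powr_at_0[OF p])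

text \<open>Replace \<open>g\<close> by \<open>t g\<close> and differentiate at \<open>t = 0\<close>, where \<open>E (t g) = |t|\<^sup>p E g\<close> has derivative 0
  since \<open>p > 1\<close>.\<close>

lemma local_derivative_additivity:
  assumes loc: "asymptotically_local m k" and B: "f1 \<in> B" "f2 \<in> B" "g \<in> B" and sep: "separated f1 f2"
  shows "E2 (\<lambda>x. f1 x + f2 x) g = E2 f1 g + E2 f2 g"
proof -
  have "E (\<lambda>x. (f1 x + f2 x) + t * g x) + E (\<lambda>x. t * g x) = E (\<lambda>x. f1 x + t * g x) + E (\<lambda>x. f2 x + t * g x)" for t
    by (rule local_additivity[OF loc B(1,2) B_cmult[OF B(3)] sep])
  then have eq: "(\<lambda>t. E (\<lambda>x. (f1 x + f2 x) + t * g x) + E (\<lambda>x. t * g x)) = (\<lambda>t. E (\<lambda>x. f1 x + t * g x) + E (\<lambda>x. f2 x + t * g x))"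
    by blast
  have "((\<lambda>t. E (\<lambda>x. (f1 x + f2 x) + t * g x) + E (\<lambda>x. t * g x)) has_real_derivative p * E2 (\<lambda>x. f1 x + f2 x) g + 0) (at 0)"
    by (intro DERIV_add E_derivative(1) E_scaled_derivative_0 B_add B)
  moreover have "((\<lambda>t. E (\<lambda>x. f1 x + t * g x) + E (\<lambda>x. f2 x + t * g x)) has_real_derivative p * E2 f1 g + p * E2 f2 g) (at 0)"
    by (intro DERIV_add E_derivative(1) B)
  ultimately have "p * E2 (\<lambda>x. f1 x + f2 x) g + 0 = p * E2 f1 g + p * E2 f2 g"
    unfolding eq by (rule DERIV_unique)
  then have "p * E2 (\<lambda>x. f1 x + f2 x) g = p * (E2 f1 g + E2 f2 g)" by (simp add: algebra_simps)
  then show ?thesis using p by simp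
qed

text \<open>Both identities differentiate additivity for the pair \<open>f1 - f2\<close>, \<open>g\<close> in a parameter \<open>t\<close> that
  scales one member of the pair; \<open>f2\<close>, respectively \<open>t f2\<close>, is the third function.\<close>

lemma local_derivative_cong:
  assumes loc: "asymptotically_local m k" and B: "f1 \<in> B" "f2 \<in> B" "g \<in> B"
    and sep: "separated (\<lambda>x. f1 x - f2 x) g"
  shows "E2 f1 g = E2 f2 g" and "E2 g f1 = E2 g f2"
proof -
  let ?h = "\<lambda>x. f1 x - f2 x"
  have h: "?h \<in> B" by (rule B_diff[OF B(1,2)])
  have "E (\<lambda>x. ?h x + t * g x + f2 x) + E f2 = E (\<lambda>x. ?h x + f2 x) + E (\<lambda>x. t * g x + f2 x)" for t
    by (rule local_additivity[OF loc h B_cmult[OF B(3)] B(2)])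
      (use separated_scale[OF sep, of 1 t] in simp)
  then have eq: "(\<lambda>t. E (\<lambda>x. f1 x + t * g x) + E f2) = (\<lambda>t. E f1 + E (\<lambda>x. f2 x + t * g x))"
    by (simp add: algebra_simps)
  have "((\<lambda>t. E (\<lambda>x. f1 x + t * g x) + E f2) has_real_derivative p * E2 f1 g + 0) (at 0)"
    by (intro DERIV_add E_derivative(1) DERIV_const B)
  moreover have "((\<lambda>t. E f1 + E (\<lambda>x. f2 x + t * g x)) has_real_derivative 0 + p * E2 f2 g) (at 0)"
    by (intro DERIV_add E_derivative(1) DERIV_const B)
  ultimately have "p * E2 f1 g + 0 = 0 + p * E2 f2 g" unfolding eq by (rule DERIV_unique)
  then show "E2 f1 g = E2 f2 g" using p by simp
  have "E (\<lambda>x. t * ?h x + g x + t * f2 x) + E (\<lambda>x. t * f2 x) = E (\<lambda>x. t * ?h x + t * f2 x) + E (\<lambda>x. g x + t * f2 x)" for t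
    by (rule local_additivity[OF loc B_cmult[OF h] B(3) B_cmult[OF B(2)]])
      (use separated_scale[OF sep, of t 1] in simp)
  then have eq': "(\<lambda>t. E (\<lambda>x. g x + t * f1 x) + E (\<lambda>x. t * f2 x)) = (\<lambda>t. E (\<lambda>x. t * f1 x) + E (\<lambda>x. g x + t * f2 x))"
    by (simp add: algebra_simps)
  have "((\<lambda>t. E (\<lambda>x. g x + t * f1 x) + E (\<lambda>x. t * f2 x)) has_real_derivative p * E2 g f1 + 0) (at 0)"
    by (intro DERIV_add E_derivative(1) E_scaled_derivative_0 B)
  moreover have "((\<lambda>t. E (\<lambda>x. t * f1 x) + E (\<lambda>x. g x + t * f2 x)) has_real_derivative 0 + p * E2 g f2) (at 0)"
    by (intro DERIV_add E_derivative(1) E_scaled_derivative_0 B)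
  ultimately have "p * E2 g f1 + 0 = 0 + p * E2 g f2" unfolding eq' by (rule DERIV_unique)
  then show "E2 g f1 = E2 g f2" using p by simp
qed

lemma disjoint_supports_separated:
  assumes uv: "u \<in> B" "v \<in> B"
    and disj: "supp_m m (\<lambda>x. u x - a) \<inter> supp_m m (\<lambda>x. v x - b) = {}"
    and comp: "compact (supp_m m (\<lambda>x. u x - a)) \<or> compact (supp_m m (\<lambda>x. v x - b))"
  shows "separated u v"
proof -
  let ?A1 = "supp_m m (\<lambda>x. u x - a)" and ?A2 = "supp_m m (\<lambda>x. v x - b)"
  have meas: "(\<lambda>x. u x - a) \<in> borel_measurable m" "(\<lambda>x. v x - b) \<in> borel_measurable m"
    using uv[THEN B_measurable] by measurable
  note s1 = supp_m_properties[OF sets_m meas(1)] and s2 = supp_m_properties[OF sets_m meas(2)]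
  have "\<exists>d>0. \<forall>x\<in>?A1. \<forall>y\<in>?A2. d \<le> dist x y"
    using comp
  proof
    assume "compact ?A1"
    then show ?thesis by (rule compact_closed_positive_distance[OF _ s2(1) disj])
  next
    assume "compact ?A2"
    moreover have "?A2 \<inter> ?A1 = {}" using disj by blast
    ultimately have "\<exists>d>0. \<forall>y\<in>?A2. \<forall>x\<in>?A1. d \<le> dist y x"
      by (intro compact_closed_positive_distance s1(1))
    then show ?thesis by (metis dist_commute)
  qed
  moreover have "AE x in m. x \<notin> ?A1 \<longrightarrow> u x = a" "AE x in m. x \<notin> ?A2 \<longrightarrow> v x = b"
    using s1(2) s2(2) by simp_all
  ultimately show ?thesis unfolding separated_def by blast
qed

end

theorem theorem3p8:
  fixes p C :: real
    and m :: "'a::{metric_space, second_countable_topology} measure"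
    and k :: "real \<Rightarrow> 'a \<Rightarrow> 'a \<Rightarrow> ennreal"
  assumes p: "1 < p"
    and two_points: "\<exists>x y::'a. x \<noteq> y"
    and m: "admissible_measure m"
    and k: "kernel_family k"
    and WM: "weak_monotonicity p m k C"
  shows
    "(\<forall>r'::nat \<Rightarrow> real. (\<forall>n. 0 < r' n) \<longrightarrow> r' \<longlonglongrightarrow> 0 \<longrightarrow>
        (\<exists>s::nat \<Rightarrow> nat. strict_mono s \<and> limit_exists p m k (r' \<circ> s)))
     \<and>
     (\<forall>r::nat \<Rightarrow> real. (\<forall>n. 0 < r n) \<longrightarrow> r \<longlonglongrightarrow> 0 \<longrightarrow> limit_exists p m k r \<longrightarrow>
       (let B = B_space p m k;
            E = limit_form p m k r;
            E2 = form_deriv p E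
        in
        \<comment> \<open>(a)\<close>
        (p_energy_form p m B E \<and>
         (\<forall>f\<in>B. ennreal (1 / C) * (SUP r\<in>{0<..}. J p m k r f) \<le> ennreal (E f) \<and>
                ennreal (E f) \<le> ennreal C * Liminf (at_right 0) (\<lambda>r. J p m k r f)) \<and>
         (emeasure m UNIV < \<infinity> \<longrightarrow> (\<lambda>_. 1) \<in> B \<and> E (\<lambda>_. 1) = 0))
        \<and>
        \<comment> \<open>(b)\<close>
        (GC p B E \<and>
         (\<forall>f\<in>B. \<forall>g\<in>B.
            (\<forall>t::real. (\<lambda>t. E (\<lambda>x. f x + t * g x)) differentiable (at t)) \<and>
            (\<lambda>n. form_deriv p (\<lambda>u. enn2real (J p m k (r n) u)) f g) \<longlonglongrightarrow> E2 f g))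
        \<and>
        \<comment> \<open>(c)\<close>
        (\<forall>(n1::nat) (n2::nat) (q1::real) (q2::ereal)
           (u::nat \<Rightarrow> 'a \<Rightarrow> real) (v::nat \<Rightarrow> 'a \<Rightarrow> real).
           1 \<le> n1 \<longrightarrow> 1 \<le> n2 \<longrightarrow> 0 < q1 \<longrightarrow> q1 \<le> p \<longrightarrow> ereal p \<le> q2 \<longrightarrow>
           (\<forall>i<n1. u i \<in> B) \<longrightarrow> (\<forall>l<n2. v l \<in> Lp_fun p m) \<longrightarrow>
           (AE (x, y) in m \<Otimes>\<^sub>M m.
              lq_norm n2 q2 (\<lambda>l. v l x - v l y) \<le> lq_norm n1 (ereal q1) (\<lambda>i. u i x - u i y)) \<longrightarrow>
           (\<forall>l<n2. v l \<in> B) \<and>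
           lq_norm n2 q2 (\<lambda>l. E (v l) powr (1 / p)) \<le> lq_norm n1 (ereal q1) (\<lambda>i. E (u i) powr (1 / p)))
        \<and>
        \<comment> \<open>(d)\<close>
        (0 < form_diff_const p \<and>
         (\<forall>f1\<in>B. \<forall>f2\<in>B. \<forall>g\<in>B.
            \<bar>E2 f1 g - E2 f2 g\<bar> \<le>
              form_diff_const p * rpow (max (E f1) (E f2)) (max (p - 2) 0 / p)
                * rpow (E (\<lambda>x. f1 x - f2 x)) (min (p - 1) 1 / p) * rpow (E g) (1 / p)))
        \<and>
        \<comment> \<open>(e)\<close>
        (asymptotically_local m k \<longrightarrow>
          (\<forall>f1\<in>B. \<forall>f2\<in>B. \<forall>g\<in>B. \<forall>a1 a2::real.
             supp_m m (\<lambda>x. f1 x - a1) \<inter> supp_m m (\<lambda>x. f2 x - a2) = {} \<longrightarrow>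
             compact (supp_m m (\<lambda>x. f1 x - a1)) \<or> compact (supp_m m (\<lambda>x. f2 x - a2)) \<longrightarrow>
             E (\<lambda>x. f1 x + f2 x + g x) + E g = E (\<lambda>x. f1 x + g x) + E (\<lambda>x. f2 x + g x) \<and>
             E2 (\<lambda>x. f1 x + f2 x) g = E2 f1 g + E2 f2 g) \<and>
          (\<forall>f1\<in>B. \<forall>f2\<in>B. \<forall>g\<in>B. \<forall>a b::real.
             supp_m m (\<lambda>x. f1 x - f2 x - a) \<inter> supp_m m (\<lambda>x. g x - b) = {} \<longrightarrow>
             compact (supp_m m (\<lambda>x. f1 x - f2 x - a)) \<or> compact (supp_m m (\<lambda>x. g x - b)) \<longrightarrow>
             E2 f1 g = E2 f2 g \<and> E2 g f1 = E2 g f2))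
        \<and>
        \<comment> \<open>(f)\<close>
        (\<forall>T::'a \<Rightarrow> 'a.
           (\<forall>A\<in>sets borel. T -` A \<in> sets borel \<and> emeasure m (T -` A) = emeasure m A) \<longrightarrow>
           (\<forall>\<rho>>0. AE (x, y) in m \<Otimes>\<^sub>M m. k \<rho> (T x) (T y) = k \<rho> x y) \<longrightarrow>
           (\<forall>f\<in>B. f \<circ> T \<in> B \<and> E (f \<circ> T) = E f))))"
proof -
  have "sigma_finite_measure m" using m by (simp add: admissible_measure_def)
  then obtain \<mu> where \<mu>: "finite_measure \<mu>" "sets \<mu> = sets m"
    "\<forall>P. (AE x in \<mu>. P x) \<longleftrightarrow> (AE x in m. P x)" "\<forall>f\<in>Lp_fun p m. integrable \<mu> f"
    using equivalent_finite_measure[of m p] p by auto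
  interpret kernel_energy p C m k \<mu>
    unfolding kernel_energy_def using p m k WM \<mu> by blast
  show ?thesis
    apply (intro conjI allI impI)
    subgoal for r' by (rule convergent_subsequence) blast
    subgoal premises r for r
    proof -
      interpret limit_energy p C m k \<mu> r
        using r by unfold_locales blast+
      show ?thesis
        unfolding Let_def E_def[symmetric] E2_def[symmetric]
        apply (intro conjI)
        subgoal by (rule E_p_energy_form)
        subgoal using E_comparable by blast
        subgoal using E_constant by blast
        subgoal by (rule E_GC)
        subgoal by (simp add: E_differentiable E_derivative(2,3))
        subgoal
        proof (intro allI impI)
          fix n1 n2 :: nat and q1 :: real and q2 :: ereal and u v :: "nat \<Rightarrow> 'a \<Rightarrow> real"
          assume n: "1 \<le> n1" "1 \<le> n2" and q: "0 < q1" "q1 \<le> p" "ereal p \<le> q2"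
            and u: "\<forall>i<n1. u i \<in> B" and v: "\<forall>l<n2. v l \<in> Lp_fun p m"
            and le: "AE (x, y) in m \<Otimes>\<^sub>M m.
              lq_norm n2 q2 (\<lambda>l. v l x - v l y) \<le> lq_norm n1 (ereal q1) (\<lambda>i. u i x - u i y)"
          show "(\<forall>l<n2. v l \<in> B) \<and>
            lq_norm n2 q2 (\<lambda>l. E (v l) powr (1 / p)) \<le> lq_norm n1 (ereal q1) (\<lambda>i. E (u i) powr (1 / p))"
            using E_contraction(1)[where u=u and v=v, OF n q _ _ le] E_contraction(2)[where u=u and v=v, OF n q _ _ le] u v
            by blast
        qed
        subgoal by (rule form_diff_const_pos[OF p])
        subgoal using E2_diff_le by blast
        subgoal
          by (intro impI conjI ballI allI)
            (assumption | rule local_additivity local_derivative_additivity local_derivative_cong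
              disjoint_supports_separated B_diff)+
        subgoal
        proof (intro allI impI ballI)
          fix T :: "'a \<Rightarrow> 'a" and f
          assume T: "\<forall>A\<in>sets borel. T -` A \<in> sets borel \<and> emeasure m (T -` A) = emeasure m A"
            and kT: "\<forall>\<rho>>0. AE (x, y) in m \<Otimes>\<^sub>M m. k \<rho> (T x) (T y) = k \<rho> x y" and f: "f \<in> B"
          note inv = invariant_compose[OF T[rule_format] kT[rule_format] f]
          show "f \<circ> T \<in> B \<and> E (f \<circ> T) = E f"
            using inv r_pos by (auto intro: E_cong)
        qed
        done
    qed
    done
qed

end
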